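(* There exist absolute constants $0<c\le C<\infty$ such that for every finite positive Borel measure $\mu$ on the unit circle $\mathbb{T}$ and every $z\in\mathbb{D}$, $$c\left(1+\int_0^{|z|}\frac{dr}{(1-r)P[\mu](rz/|z|)+(1-r)^2}\right)\le k^\mu(z,z)\le C\left(1+\int_0^{|z|}\frac{dr}{(1-r)P[\mu](rz/|z|)+(1-r)^2}\right),$$ where $k^\mu$ is the reproducing kernel of the Dirichlet type space $\mathcal{D}(\mu)$ (for $z=0$ the integral is understood to be $0$).
   Context: $\mathbb{D}$ is the open unit disc and $\mathbb{T}=\partial\mathbb{D}$. $H^2$ is the Hardy space of analytic functions $f=\sum a_nz^n$ on $\mathbb{D}$ with $\|f\|_{H^2}^2=\sum|a_n|^2<\infty$. For a finite positive Borel measure $\mu$ on $\mathbb{T}$, $P[\mu](z)=\int_{\mathbb{T}}\frac{1-|z|^2}{|\zeta-z|^2}\,d\mu(\zeta)$ for $z\in\mathbb{D}$. For $f\in H^2$ put $$\mathcal{D}_\mu(f)=\frac1{2\pi}\int_{\mathbb{T}}\int_{\mathbb{T}}\frac{|f(\zeta)-f(\xi)|^2}{|\zeta-\xi|^2}\,|d\zeta|\,d\mu(\xi),$$ where $f(\xi)$ denotes the non-tangential limit of $f$ at $\xi$ (the inner integral in $\zeta$ is taken to be $+\infty$ at points $\xi$ where this limit does not exist); equivalently $\mathcal{D}_\mu(f)=\int_{\mathbb{D}}|f'(z)|^2P[\mu](z)\,dA(z)$ with $dA=dx\,dy/\pi$. The Dirichlet type space is $\mathcal{D}(\mu)=\{f\in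 H^2:\mathcal{D}_\mu(f)<\infty\}$ with norm $\|f\|_\mu^2=\|f\|_{H^2}^2+\mathcal{D}_\mu(f)$. It is a Hilbert space, and its reproducing kernel $k^\mu$ is defined by $f(z)=\langle f,k^\mu(\cdot,z)\rangle$ for $f\in\mathcal{D}(\mu)$, $z\in\mathbb{D}$; in particular $k^\mu(z,z)=\sup\{|f(z)|^2: f\in\mathcal{D}(\mu),\ \|f\|_\mu\le1\}$. *)

theory Defs
  imports "HOL-Complex_Analysis.Complex_Analysis"
begin

text \<open>Functions on the open unit disc are total functions of which only the values on
  \<^term>\<open>ball 0 1 :: complex set\<close> matter; measures on the unit circle are measures whose
  underlying space is \<^term>\<open>sphere 0 1 :: complex set\<close>.\<close>

definition circle_measure :: "complex measure \<Rightarrow> bool" where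
  "circle_measure \<mu> \<longleftrightarrow>
     finite_measure \<mu> \<and> sets \<mu> = sets (restrict_space borel (sphere 0 1))"

definition poisson :: "complex measure \<Rightarrow> complex \<Rightarrow> real" where
  "poisson \<mu> z = (LINT \<zeta>|\<mu>. (1 - (norm z)\<^sup>2) / (norm (\<zeta> - z))\<^sup>2)"

definition taylor_coeff :: "(complex \<Rightarrow> complex) \<Rightarrow> nat \<Rightarrow> complex" where
  "taylor_coeff f n = (deriv ^^ n) f 0 / fact n"

definition hardy2 :: "(complex \<Rightarrow> complex) set" where
  "hardy2 = {f. f holomorphic_on ball 0 1 \<and> summable (\<lambda>n. (norm (taylor_coeff f n))\<^sup>2)}"

definition stolz :: "complex \<Rightarrow> real \<Rightarrow> complex set" where
  "stolz \<xi> M = {z \<in> ball 0 1. norm (z - \<xi>) < M * (1 - norm z)}"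

definition has_nt_limit :: "(complex \<Rightarrow> complex) \<Rightarrow> complex \<Rightarrow> complex \<Rightarrow> bool" where
  "has_nt_limit f \<xi> L \<longleftrightarrow> (\<forall>M>1. (f \<longlongrightarrow> L) (at \<xi> within stolz \<xi> M))"

text \<open>The boundary value; unspecified where the non-tangential limit does not exist.\<close>

definition nt_lim :: "(complex \<Rightarrow> complex) \<Rightarrow> complex \<Rightarrow> complex" where
  "nt_lim f \<xi> = (THE L. has_nt_limit f \<xi> L)"

text \<open>The inner integral over the circle uses \<open>\<zeta> = cis t\<close>, so that \<open>|d\<zeta>| = dt\<close>. The integrand
  at the single point \<open>\<zeta> = \<xi>\<close> is 0 by the convention for division by zero.\<close>

definition local_dirichlet :: "(complex \<Rightarrow> complex) \<Rightarrow> complex \<Rightarrow> ennreal" where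
  "local_dirichlet f \<xi> =
     (if \<exists>L. has_nt_limit f \<xi> L
      then (\<integral>\<^sup>+ t \<in> {0..2 * pi}.
              ennreal ((norm (nt_lim f (cis t) - nt_lim f \<xi>))\<^sup>2 / (norm (cis t - \<xi>))\<^sup>2) \<partial>lborel)
      else \<infinity>)"

definition dirichlet_integral :: "complex measure \<Rightarrow> (complex \<Rightarrow> complex) \<Rightarrow> ennreal" where
  "dirichlet_integral \<mu> f = ennreal (1 / (2 * pi)) * (\<integral>\<^sup>+ \<xi>. local_dirichlet f \<xi> \<partial>\<mu>)"

definition dirichlet_space :: "complex measure \<Rightarrow> (complex \<Rightarrow> complex) set" where
  "dirichlet_space \<mu> = {f \<in> hardy2. dirichlet_integral \<mu> f < \<infinity>}"

text \<open>The inner product obtained by polarization from the squared norm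
  \<open>\<parallel>f\<parallel>\<^sup>2 = (\<Sum>n. |a\<^sub>n|\<^sup>2) + dirichlet_integral \<mu> f\<close>, linear in the first argument.
  For two elements of the space the double integral converges absolutely.\<close>

definition dirichlet_inner ::
  "complex measure \<Rightarrow> (complex \<Rightarrow> complex) \<Rightarrow> (complex \<Rightarrow> complex) \<Rightarrow> complex" where
  "dirichlet_inner \<mu> f g =
     (\<Sum>n. taylor_coeff f n * cnj (taylor_coeff g n)) +
     complex_of_real (1 / (2 * pi)) *
       (LINT \<xi>|\<mu>. (LINT t:{0..2 * pi}|lborel.
          (nt_lim f (cis t) - nt_lim f \<xi>) * cnj (nt_lim g (cis t) - nt_lim g \<xi>)
            / complex_of_real ((norm (cis t - \<xi>))\<^sup>2)))"

text \<open>\<open>dirichlet_kernel \<mu> w z\<close> is the value at \<open>w\<close> of the element of the space that represents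
  evaluation at \<open>z\<close>. That element is unique as a function on the disc, so the description
  is determined for \<open>w\<close> and \<open>z\<close> in the disc.\<close>

definition dirichlet_kernel :: "complex measure \<Rightarrow> complex \<Rightarrow> complex \<Rightarrow> complex" where
  "dirichlet_kernel \<mu> w z =
     (THE v. \<exists>g \<in> dirichlet_space \<mu>.
        (\<forall>f \<in> dirichlet_space \<mu>. f z = dirichlet_inner \<mu> f g) \<and> v = g w)"

end

theory Submission imports Defs begin

text \<open>
  Write \<open>f = L + (z - \<xi>) g\<close> near a boundary point \<open>\<xi>\<close>. The Taylor coefficients of \<open>g\<close> have modulus
  \<open>|L - s\<^sub>n(\<xi>)|\<close>, where \<open>s\<^sub>n\<close> are the partial sums of \<open>f\<close>, so Fatou's theorem and Parseval's identity
  turn the local Dirichlet integral at \<open>\<xi>\<close> into \<open>2\<pi> (\<Sum>n. |L - s\<^sub>n(\<xi>)|\<^sup>2)\<close>. In this form it is lower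
  semicontinuous under convergence of coefficients; hence the squared norm attains its minimum
  on \<open>{f. f z = 1}\<close>, and the reproducing kernel at \<open>(z, z)\<close> is the reciprocal of that minimum.

  Let \<open>\<phi> = 1 / ((1 - r) P + (1 - r)\<^sup>2)\<close> along the radius through \<open>z\<close>. Both bounds rest on Hilbert's
  inequality, i.e. the boundedness of \<open>(g\<^sub>n) \<mapsto> (\<Sum>n. g\<^sub>n r\<^sup>n)\<close> from \<open>\<ell>\<^sup>2\<close> to \<open>L\<^sup>2(0,1)\<close>. For the upper bound
  it is applied to \<open>f' = g + (z - \<xi>) g'\<close> and gives \<open>(\<integral>|f'|\<^sup>2 / \<phi>) \<le> C \<parallel>f\<parallel>\<^sup>2\<close>, so that \<open>|f z - f 0|\<^sup>2\<close> is
  controlled by the Cauchy-Schwarz inequality. For the lower bound its dual form shows that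
  \<open>f w = (\<integral> \<phi> r (1 - r) / (1 - r cnj \<omega> w) dr)\<close>, taken over \<open>[0, |z|]\<close> with \<open>\<omega> = z / |z|\<close>, satisfies
  \<open>\<parallel>f\<parallel>\<^sup>2 \<le> C (\<integral>\<phi>)\<close>, while \<open>f z \<ge> (\<integral>\<phi>) / 2\<close>.
\<close>

section \<open>Hilbert's inequality\<close>

text \<open>Both bounds are proved at one boundary point \<open>\<xi>\<close> first, with constants
  independent of \<open>\<xi>\<close>. Everything compared is additive in the measure, so
  integrating against \<open>\<mu>\<close> turns
  \<open>(1 - r\<^sup>2) / |\<xi> - r \<omega>|\<^sup>2\<close> into the Poisson integral at no
  cost. For a point mass the weight fits \<open>f' = g + (z - \<xi>) g'\<close>: the factor
  \<open>|z - \<xi>|\<^sup>2\<close> cancels in the second summand and is at least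
  \<open>(1 - r)\<^sup>2\<close> in the first, which leaves \<open>|g|\<^sup>2\<close> and
  \<open>((1 - r) |g'|)\<^sup>2\<close> along the radius. The density \<open>(1 - r) \<phi>\<close>
  is chosen so that the squared norm of the test function is at most, and its value at
  \<open>z\<close> at least, a multiple of the integral of \<open>\<phi>\<close>. The obstacle is
  the form of the definitions. The Dirichlet integral is stated through nontangential limits, so
  Fatou's theorem, and with it a maximal function estimate, comes before any formula in
  coefficients. The kernel is a definite description, so a representing element has to be produced;
  a minimizing sequence, with limits taken coefficient by coefficient, provides it.\<close>

lemma hilbert_matrix_row_sum:
  fixes n N :: nat
  shows "(\<Sum>m<N. sqrt (real n + 1) / (sqrt (real m + 1) * (real n + real m + 1))) \<le> 8"
proof -
  define A where "A = sqrt (real n + 1)"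
  \<comment> \<open>an algebraic substitute for the antiderivative \<open>2 arctan (sqrt (m / (n + 1)))\<close>\<close>
  define T where "T m = sqrt (real m) / (sqrt (real m) + A)" for m :: nat
  have A: "A > 0" "A^2 = real n + 1" by (auto simp: A_def)
  have step: "A / (sqrt (real m + 1) * (real n + real m + 1)) \<le> 8 * (T (Suc m) - T m)" for m :: nat
  proof -
    define x where "x = sqrt (real m)"
    define y where "y = sqrt (real m + 1)"
    have xy: "0 \<le> x" "0 < y" "x \<le> y" "x^2 = real m" "y^2 = real m + 1"
      by (auto simp: x_def y_def)
    have d: "(y - x) * (y + x) = 1"
      using xy by (simp add: algebra_simps power2_eq_square)
    have "T (Suc m) - T m = y / (y + A) - x / (x + A)"
      by (simp add: T_def x_def y_def add.commute)
    also have "\<dots> = A * (y - x) / ((y + A) * (x + A))"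
      using xy A by (simp add: field_simps)
    also have "y - x = 1 / (y + x)"
      using d xy by (simp add: field_simps)
    finally have T: "T (Suc m) - T m = A / ((y + x) * ((y + A) * (x + A)))" by simp
    \<comment> \<open>The 8 is made of three factors 2: from \<open>x \<le> y\<close>, from
      \<open>(y + A)\<^sup>2 \<le> 2 (y\<^sup>2 + A\<^sup>2)\<close>, and from
      \<open>n + m + 2 \<le> 2 (n + m + 1)\<close>.\<close>
    have "(y + x) * ((y + A) * (x + A)) \<le> (2 * y) * ((y + A) * (y + A))"
      using xy A by (intro mult_mono) auto
    also have "(y + A) * (y + A) \<le> 2 * (y^2 + A^2)"
      using zero_le_power2[of "y - A"] by (simp add: power2_eq_square algebra_simps)
    also have "2 * (y^2 + A^2) \<le> 4 * (real n + real m + 1)"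
      using xy A by simp
    finally have le: "(y + x) * ((y + A) * (x + A)) \<le> 8 * (y * (real n + real m + 1))"
      using xy by (simp add: algebra_simps)
    have pos: "0 < (y + x) * ((y + A) * (x + A))" using xy A by simp
    have "A / (8 * (y * (real n + real m + 1))) \<le> T (Suc m) - T m"
      unfolding T using A le pos by (intro divide_left_mono) (auto intro: mult_pos_pos xy)
    moreover have "A / (8 * (y * (real n + real m + 1))) = A / (y * (real n + real m + 1)) / 8"
      by simp
    moreover have "X \<le> 8 * D" if "X / 8 \<le> D" for X D :: real
      using that by simp
    ultimately have "A / (y * (real n + real m + 1)) \<le> 8 * (T (Suc m) - T m)"
      by (simp only:)
    then show ?thesis by (simp add: y_def add_ac)
  qed
  have "(\<Sum>m<N. A / (sqrt (real m + 1) * (real n + real m + 1))) \<le> (\<Sum>m<N. 8 * (T (Suc m) - T m))"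
    by (intro sum_mono step)
  also have "\<dots> = 8 * (T N - T 0)"
    by (simp only: sum_distrib_left [symmetric] sum_lessThan_telescope)
  also have "\<dots> \<le> 8"
  proof -
    have "0 < sqrt (real N) + A" using A by (intro add_nonneg_pos) auto
    then have "T N \<le> 1" using A by (simp add: T_def divide_le_eq_1)
    then show ?thesis by (simp add: T_def)
  qed
  finally show ?thesis by (simp add: A_def add.commute)
qed

text \<open>Schur's test. The plain rows of the matrix have divergent sums; splitting each entry by
  the arithmetic-geometric mean with the ratio of \<open>sqrt (n + 1)\<close> and
  \<open>sqrt (m + 1)\<close> produces the weighted rows, whose sums are uniformly bounded. The
  constant is not sharp.\<close>

lemma hilbert_inequality:
  fixes c :: "nat \<Rightarrow> real"
  assumes "\<And>n. 0 \<le> c n"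
  shows "(\<Sum>n<N. \<Sum>m<N. c n * c m / (real n + real m + 1)) \<le> 8 * (\<Sum>n<N. (c n)\<^sup>2)"
proof -
  define w where "w n m = sqrt (real n + 1) / (sqrt (real m + 1) * (real n + real m + 1))" for n m :: nat
  have bound: "c n * c m / (real n + real m + 1) \<le> (c n)\<^sup>2 / 2 * w n m + (c m)\<^sup>2 / 2 * w m n" for n m
  proof -
    define a where "a = sqrt (real n + 1)"
    define b where "b = sqrt (real m + 1)"
    have ab: "a > 0" "b > 0" by (auto simp: a_def b_def)
    have "2 * (c n * c m) \<le> (c n)\<^sup>2 * (a / b) + (c m)\<^sup>2 * (b / a)"
      using ab zero_le_power2[of "c n * a - c m * b"]
      by (simp add: field_simps power2_eq_square)
    then have "2 * (c n * c m) / (real n + real m + 1) \<le>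
        ((c n)\<^sup>2 * (a / b) + (c m)\<^sup>2 * (b / a)) / (real n + real m + 1)"
      by (intro divide_right_mono) auto
    moreover have "((c n)\<^sup>2 * (a / b) + (c m)\<^sup>2 * (b / a)) / D
        = 2 * ((c n)\<^sup>2 / 2 * (a / (b * D)) + (c m)\<^sup>2 / 2 * (b / (a * D)))" for D
      by (simp add: add_divide_distrib)
    ultimately have "2 * (c n * c m) / (real n + real m + 1)
        \<le> 2 * ((c n)\<^sup>2 / 2 * w n m + (c m)\<^sup>2 / 2 * w m n)"
      by (simp only: w_def a_def b_def add.commute[of "real m" "real n"])
    then show ?thesis by simp
  qed
  have row: "(\<Sum>m<N. w n m) \<le> 8" for n
    using hilbert_matrix_row_sum[of n N] by (simp add: w_def add_ac)
  have "(\<Sum>n<N. \<Sum>m<N. c n * c m / (real n + real m + 1))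
      \<le> (\<Sum>n<N. \<Sum>m<N. (c n)\<^sup>2 / 2 * w n m + (c m)\<^sup>2 / 2 * w m n)"
    by (intro sum_mono bound)
  also have "\<dots> = (\<Sum>n<N. \<Sum>m<N. (c n)\<^sup>2 / 2 * w n m) + (\<Sum>n<N. \<Sum>m<N. (c m)\<^sup>2 / 2 * w m n)"
    by (simp add: sum.distrib)
  also have "(\<Sum>n<N. \<Sum>m<N. (c m)\<^sup>2 / 2 * w m n) = (\<Sum>n<N. \<Sum>m<N. (c n)\<^sup>2 / 2 * w n m)"
    by (rule sum.swap)
  also have "(\<Sum>n<N. \<Sum>m<N. (c n)\<^sup>2 / 2 * w n m) = (\<Sum>n<N. (c n)\<^sup>2 / 2 * (\<Sum>m<N. w n m))"
    by (simp add: sum_distrib_left)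
  also have "\<dots> + \<dots> \<le> (\<Sum>n<N. (c n)\<^sup>2 / 2 * 8) + (\<Sum>n<N. (c n)\<^sup>2 / 2 * 8)"
    by (intro add_mono sum_mono mult_left_mono row) auto
  also have "\<dots> = 8 * (\<Sum>n<N. (c n)\<^sup>2)"
    by (simp add: sum_distrib_left flip: sum.distrib)
  finally show ?thesis .
qed

text \<open>The functions are nonnegative, so after expanding the square it is enough that their
  Gram matrix is dominated entrywise by the Hilbert matrix. In this generality the estimate serves
  both the monomials and their weighted derivatives.\<close>

lemma nn_integral_hilbert_partial:
  fixes c :: "nat \<Rightarrow> real" and e :: "nat \<Rightarrow> 'a \<Rightarrow> real"
  assumes c: "\<And>n. 0 \<le> c n"
    and e[measurable]: "\<And>n. e n \<in> borel_measurable M"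
    and e0: "\<And>n x. 0 \<le> e n x"
    and ee: "\<And>n m. (\<integral>\<^sup>+x. ennreal (e n x * e m x) \<partial>M) \<le> ennreal (1 / (real n + real m + 1))"
  shows "(\<integral>\<^sup>+x. ennreal ((\<Sum>n<N. c n * e n x)\<^sup>2) \<partial>M) \<le> ennreal (8 * (\<Sum>n<N. (c n)\<^sup>2))"
proof -
  have "(\<integral>\<^sup>+x. ennreal ((\<Sum>n<N. c n * e n x)\<^sup>2) \<partial>M) =
      (\<integral>\<^sup>+x. (\<Sum>n<N. \<Sum>m<N. ennreal (c n * c m) * ennreal (e n x * e m x)) \<partial>M)"
    using c e0
    by (intro nn_integral_cong)
      (simp add: power2_eq_square sum_product sum_ennreal sum_nonneg mult_ac flip: ennreal_mult)
  also have "\<dots> = (\<Sum>n<N. \<Sum>m<N. ennreal (c n * c m) * (\<integral>\<^sup>+x. ennreal (e n x * e m x) \<partial>M))"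
    by (simp add: nn_integral_sum nn_integral_cmult)
  also have "\<dots> \<le> (\<Sum>n<N. \<Sum>m<N. ennreal (c n * c m) * ennreal (1 / (real n + real m + 1)))"
    using ee by (intro sum_mono mult_left_mono) auto
  also have "\<dots> = ennreal (\<Sum>n<N. \<Sum>m<N. c n * c m / (real n + real m + 1))"
    using c by (simp add: sum_ennreal sum_nonneg flip: ennreal_mult)
  also have "\<dots> \<le> ennreal (8 * (\<Sum>n<N. (c n)\<^sup>2))"
    using hilbert_inequality[of c N, OF c] by (intro ennreal_leI) simp
  finally show ?thesis .
qed

lemma power2_suminf_ennreal:
  fixes a :: "nat \<Rightarrow> ennreal"
  shows "(\<Sum>n. a n)\<^sup>2 = (SUP N. (\<Sum>n<N. a n)\<^sup>2)"
proof -
  have inc: "incseq (\<lambda>N. \<Sum>n<N. a n)"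
    by (intro incseq_SucI) simp
  have "(\<lambda>N. (\<Sum>n<N. a n)\<^sup>2) \<longlonglongrightarrow> (\<Sum>n. a n)\<^sup>2"
    unfolding power2_eq_square
    by (intro tendsto_mult_ennreal summable_LIMSEQ) auto
  moreover have "incseq (\<lambda>N. (\<Sum>n<N. a n)\<^sup>2)"
    using inc by (auto simp: incseq_def intro!: power_mono)
  ultimately show ?thesis
    using LIMSEQ_SUP LIMSEQ_unique by blast
qed

text \<open>With values in \<open>ennreal\<close> the passage from partial sums is monotone
  convergence, and the right-hand side may be infinite.\<close>

lemma nn_integral_hilbert:
  fixes c :: "nat \<Rightarrow> real" and e :: "nat \<Rightarrow> 'a \<Rightarrow> real"
  assumes c: "\<And>n. 0 \<le> c n"
    and e[measurable]: "\<And>n. e n \<in> borel_measurable M"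
    and e0: "\<And>n x. 0 \<le> e n x"
    and ee: "\<And>n m. (\<integral>\<^sup>+x. ennreal (e n x * e m x) \<partial>M) \<le> ennreal (1 / (real n + real m + 1))"
  shows "(\<integral>\<^sup>+x. (\<Sum>n. ennreal (c n * e n x))\<^sup>2 \<partial>M) \<le> 8 * (\<Sum>n. ennreal ((c n)\<^sup>2))"
proof -
  have "(\<integral>\<^sup>+x. (\<Sum>n. ennreal (c n * e n x))\<^sup>2 \<partial>M)
      = (\<integral>\<^sup>+x. (SUP N. (\<Sum>n<N. ennreal (c n * e n x))\<^sup>2) \<partial>M)"
    by (simp only: power2_suminf_ennreal)
  also have "\<dots> = (SUP N. (\<integral>\<^sup>+x. (\<Sum>n<N. ennreal (c n * e n x))\<^sup>2 \<partial>M))"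
    by (intro nn_integral_monotone_convergence_SUP incseq_SucI le_funI power_mono) auto
  also have "\<dots> \<le> 8 * (\<Sum>n. ennreal ((c n)\<^sup>2))"
  proof (intro SUP_least)
    fix N
    have "(\<integral>\<^sup>+x. (\<Sum>n<N. ennreal (c n * e n x))\<^sup>2 \<partial>M) = (\<integral>\<^sup>+x. ennreal ((\<Sum>n<N. c n * e n x)\<^sup>2) \<partial>M)"
      using c e0 by (intro nn_integral_cong) (simp add: sum_ennreal ennreal_power sum_nonneg)
    also have "\<dots> \<le> ennreal (8 * (\<Sum>n<N. (c n)\<^sup>2))"
      by (rule nn_integral_hilbert_partial[OF assms])
    also have "\<dots> = 8 * (\<Sum>n<N. ennreal ((c n)\<^sup>2))"
      by (simp add: ennreal_mult sum_nonneg sum_ennreal)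
    also have "\<dots> \<le> 8 * (\<Sum>n. ennreal ((c n)\<^sup>2))"
      by (intro mult_left_mono sum_le_suminf) auto
    finally show "(\<integral>\<^sup>+x. (\<Sum>n<N. ennreal (c n * e n x))\<^sup>2 \<partial>M) \<le> 8 * (\<Sum>n. ennreal ((c n)\<^sup>2))" .
  qed
  finally show ?thesis .
qed

text \<open>The dual form: the adjoint of \<open>c \<mapsto> \<Sum> c\<^sub>n e\<^sub>n\<close> has
  the same norm. The synthesis bound is applied to the moments \<open>b\<close> themselves, whose
  square sum equals the integral of \<open>h B\<close>.\<close>

lemma suminf_moments_le:
  fixes e :: "nat \<Rightarrow> 'a \<Rightarrow> real" and h :: "'a \<Rightarrow> real"
  assumes e[measurable]: "\<And>n. e n \<in> borel_measurable M"
    and e0: "\<And>n x. 0 \<le> e n x"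
    and ee: "\<And>n m. (\<integral>\<^sup>+x. ennreal (e n x * e m x) \<partial>M) \<le> ennreal (1 / (real n + real m + 1))"
    and h: "integrable M (\<lambda>x. (h x)\<^sup>2)" "\<And>x. 0 \<le> h x" "\<And>n. integrable M (\<lambda>x. h x * e n x)"
  shows "(\<Sum>n. ennreal ((LINT x|M. h x * e n x)\<^sup>2)) \<le> ennreal (8 * (LINT x|M. (h x)\<^sup>2))"
proof (rule suminf_le_const)
  fix N
  define b where "b n = (LINT x|M. h x * e n x)" for n
  define B where "B x = (\<Sum>n<N. b n * e n x)" for x
  have b0: "0 \<le> b n" for n
    using h e0 by (auto simp: b_def intro!: integral_nonneg_AE)
  have B0: "0 \<le> B x" for x
    using b0 e0 by (auto simp: B_def intro!: sum_nonneg)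
  have B[measurable]: "B \<in> borel_measurable M" unfolding B_def by measurable
  have BB: "(\<integral>\<^sup>+x. ennreal ((B x)\<^sup>2) \<partial>M) \<le> ennreal (8 * (\<Sum>n<N. (b n)\<^sup>2))"
    unfolding B_def using b0 e e0 ee by (intro nn_integral_hilbert_partial) auto
  have iB: "integrable M (\<lambda>x. (B x)\<^sup>2)"
    using BB by (intro integrableI_bounded) (auto simp: less_top[symmetric] top_unique)
  have LB: "(LINT x|M. (B x)\<^sup>2) \<le> 8 * (\<Sum>n<N. (b n)\<^sup>2)"
    using BB iB by (subst (asm) nn_integral_eq_integral) (auto simp: sum_nonneg)
  have hB: "h x * B x = (\<Sum>n<N. b n * (h x * e n x))" for x
    unfolding B_def sum_distrib_left by (intro sum.cong) (auto simp: mult_ac)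
  have "(\<Sum>n<N. (b n)\<^sup>2) = (LINT x|M. h x * B x)"
    using h unfolding hB by (simp add: power2_eq_square flip: b_def)
  \<comment> \<open>The weights 4 and 1/16 are tuned to the constant 8: the term in \<open>B\<close>
    then contributes at most half of the square sum of \<open>b\<close>, which is absorbed on the
    left, and twice 4 gives back 8.\<close>
  also have "\<dots> \<le> (LINT x|M. 4 * (h x)\<^sup>2 + (B x)\<^sup>2 / 16)"
  proof (intro integral_mono)
    show "integrable M (\<lambda>x. h x * B x)"
      using h by (simp add: hB)
    show "integrable M (\<lambda>x. 4 * (h x)\<^sup>2 + (B x)\<^sup>2 / 16)"
      using h iB by auto
    show "h x * B x \<le> 4 * (h x)\<^sup>2 + (B x)\<^sup>2 / 16" for x
      using zero_le_power2[of "2 * h x - B x / 4"] by (simp add: power2_eq_square algebra_simps)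
  qed
  also have "\<dots> = 4 * (LINT x|M. (h x)\<^sup>2) + (LINT x|M. (B x)\<^sup>2) / 16"
    using h iB by simp
  finally have "(\<Sum>n<N. (b n)\<^sup>2) \<le> 8 * (LINT x|M. (h x)\<^sup>2)"
    using LB by linarith
  then show "(\<Sum>n<N. ennreal ((LINT x|M. h x * e n x)\<^sup>2)) \<le> ennreal (8 * (LINT x|M. (h x)\<^sup>2))"
    by (simp add: sum_ennreal b_def ennreal_leI)
qed auto

section \<open>Gram matrices of monomials and of their weighted derivatives on the unit
  interval\<close>

lemma nn_integral_FTC_unit:
  fixes F f :: "real \<Rightarrow> real"
  assumes "\<And>x. (F has_real_derivative f x) (at x)" "\<And>x. x \<in> {0..1} \<Longrightarrow> 0 \<le> f x"
    and [measurable]: "f \<in> borel_measurable borel"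
  shows "(\<integral>\<^sup>+x. ennreal (f x) * indicator {0..1} x \<partial>lborel) = ennreal (F 1 - F 0)"
  using assms by (intro nn_integral_FTC_Icc) (auto intro: DERIV_subset)

lemma monomials_gram:
  fixes n m :: nat
  defines "e \<equiv> \<lambda>(n::nat) r. indicator {0..1} r * r ^ n :: real"
  shows "(\<integral>\<^sup>+r. ennreal (e n r * e m r) \<partial>lborel) \<le> ennreal (1 / (real n + real m + 1))"
proof -
  have "(\<integral>\<^sup>+r. ennreal (e n r * e m r) \<partial>lborel) = (\<integral>\<^sup>+r. ennreal (r ^ (n + m)) * indicator {0..1} r \<partial>lborel)"
    by (intro nn_integral_cong) (simp add: e_def power_add indicator_def)
  also have "\<dots> = ennreal (1 ^ (n + m + 1) / real (n + m + 1) - 0 ^ (n + m + 1) / real (n + m + 1))"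
    by (rule nn_integral_FTC_unit) (auto intro!: derivative_eq_intros simp del: power_Suc)
  finally show ?thesis by (simp add: add_ac)
qed

text \<open>The factor \<open>1 - r\<close> makes up for the growth of the derivative. The integral
  is a Beta value, \<open>2 n m / ((n + m - 1) (n + m) (n + m + 1))\<close>, and
  \<open>2 n m \<le> (n + m)\<^sup>2 / 2 \<le> (n + m - 1) (n + m)\<close> for positive
  \<open>n\<close> and \<open>m\<close>.\<close>

lemma weighted_monomial_derivs_gram:
  fixes n m :: nat
  defines "e \<equiv> \<lambda>(n::nat) r. indicator {0..1} r * ((1 - r) * (real n * r ^ (n - 1))) :: real"
  shows "(\<integral>\<^sup>+r. ennreal (e n r * e m r) \<partial>lborel) \<le> ennreal (1 / (real n + real m + 1))"
proof (cases "n = 0 \<or> m = 0")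
  case True
  then have "e n r * e m r = 0" for r by (auto simp: e_def)
  then show ?thesis by (simp only:) simp
next
  case False
  then obtain k l where kl: "n = Suc k" "m = Suc l" by (meson not0_implies_Suc)
  define j where "j = k + l"
  define F where "F r = real n * real m * (r ^ (j+1) / (j+1) - 2 * r ^ (j+2) / (j+2) + r ^ (j+3) / (j+3))" for r :: real
  have "(\<integral>\<^sup>+r. ennreal (e n r * e m r) \<partial>lborel) =
      (\<integral>\<^sup>+r. ennreal (real n * real m * (r ^ j - 2 * r ^ (j + 1) + r ^ (j + 2))) * indicator {0..1} r \<partial>lborel)"
    by (intro nn_integral_cong)
      (auto simp: e_def indicator_def kl j_def power_add power2_eq_square algebra_simps intro!: arg_cong[where f=ennreal])
  also have "\<dots> = ennreal (F 1 - F 0)"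
  proof (rule nn_integral_FTC_unit)
    show "(F has_real_derivative real n * real m * (r ^ j - 2 * r ^ (j + 1) + r ^ (j + 2))) (at r)" for r
    proof -
      have "((\<lambda>r. r ^ (k + 1) / real (k + 1)) has_real_derivative r ^ k) (at r)" for k
        by (auto intro!: derivative_eq_intros simp del: power_Suc)
      from this[of j] this[of "j+1"] this[of "j+2"] show ?thesis
        unfolding F_def
        by (auto intro!: DERIV_cmult DERIV_add DERIV_diff simp: eval_nat_numeral
            simp flip: times_divide_eq_right)
    qed
    show "0 \<le> real n * real m * (r ^ j - 2 * r ^ (j + 1) + r ^ (j + 2))" if "r \<in> {0..1}" for r
    proof -
      have "r ^ j - 2 * r ^ (j + 1) + r ^ (j + 2) = r ^ j * (1 - r)\<^sup>2"
        by (simp add: power2_eq_square algebra_simps power_add)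
      then show ?thesis using that by simp
    qed
  qed auto
  also have "F 1 - F 0 \<le> 1 / (real n + real m + 1)"
  proof -
    have "F 1 - F 0 = real n * real m * (1 / (j+1) - 2 / (j+2) + 1 / (j+3))"
      by (simp add: F_def)
    also have "1 / real (j+1) - 2 / real (j+2) + 1 / real (j+3) = 2 / (real (j+1) * real (j+2) * real (j+3))"
    proof -
      have "1 / (x+1) - 2 / (x+2) + 1 / (x+3) = 2 / ((x+1) * (x+2) * (x+3))" if "0 \<le> x" for x :: real
        using that by (simp add: divide_simps) (simp add: algebra_simps)
      from this[of "real j"] show ?thesis by (simp add: add_ac)
    qed
    also have "real n * real m * (2 / (real (j+1) * real (j+2) * real (j+3))) \<le> 1 / real (j+3)"
    proof -
      have "2 * (real n * real m) \<le> real (j+1) * real (j+2)"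
      proof -
        have "2 * (real n * real m) \<le> (real n + real m)\<^sup>2 / 2"
          using zero_le_power2[of "real n - real m"] by (simp add: power2_eq_square algebra_simps)
        also have "real n + real m = real (j + 2)" by (simp add: kl j_def)
        also have "(real (j+2))\<^sup>2 / 2 \<le> real (j+1) * real (j+2)"
          by (simp add: power2_eq_square algebra_simps)
        finally show ?thesis .
      qed
      then show ?thesis
        by (simp add: field_simps del: of_nat_add of_nat_Suc)
    qed
    finally show ?thesis by (simp add: kl j_def add_ac)
  qed
  finally show ?thesis by (simp add: ennreal_leI)
qed

section \<open>Arc length measure and the nontangential maximal function\<close>

abbreviation circ :: "complex measure" where
  "circ \<equiv> restrict_space borel (sphere 0 1)"

text \<open>Not normalized: the total mass is \<open>2 * pi\<close>, the source of the factors
  \<open>2 * pi\<close> in all Fourier formulas below. Both ends of the interval are sent to 1,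
  which is a null set.\<close>

definition arclen :: "complex measure" where
  "arclen = distr (restrict_space lborel {0..2 * pi}) circ cis"

lemma space_circ [simp]: "space circ = sphere 0 1"
  by (simp add: space_restrict_space)

lemma sets_arclen [measurable_cong, simp]: "sets arclen = sets circ"
  by (simp add: arclen_def)

lemma space_arclen [simp]: "space arclen = sphere 0 1"
  by (simp add: arclen_def)

lemma measurable_cis_circ [measurable]: "cis \<in> restrict_space lborel A \<rightarrow>\<^sub>M circ"
  by (intro measurable_restrict_space1 measurable_restrict_space2)
    (auto intro!: borel_measurable_continuous_onI continuous_intros)

lemma measurable_circI:
  "continuous_on (sphere 0 1) F \<Longrightarrow> F \<in> borel_measurable circ"
  by (rule borel_measurable_continuous_on_restrict)

lemma nn_integral_arclen:
  assumes "F \<in> borel_measurable circ"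
  shows "(\<integral>\<^sup>+\<zeta>. F \<zeta> \<partial>arclen) = (\<integral>\<^sup>+t \<in> {0..2*pi}. F (cis t) \<partial>lborel)"
  using assms unfolding arclen_def
  by (simp add: nn_integral_distr nn_integral_restrict_space)

lemma integral_arclen:
  fixes F :: "complex \<Rightarrow> 'b :: {banach, second_countable_topology}"
  assumes "F \<in> borel_measurable circ"
  shows "(LINT \<zeta>|arclen. F \<zeta>) = (LINT t:{0..2*pi}|lborel. F (cis t))"
  using assms unfolding arclen_def
  by (simp add: integral_distr integral_restrict_space set_lebesgue_integral_def)

lemma emeasure_arclen_space: "emeasure arclen (sphere 0 1) = ennreal (2 * pi)"
proof -
  have "emeasure arclen (sphere 0 1) = emeasure (restrict_space lborel {0..2*pi}) {0..2*pi}"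
    unfolding arclen_def by (subst emeasure_distr) (auto simp: sets_restrict_space intro!: arg_cong2[where f=emeasure])
  also have "\<dots> = ennreal (2 * pi)"
    by (subst emeasure_restrict_space) auto
  finally show ?thesis .
qed

lemma finite_measure_arclen: "finite_measure arclen"
  by (intro finite_measureI) (simp add: emeasure_arclen_space)

lemma integrable_arclen_continuous:
  fixes F :: "complex \<Rightarrow> 'b :: {banach, second_countable_topology}"
  assumes "continuous_on (sphere 0 1) F"
  shows "integrable arclen F"
proof -
  interpret finite_measure arclen by (rule finite_measure_arclen)
  have "bounded (F ` sphere 0 1)"
    using assms by (intro compact_imp_bounded compact_continuous_image) auto
  then obtain B where "\<forall>x\<in>sphere 0 1. norm (F x) \<le> B" by (auto simp: bounded_iff)
  then show ?thesis
    using measurable_circI[OF assms] measurable_cong_sets[OF sets_arclen refl]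
    by (intro integrable_const_bound[where B=B] AE_I2) auto
qed

text \<open>On the unit circle \<open>dz = i \<zeta> |d\<zeta>|\<close>; this is the origin of the
  factor \<open>\<zeta>\<close> on the left and of \<open>- \<i>\<close> on the right.\<close>

lemma contour_integral_arclen:
  fixes f :: "complex \<Rightarrow> complex"
  assumes "(f has_contour_integral I) (circlepath 0 1)" "continuous_on (sphere 0 1) f"
  shows "(LINT \<zeta>|arclen. f \<zeta> * \<zeta>) = - \<i> * I"
proof -
  have cf: "continuous_on {0..2*pi} (\<lambda>t. f (cis t))"
    by (rule continuous_on_compose2[OF assms(2)]) (auto intro!: continuous_intros)
  have "((\<lambda>t. f (0 + 1 * cis t) * 1 * \<i> * cis t) has_integral I) {0..2*pi}"
    using assms(1) unfolding circlepath_def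
    by (subst (asm) has_contour_integral_part_circlepath_iff) auto
  moreover have "set_integrable lborel {0..2*pi} (\<lambda>t. f (cis t) * \<i> * cis t)"
    by (rule borel_integrable_atLeastAtMost') (auto intro!: continuous_intros cf)
  ultimately have "(LINT t:{0..2*pi}|lborel. f (cis t) * \<i> * cis t) = I"
    by (subst set_borel_integral_eq_integral) (auto simp: integral_unique)
  moreover have "(LINT t:{0..2*pi}|lborel. f (cis t) * \<i> * cis t) = \<i> * (LINT t:{0..2*pi}|lborel. f (cis t) * cis t)"
    by (subst set_integral_mult_right[symmetric]) (simp add: mult_ac)
  ultimately have "(LINT t:{0..2*pi}|lborel. f (cis t) * cis t) = - \<i> * I"
    by (auto simp: algebra_simps)
  then show ?thesis
    by (subst integral_arclen) (auto intro!: measurable_circI continuous_intros assms)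
qed

lemma cnj_circle: "norm \<zeta> = 1 \<Longrightarrow> cnj \<zeta> = inverse \<zeta>"
  using complex_norm_square[of \<zeta>] by (intro inverse_unique[symmetric]) simp

lemma integral_arclen_orthogonal:
  "(LINT \<zeta>|arclen. \<zeta> ^ n * cnj \<zeta> ^ m) = (if n = m then 2 * of_real pi else 0)"
proof (cases "n = m")
  case True
  interpret finite_measure arclen by (rule finite_measure_arclen)
  have "(LINT \<zeta>|arclen. \<zeta> ^ n * cnj \<zeta> ^ m) = (LINT \<zeta>|arclen. 1)"
  proof (rule Bochner_Integration.integral_cong[OF refl])
    fix \<zeta> assume "\<zeta> \<in> space arclen"
    then have "norm \<zeta> = 1" "\<zeta> \<noteq> 0" by auto
    then show "\<zeta> ^ n * cnj \<zeta> ^ m = 1"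
      using True by (simp add: cnj_circle flip: power_mult_distrib)
  qed
  also have "\<dots> = of_real (measure arclen (sphere 0 1))" by (simp add: scaleR_conv_of_real)
  finally show ?thesis using True by (simp add: measure_def emeasure_arclen_space)
next
  case False
  define k where "k = int n - int m"
  have "(LINT \<zeta>|arclen. \<zeta> ^ n * cnj \<zeta> ^ m) = (LINT t:{0..2*pi}|lborel. cis t ^ n * cnj (cis t) ^ m)"
    by (subst integral_arclen) (auto intro!: measurable_circI continuous_intros)
  also have "\<dots> = (LINT t:{0..2*pi}|lborel. cis (of_int k * t))"
  proof (intro set_lebesgue_integral_cong allI impI)
    fix t
    have "cis t ^ n * cnj (cis t) ^ m = cis (real n * t) * cis (real m * (- t))"
      by (simp only: cis_cnj Complex.DeMoivre)
    also have "\<dots> = cis (of_int k * t)"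
      by (simp add: cis_mult k_def algebra_simps)
    finally show "cis t ^ n * cnj (cis t) ^ m = cis (of_int k * t)" .
  qed auto
  also have "\<dots> = integral {0..2*pi} (\<lambda>t. cis (of_int k * t))"
    by (intro set_borel_integral_eq_integral borel_integrable_atLeastAtMost') (auto intro!: continuous_intros)
  also have "\<dots> = 0"
  proof (rule integral_unique)
    have k0: "k \<noteq> 0" using False by (simp add: k_def)
    have "((\<lambda>t. cis (of_int k * t)) has_integral
        (cis (of_int k * (2*pi)) / (\<i> * of_int k) - cis (of_int k * 0) / (\<i> * of_int k))) {0..2*pi}"
    proof (rule fundamental_theorem_of_calculus)
      fix t :: real
      show "((\<lambda>t. cis (of_int k * t) / (\<i> * of_int k)) has_vector_derivative cis (of_int k * t)) (at t within {0..2*pi})"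
      proof -
        have "((\<lambda>w. exp (\<i> * (of_int k * w)) / (\<i> * of_int k)) has_field_derivative exp (\<i> * (of_int k * of_real t))) (at (of_real t))"
          using k0 by (auto intro!: derivative_eq_intros simp: field_simps)
        from has_vector_derivative_real_field[OF this] show ?thesis
          by (simp add: cis_conv_exp)
      qed
    qed simp
    moreover have "cis (of_int k * (2*pi)) = 1"
      using cis_multiple_2pi[of "of_int k"] by (simp add: mult_ac)
    ultimately show "((\<lambda>t. cis (of_int k * t)) has_integral 0) {0..2*pi}" by simp
  qed
  finally show ?thesis using False by simp
qed

text \<open>Cauchy's formula for \<open>p\<^sup>2 / (1 - cnj z w)\<close>: on the unit circle its kernel has modulus
  \<open>1 / |\<zeta> - z|\<^sup>2\<close>.\<close>

lemma norm_le_poisson_sq: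
  assumes p: "continuous_on (cball 0 1) p" "p holomorphic_on ball 0 1" and z: "norm z < 1"
  shows "(norm (p z))\<^sup>2 \<le> (1 / (2*pi)) * (LINT \<zeta>|arclen. (1 - (norm z)\<^sup>2) / (norm (\<zeta> - z))\<^sup>2 * (norm (p \<zeta>))\<^sup>2)"
proof -
  \<comment> \<open>At \<open>w = z\<close> the denominator is \<open>1 - |z|\<^sup>2\<close>, which
    becomes the numerator of the Poisson kernel.\<close>
  define F where "F w = (p w)\<^sup>2 / (1 - cnj z * w)" for w
  have nz: "1 - cnj z * w \<noteq> 0" if "norm w \<le> 1" for w
  proof
    assume "1 - cnj z * w = 0"
    then have "norm (cnj z * w) = 1" by (metis eq_iff_diff_eq_0 norm_one)
    moreover have "norm (cnj z * w) \<le> norm z * 1"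
      unfolding norm_mult using that by (intro mult_mono) auto
    ultimately show False using z by simp
  qed
  have nz2: "\<zeta> - z \<noteq> 0" if "norm \<zeta> = 1" for \<zeta> using that z by auto
  have contp: "continuous_on (sphere 0 1) p"
    by (rule continuous_on_subset[OF p(1)]) auto
  have "((\<lambda>u. F u / (u - z)) has_contour_integral (2 * of_real pi * \<i> * F z)) (circlepath 0 1)"
  proof (rule Cauchy_integral_circlepath)
    show "continuous_on (cball 0 1) F"
      unfolding F_def using nz by (intro continuous_intros p) auto
    show "F holomorphic_on ball 0 1"
      unfolding F_def using nz by (intro holomorphic_intros p) auto
  qed (use z in auto)
  moreover have cF: "continuous_on (sphere 0 1) (\<lambda>u. F u / (u - z))"
    unfolding F_def using nz nz2 by (intro continuous_intros contp) auto
  ultimately have eq: "(LINT \<zeta>|arclen. F \<zeta> / (\<zeta> - z) * \<zeta>) = - \<i> * (2 * of_real pi * \<i> * F z)"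
    by (rule contour_integral_arclen)
  have Fz: "norm (F z) = (norm (p z))\<^sup>2 / (1 - (norm z)\<^sup>2)"
  proof -
    have "1 - cnj z * z = of_real (1 - (norm z)\<^sup>2)"
      using complex_norm_square[of z] by (simp add: mult.commute)
    moreover have "(norm z)\<^sup>2 < 1" using z by (simp add: power_less_one_iff abs_square_less_1)
    ultimately show ?thesis unfolding F_def
      by (simp only: norm_divide norm_power norm_of_real abs_of_pos diff_gt_0_iff_gt)
  qed
  have nF: "norm (F \<zeta> / (\<zeta> - z) * \<zeta>) = (norm (p \<zeta>))\<^sup>2 / (norm (\<zeta> - z))\<^sup>2" if "norm \<zeta> = 1" for \<zeta>
  proof -
    have "\<zeta> * cnj \<zeta> = 1" using that by (metis complex_norm_square of_real_1 one_power2)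
    then have "1 - cnj z * \<zeta> = \<zeta> * cnj (\<zeta> - z)" by (simp add: algebra_simps)
    then have "norm (1 - cnj z * \<zeta>) = norm (\<zeta> - z)"
      using that by (simp add: norm_mult del: complex_cnj_diff)
    then show ?thesis using that by (simp add: F_def norm_mult norm_divide norm_power power2_eq_square)
  qed
  have "2 * pi * ((norm (p z))\<^sup>2 / (1 - (norm z)\<^sup>2)) = norm (LINT \<zeta>|arclen. F \<zeta> / (\<zeta> - z) * \<zeta>)"
    unfolding eq by (simp add: norm_mult Fz)
  also have "\<dots> \<le> (LINT \<zeta>|arclen. norm (F \<zeta> / (\<zeta> - z) * \<zeta>))"
    by (rule integral_norm_bound)
  also have "\<dots> = (LINT \<zeta>|arclen. (norm (p \<zeta>))\<^sup>2 / (norm (\<zeta> - z))\<^sup>2)"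
    by (rule Bochner_Integration.integral_cong[OF refl], rule nF) auto
  finally have "2 * pi * ((norm (p z))\<^sup>2 / (1 - (norm z)\<^sup>2)) \<le> (LINT \<zeta>|arclen. (norm (p \<zeta>))\<^sup>2 / (norm (\<zeta> - z))\<^sup>2)" .
  moreover have "(norm z)\<^sup>2 < 1" using z by (simp add: power_less_one_iff abs_square_less_1)
  ultimately have "(norm (p z))\<^sup>2 \<le> (1 / (2*pi)) * ((1 - (norm z)\<^sup>2) * (LINT \<zeta>|arclen. (norm (p \<zeta>))\<^sup>2 / (norm (\<zeta> - z))\<^sup>2))"
    by (simp add: field_simps)
  also have "(1 - (norm z)\<^sup>2) * (LINT \<zeta>|arclen. (norm (p \<zeta>))\<^sup>2 / (norm (\<zeta> - z))\<^sup>2)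
      = (LINT \<zeta>|arclen. (1 - (norm z)\<^sup>2) * ((norm (p \<zeta>))\<^sup>2 / (norm (\<zeta> - z))\<^sup>2))"
    by (rule integral_mult_right_zero[symmetric])
  finally show ?thesis by (simp add: mult_ac)
qed

section \<open>Lengths of arcs in terms of chords\<close>

lemma jordan_inequality:
  assumes "0 \<le> x" "x \<le> pi / 2"
  shows "2 / pi * x \<le> sin x"
proof -
  have "convex_on {0..pi/2} (\<lambda>x. - sin x)"
  proof (rule f''_ge0_imp_convex)
    show "((\<lambda>x. - sin x) has_real_derivative - cos x) (at x)" for x
      by (auto intro!: derivative_eq_intros)
    show "((\<lambda>x. - cos x) has_real_derivative sin x) (at x)" for x
      by (auto intro!: derivative_eq_intros)
    show "0 \<le> sin x" if "x \<in> {0..pi/2}" for x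
      using that by (intro sin_ge_zero) auto
  qed auto
  from convex_onD[OF this, of "2 / pi * x" 0 "pi/2"] show ?thesis
    using assms by (simp add: field_simps)
qed

lemma norm_cis_diff: "norm (cis t - cis s) = 2 * \<bar>sin ((t - s) / 2)\<bar>"
proof -
  have "(norm (cis t - cis s))\<^sup>2 = (cos t - cos s)\<^sup>2 + (sin t - sin s)\<^sup>2"
    by (simp add: cmod_power2)
  also have "\<dots> = 2 - 2 * (cos t * cos s + sin t * sin s)"
    using sin_cos_squared_add[of t] sin_cos_squared_add[of s] by (simp add: power2_eq_square algebra_simps)
  also have "\<dots> = 2 - 2 * cos (2 * ((t - s) / 2))"
  proof -
    have "2 * ((t - s) / 2) = t - s" by simp
    then show ?thesis by (simp only: cos_diff)
  qed
  also have "\<dots> = (2 * \<bar>sin ((t - s) / 2)\<bar>)\<^sup>2"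
    by (subst cos_double_sin) (simp add: power_mult_distrib)
  finally show ?thesis
    by (rule power2_eq_imp_eq) auto
qed

lemma emeasure_arclen_cball:
  assumes "norm \<xi> = 1" "0 \<le> s"
  shows "emeasure arclen (cball \<xi> s \<inter> sphere 0 1) \<le> ennreal (2 * pi * s)"
proof -
  obtain u where u: "0 \<le> u" "u < 2*pi" "\<xi> = cis u"
    using complex_unimodular_polar[OF assms(1)] by (metis cis.code)
  \<comment> \<open>A chord of length at most \<open>s\<close> allows an angular distance of at most
    \<open>pi * s / 2\<close>. The parametrization is cut at the angle 0, so an arc around
    \<open>cis u\<close> may continue at the other end of \<open>{0..2 * pi}\<close>; the last two
    intervals catch these continuations and double the total length.\<close>
  define A where "A = {u - pi * s / 2..u + pi * s / 2} \<union> ({u + 2*pi - pi * s / 2..u + 2*pi} \<union> {u - 2*pi..u - 2*pi + pi * s / 2})"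
  have sub: "{t \<in> {0..2*pi}. cis t \<in> cball \<xi> s} \<subseteq> A"
  proof safe
    fix t assume t: "t \<in> {0..2*pi}" "cis t \<in> cball \<xi> s"
    define x where "x = \<bar>t - u\<bar> / 2"
    have x: "0 \<le> x" "x \<le> pi" using t u by (auto simp: x_def)
    have "2 * \<bar>sin ((t - u)/2)\<bar> \<le> s"
      using t u norm_cis_diff[of t u] by (simp add: dist_norm norm_minus_commute)
    moreover have "\<bar>sin ((t-u)/2)\<bar> = \<bar>sin x\<bar>"
    proof -
      have "(t - u) / 2 = x \<or> (t - u) / 2 = - x" by (auto simp: x_def abs_if)
      then show ?thesis by auto
    qed
    ultimately have sx: "2 * \<bar>sin x\<bar> \<le> s" by simp
    consider "x \<le> pi/2" | "pi/2 < x" by linarith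
    then show "t \<in> A"
    proof cases
      case 1
      then have "2 * (2 / pi * x) \<le> s" using jordan_inequality[of x] sx x by linarith
      then have "2 * x \<le> pi * s / 2" by (simp add: field_simps)
      then show ?thesis using t by (auto simp: A_def x_def abs_if split: if_splits)
    next
      case 2
      then have "2 / pi * (pi - x) \<le> sin (pi - x)" using x by (intro jordan_inequality) auto
      then have "2 * (2 / pi * (pi - x)) \<le> 2 * sin x" by (simp only: sin_pi_minus)
      then have "2 * (2 / pi * (pi - x)) \<le> s" using sx abs_ge_self[of "sin x"] by linarith
      then have "2 * (pi - x) \<le> pi * s / 2" by (simp add: field_simps)
      then show ?thesis using t u x by (auto simp: A_def x_def abs_if split: if_splits)
    qed
  qed
  have "emeasure arclen (cball \<xi> s \<inter> sphere 0 1) = emeasure (restrict_space lborel {0..2*pi}) {t \<in> {0..2*pi}. cis t \<in> cball \<xi> s}"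
    unfolding arclen_def by (subst emeasure_distr)
      (auto simp: sets_restrict_space intro!: arg_cong2[where f=emeasure])
  also have "\<dots> = emeasure lborel {t \<in> {0..2*pi}. cis t \<in> cball \<xi> s}"
    by (subst emeasure_restrict_space) auto
  also have "\<dots> \<le> emeasure lborel A"
    using sub by (intro emeasure_mono) (auto simp: A_def)
  also have "\<dots> \<le> emeasure lborel {u - pi * s / 2..u + pi * s / 2} + (emeasure lborel {u + 2*pi - pi * s / 2..u + 2*pi} + emeasure lborel {u - 2*pi..u - 2*pi + pi * s / 2})"
    unfolding A_def by (intro order_trans[OF emeasure_subadditive] add_left_mono) auto
  also have "\<dots> = ennreal (2 * pi * s)"
    using assms by (simp flip: ennreal_plus)
  finally show ?thesis .
qed

section \<open>Weak type estimate for the nontangential maximal function\<close>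

lemma sets_circI: "open T \<or> closed T \<Longrightarrow> sphere 0 1 \<inter> T \<in> sets circ"
  by (auto simp: sets_restrict_space)

text \<open>If the mean of \<open>|p|\<^sup>2\<close> over every arc around \<open>\<xi>\<close> of radius \<open>2\<^sup>k (1 - |z|)\<close> were small, splitting
  the Poisson kernel at \<open>z\<close> along these arcs would make \<open>|p z|\<close> too small.\<close>

lemma arclen_density_large:
  assumes p: "continuous_on (cball 0 1) p" "p holomorphic_on ball 0 1"
    and M: "0 < M" and l: "0 < l" and xi: "norm \<xi> = 1"
    and z: "z \<in> stolz \<xi> M" "l < norm (p z)"
  shows "\<exists>r>0. ennreal (l\<^sup>2 * r / (8 * (1 + M)\<^sup>2)) <
    (\<integral>\<^sup>+\<zeta>. ennreal ((norm (p \<zeta>))\<^sup>2) * indicator (cball \<xi> r) \<zeta> \<partial>arclen)"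
proof (rule ccontr)
  assume neg: "\<not> ?thesis"
  define h where "h = 1 - norm z"
  have h: "0 < h" "h \<le> 1" "norm z < 1" using z by (auto simp: h_def stolz_def)
  have zxi: "norm (z - \<xi>) < M * h" using z by (simp add: h_def stolz_def)
  define K where "K \<zeta> = (1 - (norm z)\<^sup>2) / (norm (\<zeta> - z))\<^sup>2" for \<zeta>
  \<comment> \<open>The bound for the Poisson kernel, including the factor
    \<open>1 / (2 * pi)\<close>, at points whose smallest enclosing ball in the family has index
    \<open>k\<close>.\<close>
  define a where "a k = (1 / (2 * pi)) * (8 * (1 + M)\<^sup>2 / (4 ^ k * h))" for k :: nat
  have a0: "0 \<le> a k" for k using h by (simp add: a_def)
  have contp: "continuous_on (sphere 0 1) p"
    by (rule continuous_on_subset[OF p(1)]) auto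
  have [measurable]: "(\<lambda>\<zeta>. (norm (p \<zeta>))\<^sup>2) \<in> borel_measurable circ"
    by (intro measurable_circI continuous_intros contp)
  have [measurable]: "cball \<xi> r \<inter> sphere 0 1 \<in> sets circ" for r
    using sets_circI[of "cball \<xi> r"] by (simp add: Int_commute)
  have [measurable]: "(\<lambda>\<zeta>. indicator (cball \<xi> r) \<zeta> :: ennreal) \<in> borel_measurable circ" for r
    by (intro measurable_restrict_space1 borel_measurable_indicator) auto
  have ball: "(\<integral>\<^sup>+\<zeta>. ennreal ((norm (p \<zeta>))\<^sup>2) * indicator (cball \<xi> (2 ^ k * h)) \<zeta> \<partial>arclen)
      \<le> ennreal (l\<^sup>2 * (2 ^ k * h) / (8 * (1 + M)\<^sup>2))" for k :: nat
  proof -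
    have "0 < 2 ^ k * h" using h by simp
    then show ?thesis using neg by (meson not_less)
  qed
  have nz2: "\<zeta> - z \<noteq> 0" if "norm \<zeta> = 1" for \<zeta> using that h by auto
  have z2: "1 - (norm z)\<^sup>2 \<le> 2 * h" "0 \<le> 1 - (norm z)\<^sup>2"
  proof -
    have "1 - (norm z)\<^sup>2 = h * (1 + norm z)" by (simp add: h_def power2_eq_square algebra_simps)
    moreover have "h * (1 + norm z) \<le> h * 2" using h by (intro mult_left_mono) auto
    ultimately show "1 - (norm z)\<^sup>2 \<le> 2 * h" by simp
    show "0 \<le> 1 - (norm z)\<^sup>2" using h by (simp add: abs_square_le_1)
  qed
  have dom: "ennreal ((1 / (2*pi)) * (K \<zeta> * (norm (p \<zeta>))\<^sup>2)) \<le>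
      (\<Sum>k. ennreal (a k) * (ennreal ((norm (p \<zeta>))\<^sup>2) * indicator (cball \<xi> (2 ^ k * h)) \<zeta>))"
    if zeta: "norm \<zeta> = 1" for \<zeta>
  proof -
    define D where "D = norm (\<zeta> - z)"
    have D: "h \<le> D" using norm_triangle_ineq2[of \<zeta> z] zeta by (simp add: D_def h_def)
    define P where "P k \<longleftrightarrow> dist \<xi> \<zeta> \<le> 2 ^ k * h" for k :: nat
    have "\<exists>k. P k"
    proof -
      obtain k :: nat where "dist \<xi> \<zeta> / h < 2 ^ k"
        using real_arch_pow[of 2 "dist \<xi> \<zeta> / h"] by auto
      then show ?thesis using h by (auto simp: P_def field_simps intro!: exI[of _ k])
    qed
    then obtain k where k: "P k" "\<And>j. j < k \<Longrightarrow> \<not> P j"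
      using exists_least_iff[of P] by auto
    \<comment> \<open>By minimality of \<open>k\<close> the point \<open>\<zeta>\<close> lies
      outside the ball of index \<open>k - 1\<close>. Replacing the centre \<open>\<xi>\<close> by
      \<open>z\<close> costs \<open>M * h\<close>, which is at most \<open>M * D\<close> because
      \<open>h \<le> D\<close>; hence the factor \<open>1 + M\<close>, and the 2 from the lowered
      index.\<close>
    have Dk: "2 ^ k * h / (2 * (1 + M)) \<le> D"
    proof (cases k)
      case 0
      have "h / (2 * (1 + M)) \<le> h / 1" using h M by (intro divide_left_mono) auto
      then show ?thesis using 0 D by simp
    next
      case (Suc j)
      then have "2 ^ j * h < dist \<xi> \<zeta>" using k(2)[of j] by (simp add: P_def)
      also have "dist \<xi> \<zeta> \<le> D + norm (z - \<xi>)"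
        using norm_triangle_ineq[of "\<zeta> - z" "z - \<xi>"] by (simp add: D_def dist_norm norm_minus_commute)
      also have "\<dots> \<le> D + M * D" using zxi D M
        by (intro add_left_mono order_trans[OF less_imp_le[OF zxi]] mult_left_mono) auto
      finally show ?thesis using Suc M by (simp add: field_simps)
    qed
    have Dpos: "0 < 2 ^ k * h / (2 * (1 + M))" using h M by simp
    have "K \<zeta> \<le> 2 * h / (2 ^ k * h / (2 * (1 + M)))\<^sup>2"
      unfolding K_def D_def[symmetric]
      using Dk Dpos z2 h by (intro frac_le power_mono) auto
    also have "\<dots> = 8 * (1 + M)\<^sup>2 / (4 ^ k * h)"
    proof -
      have "(2::real) ^ k * 2 ^ k = 4 ^ k" by (simp flip: power_mult_distrib)
      then show ?thesis using h by (simp add: power2_eq_square divide_simps) (simp add: algebra_simps)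
    qed
    finally have Kle: "K \<zeta> \<le> 8 * (1 + M)\<^sup>2 / (4 ^ k * h)" .
    have "(1 / (2*pi)) * (K \<zeta> * (norm (p \<zeta>))\<^sup>2) \<le> a k * (norm (p \<zeta>))\<^sup>2"
      using mult_right_mono[OF Kle, of "(norm (p \<zeta>))\<^sup>2 / (2 * pi)"] by (simp add: a_def mult_ac)
    then have "ennreal ((1 / (2*pi)) * (K \<zeta> * (norm (p \<zeta>))\<^sup>2)) \<le> ennreal (a k) * (ennreal ((norm (p \<zeta>))\<^sup>2) * indicator (cball \<xi> (2 ^ k * h)) \<zeta>)"
      using k(1) a0 by (simp add: P_def ennreal_leI flip: ennreal_mult)
    also have "\<dots> = (\<Sum>j\<in>{k}. ennreal (a j) * (ennreal ((norm (p \<zeta>))\<^sup>2) * indicator (cball \<xi> (2 ^ j * h)) \<zeta>))"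
      by simp
    also have "\<dots> \<le> (\<Sum>j. ennreal (a j) * (ennreal ((norm (p \<zeta>))\<^sup>2) * indicator (cball \<xi> (2 ^ j * h)) \<zeta>))"
      by (intro sum_le_suminf) auto
    finally show ?thesis .
  qed
  have "ennreal (l\<^sup>2) < ennreal ((norm (p z))\<^sup>2)"
    using l z by (intro ennreal_lessI power_strict_mono zero_less_power) (auto intro: less_trans)
  also have "\<dots> \<le> ennreal (LINT \<zeta>|arclen. (1 / (2*pi)) * (K \<zeta> * (norm (p \<zeta>))\<^sup>2))"
  proof (rule ennreal_leI)
    have "(LINT \<zeta>|arclen. (1 / (2*pi)) * (K \<zeta> * (norm (p \<zeta>))\<^sup>2))
        = (1 / (2*pi)) * (LINT \<zeta>|arclen. K \<zeta> * (norm (p \<zeta>))\<^sup>2)"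
      by (rule integral_mult_right_zero)
    then show "(norm (p z))\<^sup>2 \<le> (LINT \<zeta>|arclen. (1 / (2*pi)) * (K \<zeta> * (norm (p \<zeta>))\<^sup>2))"
      using norm_le_poisson_sq[OF p h(3)] by (simp add: K_def)
  qed
  also have "\<dots> = (\<integral>\<^sup>+\<zeta>. ennreal ((1 / (2*pi)) * (K \<zeta> * (norm (p \<zeta>))\<^sup>2)) \<partial>arclen)"
    using z2 nz2 unfolding K_def
    by (intro nn_integral_eq_integral[symmetric] integrable_arclen_continuous AE_I2 continuous_intros contp) auto
  also have "\<dots> \<le> (\<integral>\<^sup>+\<zeta>. (\<Sum>k. ennreal (a k) * (ennreal ((norm (p \<zeta>))\<^sup>2) * indicator (cball \<xi> (2 ^ k * h)) \<zeta>)) \<partial>arclen)"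
    using dom by (intro nn_integral_mono) auto
  also have "\<dots> = (\<Sum>k. ennreal (a k) * (\<integral>\<^sup>+\<zeta>. ennreal ((norm (p \<zeta>))\<^sup>2) * indicator (cball \<xi> (2 ^ k * h)) \<zeta> \<partial>arclen))"
    by (subst nn_integral_suminf) (auto simp: nn_integral_cmult)
  also have "\<dots> \<le> (\<Sum>k. ennreal (a k) * ennreal (l\<^sup>2 * (2 ^ k * h) / (8 * (1 + M)\<^sup>2)))"
    by (intro suminf_le mult_left_mono ball) auto
  also have "\<dots> = (\<Sum>k. ennreal (l\<^sup>2 / (2 * pi) * (1 / 2) ^ k))"
  proof (intro suminf_cong)
    fix k :: nat
    have "a k * (l\<^sup>2 * (2 ^ k * h) / (8 * (1 + M)\<^sup>2)) = l\<^sup>2 / (2 * pi) * (2 ^ k / 4 ^ k)"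
      using h M by (simp add: a_def field_simps)
    also have "(2::real) ^ k / 4 ^ k = (1/2) ^ k" by (simp flip: power_divide)
    finally show "ennreal (a k) * ennreal (l\<^sup>2 * (2 ^ k * h) / (8 * (1 + M)\<^sup>2)) = ennreal (l\<^sup>2 / (2 * pi) * (1 / 2) ^ k)"
      using a0[of k] h M by (simp flip: ennreal_mult)
  qed
  also have "\<dots> = ennreal (l\<^sup>2 / (2 * pi) * 2)"
  proof (rule suminf_ennreal_eq)
    show "(\<lambda>k. l\<^sup>2 / (2 * pi) * (1 / 2) ^ k) sums (l\<^sup>2 / (2 * pi) * 2)"
      using geometric_sums[of "1/2::real"] by (intro sums_mult) auto
  qed auto
  \<comment> \<open>The geometric series contributes 2, and \<open>2 / (2 * pi) < 1\<close>.
    Together with the strict inequality at the start of the chain this is absurd.\<close>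
  also have "\<dots> \<le> ennreal (l\<^sup>2)"
    using pi_gt3 l by (intro ennreal_leI) (simp add: field_simps)
  finally show False by simp
qed

text \<open>Measurability: for fixed \<open>z\<close> membership in the Stolz region is an open
  condition on \<open>\<xi>\<close>. Bound: every point of \<open>E\<close> is the centre of a ball
  with a large mean of \<open>|p|\<^sup>2\<close>. A Vitali subfamily of disjoint balls carries at
  most the whole integral, and its fivefold enlargements cover \<open>E\<close>; the constant is
  \<open>10 * pi\<close>, from arcs of radius \<open>5 * r\<close>, times
  \<open>8 * (1 + M)\<^sup>2 / l\<^sup>2\<close>.\<close>

lemma emeasure_nontangential_maximal:
  assumes p: "continuous_on (cball 0 1) p" "p holomorphic_on ball 0 1"
    and M: "0 < M" and l: "0 < l"
  defines "E \<equiv> {\<xi> \<in> sphere 0 1. \<exists>z\<in>stolz \<xi> M. l < norm (p z)}"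
  shows "E \<in> sets circ"
    and "emeasure arclen E \<le> ennreal (80 * pi * (1 + M)\<^sup>2 / l\<^sup>2 * (LINT \<zeta>|arclen. (norm (p \<zeta>))\<^sup>2))"
proof -
  have "E = sphere 0 1 \<inter> (\<Union>z\<in>{z\<in>ball 0 1. l < norm (p z)}. ball z (M * (1 - norm z)))"
    by (auto simp: E_def stolz_def dist_norm)
  also have "\<dots> \<in> sets circ"
    by (intro sets_circI disjI1 open_UN) auto
  finally show "E \<in> sets circ" .
  have contp: "continuous_on (sphere 0 1) p"
    by (rule continuous_on_subset[OF p(1)]) auto
  have u[measurable]: "(\<lambda>\<zeta>. (norm (p \<zeta>))\<^sup>2) \<in> borel_measurable circ"
    by (intro measurable_circI continuous_intros contp)
  define A where "A = (LINT \<zeta>|arclen. (norm (p \<zeta>))\<^sup>2)"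
  define \<nu> where "\<nu> = density arclen (\<lambda>\<zeta>. ennreal ((norm (p \<zeta>))\<^sup>2))"
  define q where "q = 8 * (1 + M)\<^sup>2 / l\<^sup>2"
  have q: "0 < q" using M l by (simp add: q_def)
  have A0: "0 \<le> A" by (simp add: A_def)
  have nu_space: "emeasure \<nu> X \<le> ennreal A" if "X \<in> sets circ" for X
  proof -
    have "emeasure \<nu> X \<le> emeasure \<nu> (space \<nu>)" using that by (intro emeasure_space)
    also have "\<dots> = (\<integral>\<^sup>+\<zeta>. ennreal ((norm (p \<zeta>))\<^sup>2) \<partial>arclen)"
      unfolding \<nu>_def using sets.top[of arclen]
      by (subst emeasure_density) (auto intro!: nn_integral_cong)
    also have "\<dots> = ennreal A"
      unfolding A_def
      by (intro nn_integral_eq_integral integrable_arclen_continuous continuous_intros contp) auto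
    finally show ?thesis .
  qed
  have cb: "cball \<xi> r \<inter> sphere 0 1 \<in> sets circ" for \<xi> r
    using sets_circI[of "cball \<xi> r"] by (simp add: Int_commute)
  have nu_cball: "emeasure \<nu> (cball \<xi> r \<inter> sphere 0 1) =
      (\<integral>\<^sup>+\<zeta>. ennreal ((norm (p \<zeta>))\<^sup>2) * indicator (cball \<xi> r) \<zeta> \<partial>arclen)" for \<xi> r
    unfolding \<nu>_def using cb
    by (subst emeasure_density) (auto intro!: nn_integral_cong simp: indicator_def)
  have "\<forall>\<xi>\<in>E. \<exists>r>0. ennreal (r / q) < emeasure \<nu> (cball \<xi> r \<inter> sphere 0 1)"
    using arclen_density_large[OF p M l] l
    unfolding nu_cball by (simp add: E_def q_def mult.commute) blast
  then obtain r where r: "\<And>\<xi>. \<xi> \<in> E \<Longrightarrow> 0 < r \<xi>"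
      "\<And>\<xi>. \<xi> \<in> E \<Longrightarrow> ennreal (r \<xi> / q) < emeasure \<nu> (cball \<xi> (r \<xi>) \<inter> sphere 0 1)"
    by metis
  \<comment> \<open>Vitali's lemma asks for bounded radii; the total mass of \<open>\<nu>\<close>
    bounds them.\<close>
  have rB: "r \<xi> \<le> q * A" if "\<xi> \<in> E" for \<xi>
  proof -
    have "ennreal (r \<xi> / q) \<le> ennreal A"
      using r(2)[OF that] nu_space[OF cb] by (meson less_imp_le order_trans)
    then have "r \<xi> / q \<le> A" using A0 by simp
    then show ?thesis using q by (simp add: field_simps)
  qed
  have "E \<subseteq> (\<Union>\<xi>\<in>E. cball \<xi> (r \<xi>))" using r(1) by (force intro: less_imp_le)
  then obtain C where C: "countable C" "C \<subseteq> E"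
     "pairwise (\<lambda>i j. disjnt (cball i (r i)) (cball j (r j))) C"
     "E \<subseteq> (\<Union>i\<in>C. cball i (5 * r i))"
    by (rule Vitali_covering_lemma_cballs[of E "\<lambda>x. x" r E "q * A"]) (use r(1) rB in auto)
  \<comment> \<open>The selected family may be finite. It is indexed by a set \<open>N\<close> of
    naturals, and the sequences \<open>X\<close> and \<open>Y\<close> are padded with empty sets
    outside \<open>N\<close>.\<close>
  define N where "N = to_nat_on C ` C"
  define c where "c n = from_nat_into C n" for n
  have cC: "c n \<in> C" if "n \<in> N" for n
    using that C(1) by (auto simp: N_def c_def)
  have cinj: "c n \<noteq> c m" if "n \<in> N" "m \<in> N" "n \<noteq> m" for n m
    using that C(1) by (auto simp: N_def c_def)
  have Cc: "C = c ` N" using C(1) by (force simp: N_def c_def)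
  define X where "X n = (if n \<in> N then cball (c n) (r (c n)) \<inter> sphere 0 1 else {})" for n
  define Y where "Y n = (if n \<in> N then cball (c n) (5 * r (c n)) \<inter> sphere 0 1 else {})" for n
  have XY: "X n \<in> sets circ" "Y n \<in> sets circ" for n
    using cb by (auto simp: X_def Y_def)
  have dis: "disjoint_family X"
  proof (unfold disjoint_family_on_def, intro ballI impI)
    fix m n :: nat assume "m \<noteq> n"
    then show "X m \<inter> X n = {}"
      using C(3) cC[of m] cC[of n] cinj[of m n] unfolding pairwise_def disjnt_def X_def by auto
  qed
  have "E \<subseteq> (\<Union>n. Y n)"
    using C(4) unfolding Cc by (force simp: Y_def E_def)
  then have "emeasure arclen E \<le> emeasure arclen (\<Union>n. Y n)"
    using XY by (intro emeasure_mono) auto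
  also have "\<dots> \<le> (\<Sum>n. emeasure arclen (Y n))"
    using XY by (intro emeasure_subadditive_countably) auto
  also have "\<dots> \<le> (\<Sum>n. ennreal (10 * pi * q) * emeasure \<nu> (X n))"
  proof (intro suminf_le)
    fix n
    show "emeasure arclen (Y n) \<le> ennreal (10 * pi * q) * emeasure \<nu> (X n)"
    proof (cases "n \<in> N")
      case True
      then have cE: "c n \<in> E" using cC C(2) by auto
      then have "norm (c n) = 1" by (simp add: E_def)
      then have "emeasure arclen (Y n) \<le> ennreal (2 * pi * (5 * r (c n)))"
        using True r(1)[OF cE] emeasure_arclen_cball[of "c n" "5 * r (c n)"] by (simp add: Y_def mult_ac)
      also have "\<dots> = ennreal (10 * pi * q) * ennreal (r (c n) / q)"
      proof -
        have "2 * pi * (5 * r (c n)) = 10 * pi * q * (r (c n) / q)" using q by simp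
        moreover have "ennreal (10 * pi * q * (r (c n) / q)) = ennreal (10 * pi * q) * ennreal (r (c n) / q)"
          using q r(1)[OF cE] by (intro ennreal_mult) auto
        ultimately show ?thesis by (simp only:)
      qed
      also have "\<dots> \<le> ennreal (10 * pi * q) * emeasure \<nu> (X n)"
        using r(2)[OF cE] True by (intro mult_left_mono) (auto simp: X_def)
      finally show ?thesis .
    qed (simp add: Y_def)
  qed auto
  also have "\<dots> = ennreal (10 * pi * q) * emeasure \<nu> (\<Union>n. X n)"
    using XY dis by (simp add: suminf_emeasure \<nu>_def image_subset_iff)
  also have "\<dots> \<le> ennreal (10 * pi * q) * ennreal A"
    using XY by (intro mult_left_mono nu_space) auto
  also have "\<dots> = ennreal (80 * pi * (1 + M)\<^sup>2 / l\<^sup>2 * A)"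
    using q A0 by (simp add: q_def flip: ennreal_mult)
  finally show "emeasure arclen E \<le> ennreal (80 * pi * (1 + M)\<^sup>2 / l\<^sup>2 * (LINT \<zeta>|arclen. (norm (p \<zeta>))\<^sup>2))"
    by (simp add: A_def)
qed

section \<open>Boundary values of functions in the Hardy space\<close>

text \<open>One fixed radial approach that stays in every Stolz region of aperture above 1. It gives
  uniqueness of the nontangential limit, links different apertures and exhibits the boundary
  function as a limit of a sequence. The shift by 2 keeps the factor in
  \<open>[1/2, 1)\<close>.\<close>

definition radial :: "nat \<Rightarrow> complex \<Rightarrow> complex" where
  "radial n \<xi> = of_real (1 - 1 / (real n + 2)) * \<xi>"

lemma norm_radial: "norm \<xi> = 1 \<Longrightarrow> norm (radial n \<xi>) = 1 - 1 / (real n + 2)"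
  by (simp add: radial_def norm_mult del: of_real_diff)

lemma radial_in_ball: "norm \<xi> = 1 \<Longrightarrow> radial n \<xi> \<in> ball 0 1"
  by (simp add: norm_radial)

lemma radial_in_stolz:
  assumes "norm \<xi> = 1" "1 < M"
  shows "radial n \<xi> \<in> stolz \<xi> M"
proof -
  have "radial n \<xi> - \<xi> = - of_real (1 / (real n + 2)) * \<xi>"
    by (simp add: radial_def algebra_simps)
  then have "norm (radial n \<xi> - \<xi>) = 1 / (real n + 2)"
    using assms by (simp only: norm_mult norm_minus_cancel norm_of_real) simp
  then show ?thesis
    using assms by (simp add: stolz_def norm_radial divide_strict_right_mono)
qed

lemma radial_tendsto: "(\<lambda>n. radial n \<xi>) \<longlonglongrightarrow> \<xi>"
proof -
  have "(\<lambda>n. 1 / (real n + 2)) \<longlonglongrightarrow> 0"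
    by real_asymp
  then have "(\<lambda>n. radial n \<xi>) \<longlonglongrightarrow> of_real (1 - 0) * \<xi>"
    unfolding radial_def by (intro tendsto_intros)
  then show ?thesis by simp
qed

lemma filterlim_radial:
  assumes "norm \<xi> = 1" "1 < M"
  shows "filterlim (\<lambda>n. radial n \<xi>) (at \<xi> within stolz \<xi> M) sequentially"
proof -
  have "radial n \<xi> \<noteq> \<xi>" for n
    using norm_radial[OF assms(1), of n] assms by auto
  then show ?thesis
    using radial_tendsto radial_in_stolz[OF assms] by (auto simp: filterlim_at)
qed

lemma at_within_stolz_nontrivial:
  assumes "norm \<xi> = 1" "1 < M"
  shows "at \<xi> within stolz \<xi> M \<noteq> bot"
  using filterlim_radial[OF assms] by (auto simp: filterlim_def bot_unique filtermap_bot_iff)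

lemma nt_lim_radial:
  assumes "norm \<xi> = 1" "has_nt_limit f \<xi> L"
  shows "(\<lambda>n. f (radial n \<xi>)) \<longlonglongrightarrow> L"
proof -
  have "(f \<longlongrightarrow> L) (at \<xi> within stolz \<xi> 2)" using assms by (simp add: has_nt_limit_def)
  then show ?thesis by (rule filterlim_compose[OF _ filterlim_radial]) (use assms in auto)
qed

lemma nt_lim_eq:
  assumes "norm \<xi> = 1" "has_nt_limit f \<xi> L"
  shows "nt_lim f \<xi> = L"
  unfolding nt_lim_def using assms nt_lim_radial LIMSEQ_unique by blast

section \<open>Existence of a nontangential limit as a Borel condition\<close>

lemma stolz_mono: "M \<le> M' \<Longrightarrow> stolz \<xi> M \<subseteq> stolz \<xi> M'"
  by (auto simp: stolz_def intro: less_le_trans mult_right_mono)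

text \<open>Stolz regions grow with the aperture, so countably many apertures decide; almost
  everywhere statements can thus be proved one aperture at a time.\<close>

lemma has_nt_limitI:
  assumes "\<And>m::nat. (f \<longlongrightarrow> L) (at \<xi> within stolz \<xi> (real m + 2))"
  shows "has_nt_limit f \<xi> L"
  unfolding has_nt_limit_def
proof (intro allI impI)
  fix M :: real
  obtain m :: nat where "M \<le> real m" using real_arch_simple by blast
  then have "stolz \<xi> M \<subseteq> stolz \<xi> (real m + 2)" by (intro stolz_mono) auto
  then show "(f \<longlongrightarrow> L) (at \<xi> within stolz \<xi> M)"
    by (rule tendsto_within_subset[OF assms])
qed

lemma has_nt_limit_cong:
  assumes "\<And>z. z \<in> ball 0 1 \<Longrightarrow> f z = g z"
  shows "has_nt_limit f \<xi> L \<longleftrightarrow> has_nt_limit g \<xi> L"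
proof -
  have "(f \<longlongrightarrow> L) (at \<xi> within stolz \<xi> M) \<longleftrightarrow> (g \<longlongrightarrow> L) (at \<xi> within stolz \<xi> M)" for M
    by (intro tendsto_cong) (auto simp: eventually_at_filter stolz_def assms)
  then show ?thesis by (simp add: has_nt_limit_def)
qed

text \<open>Cauchy's criterion with all quantifiers over numbers running over naturals, in
  preparation for a countable Borel description. It avoids mention of the limit.\<close>

lemma nt_limit_exists_iff:
  assumes "norm \<xi> = 1"
  shows "(\<exists>L. has_nt_limit f \<xi> L) \<longleftrightarrow>
    (\<forall>m j :: nat. \<exists>i :: nat. \<forall>z\<in>stolz \<xi> (real m + 2). \<forall>w\<in>stolz \<xi> (real m + 2).
        dist z \<xi> < 1 / (real i + 1) \<longrightarrow> dist w \<xi> < 1 / (real i + 1) \<longrightarrow> norm (f z - f w) \<le> 1 / (real j + 1))"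
    (is "?L \<longleftrightarrow> ?R")
proof
  assume ?L
  then obtain L where L: "has_nt_limit f \<xi> L" ..
  show ?R
  proof (intro allI)
    fix m j :: nat
    have "(f \<longlongrightarrow> L) (at \<xi> within stolz \<xi> (real m + 2))"
      using L by (simp add: has_nt_limit_def)
    then have "\<forall>\<^sub>F z in at \<xi> within stolz \<xi> (real m + 2). dist (f z) L < 1 / (real j + 1) / 2"
      by (rule tendstoD) simp
    then obtain d where d: "0 < d" "\<And>z. z \<in> stolz \<xi> (real m + 2) \<Longrightarrow> z \<noteq> \<xi> \<Longrightarrow> dist z \<xi> < d \<Longrightarrow> dist (f z) L < 1 / (real j + 1) / 2"
      by (auto simp: eventually_at)
    obtain i where i: "1 / (real i + 1) < d"
      using reals_Archimedean[OF d(1)] by (auto simp: inverse_eq_divide add.commute)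
    have ne: "z \<noteq> \<xi>" if "z \<in> stolz \<xi> (real m + 2)" for z
      using that assms by (auto simp: stolz_def)
    show "\<exists>i :: nat. \<forall>z\<in>stolz \<xi> (real m + 2). \<forall>w\<in>stolz \<xi> (real m + 2).
        dist z \<xi> < 1 / (real i + 1) \<longrightarrow> dist w \<xi> < 1 / (real i + 1) \<longrightarrow> norm (f z - f w) \<le> 1 / (real j + 1)"
    proof (intro exI ballI impI)
      fix z w assume zw: "z \<in> stolz \<xi> (real m + 2)" "w \<in> stolz \<xi> (real m + 2)"
        "dist z \<xi> < 1 / (real i + 1)" "dist w \<xi> < 1 / (real i + 1)"
      then have "dist (f z) L < 1 / (real j + 1) / 2" "dist (f w) L < 1 / (real j + 1) / 2"
        using d(2)[of z] d(2)[of w] ne i by auto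
      then show "norm (f z - f w) \<le> 1 / (real j + 1)"
        using dist_triangle2[of "f z" "f w" L] unfolding dist_norm[of "f z" "f w", symmetric]
        by (smt (verit) field_sum_of_halves)
    qed
  qed
next
  assume R: ?R
  \<comment> \<open>The candidate comes from the aperture 2. The radial sequence lies in all the
    wider regions too, so each of them is forced to the same limit.\<close>
  have "Cauchy (\<lambda>n. f (radial n \<xi>))"
  proof (rule metric_CauchyI)
    fix e :: real assume "0 < e"
    then obtain j where j: "1 / (real j + 1) < e"
      using reals_Archimedean by (auto simp: inverse_eq_divide add.commute)
    obtain i where i: "\<And>z w. z\<in>stolz \<xi> (real 0 + 2) \<Longrightarrow> w\<in>stolz \<xi> (real 0 + 2) \<Longrightarrow>
        dist z \<xi> < 1 / (real i + 1) \<Longrightarrow> dist w \<xi> < 1 / (real i + 1) \<Longrightarrow> norm (f z - f w) \<le> 1 / (real j + 1)"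
      using R by blast
    have "\<forall>\<^sub>F n in sequentially. dist (radial n \<xi>) \<xi> < 1 / (real i + 1)"
      by (rule tendstoD[OF radial_tendsto]) simp
    then obtain N where N: "\<And>n. n \<ge> N \<Longrightarrow> dist (radial n \<xi>) \<xi> < 1 / (real i + 1)"
      by (auto simp: eventually_sequentially)
    show "\<exists>N. \<forall>m\<ge>N. \<forall>n\<ge>N. dist (f (radial m \<xi>)) (f (radial n \<xi>)) < e"
    proof (intro exI allI impI)
      fix m n assume "N \<le> m" "N \<le> n"
      then have "norm (f (radial m \<xi>) - f (radial n \<xi>)) \<le> 1 / (real j + 1)"
        using radial_in_stolz[OF assms] by (intro i N) auto
      then show "dist (f (radial m \<xi>)) (f (radial n \<xi>)) < e"
        using j by (simp add: dist_norm)
    qed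
  qed
  then obtain L where L: "(\<lambda>n. f (radial n \<xi>)) \<longlonglongrightarrow> L"
    using Cauchy_convergent convergent_def by blast
  have "has_nt_limit f \<xi> L"
  proof (rule has_nt_limitI, rule tendstoI)
    fix m :: nat and e :: real assume "0 < e"
    then obtain j where j: "1 / (real j + 1) < e"
      using reals_Archimedean by (auto simp: inverse_eq_divide add.commute)
    obtain i where i: "\<And>z w. z\<in>stolz \<xi> (real m + 2) \<Longrightarrow> w\<in>stolz \<xi> (real m + 2) \<Longrightarrow>
        dist z \<xi> < 1 / (real i + 1) \<Longrightarrow> dist w \<xi> < 1 / (real i + 1) \<Longrightarrow> norm (f z - f w) \<le> 1 / (real j + 1)"
      using R by blast
    have "dist (f z) L < e" if z: "z \<in> stolz \<xi> (real m + 2)" "dist z \<xi> < 1 / (real i + 1)" for z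
    proof -
      have "\<forall>\<^sub>F n in sequentially. dist (radial n \<xi>) \<xi> < 1 / (real i + 1)"
        by (rule tendstoD[OF radial_tendsto]) simp
      then have "\<forall>\<^sub>F n in sequentially. norm (f z - f (radial n \<xi>)) \<le> 1 / (real j + 1)"
        by eventually_elim (rule i, use z radial_in_stolz[OF assms] in auto)
      moreover have "(\<lambda>n. norm (f z - f (radial n \<xi>))) \<longlonglongrightarrow> norm (f z - L)"
        by (intro tendsto_intros L)
      ultimately have "norm (f z - L) \<le> 1 / (real j + 1)"
        by (intro tendsto_upperbound) auto
      then show ?thesis using j by (simp add: dist_norm)
    qed
    then show "\<forall>\<^sub>F z in at \<xi> within stolz \<xi> (real m + 2). dist (f z) L < e"
      unfolding eventually_at by (intro exI[of _ "1 / (real i + 1)"]) auto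
  qed
  then show ?L ..
qed

text \<open>For fixed \<open>z\<close> and \<open>w\<close> the points \<open>\<xi>\<close> whose
  Stolz regions contain both, close to the vertex, form an open set. Failure of the oscillation
  bound is a union of such sets over all bad pairs, hence open although the union is uncountable;
  only the indices \<open>m\<close>, \<open>j\<close>, \<open>i\<close> enter as countable
  operations.\<close>

lemma sets_nt_limit_exists [measurable]: "{\<xi> \<in> sphere 0 1. \<exists>L. has_nt_limit f \<xi> L} \<in> sets circ"
proof -
  define U where "U m i j = (\<Union>(z, w) \<in> {(z, w). z \<in> ball 0 1 \<and> w \<in> ball 0 1 \<and> \<not> norm (f z - f w) \<le> 1 / (real j + 1)}.
      ball z ((real m + 2) * (1 - norm z)) \<inter> ball w ((real m + 2) * (1 - norm w)) \<inter>
      ball z (1 / (real i + 1)) \<inter> ball w (1 / (real i + 1)))" for m i j :: nat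
  have "{\<xi> \<in> sphere 0 1. \<exists>L. has_nt_limit f \<xi> L} = (\<Inter>m. \<Inter>j. \<Union>i. sphere 0 1 \<inter> - U m i j)"
  proof (intro set_eqI)
    fix \<xi>
    show "\<xi> \<in> {\<xi> \<in> sphere 0 1. \<exists>L. has_nt_limit f \<xi> L} \<longleftrightarrow> \<xi> \<in> (\<Inter>m. \<Inter>j. \<Union>i. sphere 0 1 \<inter> - U m i j)"
    proof (cases "norm \<xi> = 1")
      case True
      have "(\<forall>z\<in>stolz \<xi> (real m + 2). \<forall>w\<in>stolz \<xi> (real m + 2).
        dist z \<xi> < 1 / (real i + 1) \<longrightarrow> dist w \<xi> < 1 / (real i + 1) \<longrightarrow> norm (f z - f w) \<le> 1 / (real j + 1))
        \<longleftrightarrow> \<xi> \<notin> U m i j" for m i j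
        unfolding U_def stolz_def by (auto simp: dist_norm)
      then show ?thesis using True by (simp add: nt_limit_exists_iff)
    qed auto
  qed
  also have "\<dots> \<in> sets circ"
  proof -
    have "open (U m i j)" for m i j unfolding U_def by (intro open_UN) auto
    then have "sphere 0 1 \<inter> - U m i j \<in> sets circ" for m i j
      by (intro sets_circI disjI2) auto
    then show ?thesis by (intro sets.countable_INT' image_subsetI sets.countable_UN') auto
  qed
  finally show ?thesis .
qed

lemma borel_measurable_nt_lim [measurable]:
  assumes "continuous_on (ball 0 1) f"
  shows "nt_lim f \<in> borel_measurable circ"
proof -
  have r: "(\<lambda>\<xi>. f (radial n \<xi>)) \<in> borel_measurable circ" for n
  proof (intro measurable_circI continuous_on_compose2[OF assms])
    show "continuous_on (sphere 0 1) (radial n)"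
      unfolding radial_def by (intro continuous_intros)
    show "radial n ` sphere 0 1 \<subseteq> ball 0 1"
      using radial_in_ball by fastforce
  qed
  \<comment> \<open>Where no limit exists the predicate in \<open>nt_lim\<close> is constantly
    false, so its unspecified value is the same at all such points and the else branch is a
    constant.\<close>
  have "(\<lambda>\<xi>. if \<xi> \<in> {\<xi> \<in> sphere 0 1. \<exists>L. has_nt_limit f \<xi> L}
      then lim (\<lambda>n. f (radial n \<xi>)) else (THE L :: complex. False)) \<in> borel_measurable circ"
  proof (intro measurable_If_set borel_measurable_lim_metric r)
    have "{\<xi> \<in> sphere 0 1. \<exists>L. has_nt_limit f \<xi> L} \<inter> space circ = {\<xi> \<in> sphere 0 1. \<exists>L. has_nt_limit f \<xi> L}"
      by auto
    then show "{\<xi> \<in> sphere 0 1. \<exists>L. has_nt_limit f \<xi> L} \<inter> space circ \<in> sets circ"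
      using sets_nt_limit_exists[of f] by (simp only:)
  qed auto
  also have "?this \<longleftrightarrow> ?thesis"
  proof (rule measurable_cong)
    fix \<xi> assume "\<xi> \<in> space circ"
    then have xi: "norm \<xi> = 1" by simp
    show "(if \<xi> \<in> {\<xi> \<in> sphere 0 1. \<exists>L. has_nt_limit f \<xi> L}
      then lim (\<lambda>n. f (radial n \<xi>)) else (THE L :: complex. False)) = nt_lim f \<xi>"
    proof (cases "\<exists>L. has_nt_limit f \<xi> L")
      case True
      then obtain L where "has_nt_limit f \<xi> L" ..
      then have "nt_lim f \<xi> = L" "lim (\<lambda>n. f (radial n \<xi>)) = L"
        by (auto intro: nt_lim_eq[OF xi] limI nt_lim_radial[OF xi])
      then show ?thesis using True xi by simp
    next
      case False
      then have "has_nt_limit f \<xi> = (\<lambda>L. False)" by auto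
      then show ?thesis using False by (simp add: nt_lim_def)
    qed
  qed
  finally show ?thesis .
qed

section \<open>Orthogonal systems and Bessel's inequality on the circle\<close>

lemma borel_measurable_cnj [measurable]: "cnj \<in> borel_measurable borel"
  by (intro borel_measurable_continuous_onI continuous_intros)

lemma orthogonal_L2_norm:
  fixes e :: "nat \<Rightarrow> complex \<Rightarrow> complex"
  assumes e: "\<And>n. continuous_on (sphere 0 1) (e n)"
    and orth: "\<And>n m. (LINT \<zeta>|arclen. e n \<zeta> * cnj (e m \<zeta>)) = (if n = m then 2 * of_real pi else 0)"
    and A: "finite A"
  shows "(LINT \<zeta>|arclen. (norm (\<Sum>n\<in>A. c n * e n \<zeta>))\<^sup>2) = 2 * pi * (\<Sum>n\<in>A. (norm (c n))\<^sup>2)"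
proof -
  have int: "integrable arclen (\<lambda>\<zeta>. c n * cnj (c m) * (e n \<zeta> * cnj (e m \<zeta>)))" for n m
    by (intro integrable_arclen_continuous continuous_intros e)
  have "complex_of_real (LINT \<zeta>|arclen. (norm (\<Sum>n\<in>A. c n * e n \<zeta>))\<^sup>2) =
      (LINT \<zeta>|arclen. complex_of_real ((norm (\<Sum>n\<in>A. c n * e n \<zeta>))\<^sup>2))"
    by (rule integral_complex_of_real[symmetric])
  also have "\<dots> = (LINT \<zeta>|arclen. (\<Sum>n\<in>A. \<Sum>m\<in>A. c n * cnj (c m) * (e n \<zeta> * cnj (e m \<zeta>))))"
    unfolding complex_norm_square cnj_sum sum_product
    by (intro Bochner_Integration.integral_cong refl sum.cong) (simp add: mult_ac)
  also have "\<dots> = (\<Sum>n\<in>A. \<Sum>m\<in>A. c n * cnj (c m) * (LINT \<zeta>|arclen. e n \<zeta> * cnj (e m \<zeta>)))"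
    using int by (simp add: integral_sum)
  also have "\<dots> = (\<Sum>n\<in>A. c n * cnj (c n) * (2 * of_real pi))"
    using A by (simp add: orth if_distrib[of "(*) _"] sum.delta cong: if_cong)
  also have "\<dots> = complex_of_real (2 * pi * (\<Sum>n\<in>A. (norm (c n))\<^sup>2))"
    by (simp add: complex_norm_square sum_distrib_left mult_ac del: of_real_power)
  finally show ?thesis by (simp only: of_real_eq_iff)
qed

lemma mult_le_sum_squares:
  fixes x y :: real
  assumes "0 \<le> x" "0 \<le> y"
  shows "x * y \<le> x\<^sup>2 + y\<^sup>2"
  using sum_squares_bound[of x y] mult_nonneg_nonneg[OF assms] by linarith

lemma norm_add_mult_square_le:
  fixes x c y :: complex
  shows "(norm (x + c * y))\<^sup>2 \<le> 2 * (norm x)\<^sup>2 + 2 * (norm c)\<^sup>2 * (norm y)\<^sup>2"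
proof -
  have "(norm (x + c * y))\<^sup>2 \<le> (norm x + norm c * norm y)\<^sup>2"
    by (intro power_mono) (auto intro: order_trans[OF norm_triangle_ineq] simp: norm_mult)
  also have "\<dots> \<le> 2 * (norm x)\<^sup>2 + 2 * (norm c * norm y)\<^sup>2"
    using sum_squares_bound[of "norm x" "norm c * norm y"] unfolding power2_sum by linarith
  finally show ?thesis by (simp add: power_mult_distrib)
qed

lemma integrable_arclen_square_mult:
  fixes h e :: "complex \<Rightarrow> complex"
  assumes h[measurable]: "h \<in> borel_measurable circ" and h2: "integrable arclen (\<lambda>\<zeta>. (norm (h \<zeta>))\<^sup>2)"
    and e: "continuous_on (sphere 0 1) e"
  shows "integrable arclen (\<lambda>\<zeta>. h \<zeta> * e \<zeta>)"
proof (rule Bochner_Integration.integrable_bound)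
  have [measurable]: "e \<in> borel_measurable circ" by (rule measurable_circI[OF e])
  show "integrable arclen (\<lambda>\<zeta>. (norm (h \<zeta>))\<^sup>2 + (norm (e \<zeta>))\<^sup>2)"
    by (intro Bochner_Integration.integrable_add h2 integrable_arclen_continuous continuous_intros e)
  show "AE \<zeta> in arclen. norm (h \<zeta> * e \<zeta>) \<le> norm ((norm (h \<zeta>))\<^sup>2 + (norm (e \<zeta>))\<^sup>2)"
    by (intro AE_I2) (simp add: norm_mult mult_le_sum_squares)
  show "(\<lambda>\<zeta>. h \<zeta> * e \<zeta>) \<in> borel_measurable arclen" by measurable
qed

text \<open>Nonnegativity of the integral of \<open>|h - p|\<^sup>2\<close>, where \<open>p\<close>
  is the projection of \<open>h\<close>; the division by \<open>2 * pi\<close> in its coefficients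
  reflects the norms of the \<open>e n\<close>. The system is abstract because nonnegative and
  negative frequencies are both needed.\<close>

lemma bessel_arclen:
  fixes e :: "nat \<Rightarrow> complex \<Rightarrow> complex" and h :: "complex \<Rightarrow> complex"
  assumes e: "\<And>n. continuous_on (sphere 0 1) (e n)"
    and orth: "\<And>n m. (LINT \<zeta>|arclen. e n \<zeta> * cnj (e m \<zeta>)) = (if n = m then 2 * of_real pi else 0)"
    and h[measurable]: "h \<in> borel_measurable circ" and h2: "integrable arclen (\<lambda>\<zeta>. (norm (h \<zeta>))\<^sup>2)"
    and A: "finite A"
  shows "(\<Sum>n\<in>A. (norm (LINT \<zeta>|arclen. h \<zeta> * cnj (e n \<zeta>)))\<^sup>2) \<le> 2 * pi * (LINT \<zeta>|arclen. (norm (h \<zeta>))\<^sup>2)"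
proof -
  have [measurable]: "e n \<in> borel_measurable circ" for n by (rule measurable_circI[OF e])
  have he: "integrable arclen (\<lambda>\<zeta>. h \<zeta> * cnj (e n \<zeta>))" for n
    by (rule integrable_arclen_square_mult[OF h h2 continuous_on_cnj[OF e]])
  define H where "H n = (LINT \<zeta>|arclen. h \<zeta> * cnj (e n \<zeta>))" for n
  define c where "c n = H n / (2 * of_real pi)" for n
  define p where "p \<zeta> = (\<Sum>n\<in>A. c n * e n \<zeta>)" for \<zeta>
  have [measurable]: "p \<in> borel_measurable circ" unfolding p_def by measurable
  have hp_eq: "h \<zeta> * cnj (p \<zeta>) = (\<Sum>n\<in>A. cnj (c n) * (h \<zeta> * cnj (e n \<zeta>)))" for \<zeta>
    by (simp add: p_def sum_distrib_left mult_ac)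
  have hp: "integrable arclen (\<lambda>\<zeta>. h \<zeta> * cnj (p \<zeta>))"
    unfolding hp_eq by (intro Bochner_Integration.integrable_sum integrable_mult_right he)
  have S: "(\<Sum>n\<in>A. (norm (c n))\<^sup>2) = (\<Sum>n\<in>A. (norm (H n))\<^sup>2) / (2*pi)\<^sup>2"
    by (simp add: c_def norm_divide power_divide sum_divide_distrib norm_mult)
  have Ihp: "(LINT \<zeta>|arclen. h \<zeta> * cnj (p \<zeta>)) = complex_of_real ((\<Sum>n\<in>A. (norm (H n))\<^sup>2) / (2 * pi))"
  proof -
    have "(LINT \<zeta>|arclen. h \<zeta> * cnj (p \<zeta>)) = (\<Sum>n\<in>A. cnj (c n) * H n)"
      unfolding hp_eq H_def using he by (subst Bochner_Integration.integral_sum) auto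
    also have "\<dots> = complex_of_real ((\<Sum>n\<in>A. (norm (H n))\<^sup>2) / (2 * pi))"
      by (simp add: c_def complex_norm_square sum_divide_distrib mult.commute del: of_real_power)
    finally show ?thesis .
  qed
  have ip: "integrable arclen (\<lambda>\<zeta>. (norm (p \<zeta>))\<^sup>2)"
    unfolding p_def by (intro integrable_arclen_continuous continuous_intros e)
  have Ip: "(LINT \<zeta>|arclen. (norm (p \<zeta>))\<^sup>2) = (\<Sum>n\<in>A. (norm (H n))\<^sup>2) / (2*pi)"
    unfolding p_def orthogonal_L2_norm[OF e orth A] S by (simp add: power2_eq_square)
  have exp: "(norm (h \<zeta> - p \<zeta>))\<^sup>2 = (norm (h \<zeta>))\<^sup>2 - 2 * Re (h \<zeta> * cnj (p \<zeta>)) + (norm (p \<zeta>))\<^sup>2" for \<zeta>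
    unfolding cmod_power2 by (simp add: power2_eq_square algebra_simps)
  have "0 \<le> (LINT \<zeta>|arclen. (norm (h \<zeta> - p \<zeta>))\<^sup>2)" by simp
  also have "\<dots> = (LINT \<zeta>|arclen. (norm (h \<zeta>))\<^sup>2) - 2 * Re (LINT \<zeta>|arclen. h \<zeta> * cnj (p \<zeta>)) + (LINT \<zeta>|arclen. (norm (p \<zeta>))\<^sup>2)"
  proof -
    define R where "R \<zeta> = Re (h \<zeta> * cnj (p \<zeta>))" for \<zeta>
    have "integrable arclen R" "(LINT \<zeta>|arclen. R \<zeta>) = Re (LINT \<zeta>|arclen. h \<zeta> * cnj (p \<zeta>))"
      unfolding R_def using hp by (rule integrable_Re, rule integral_Re)
    then show ?thesis
      unfolding exp R_def[symmetric] using h2 ip by simp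
  qed
  also have "\<dots> = (LINT \<zeta>|arclen. (norm (h \<zeta>))\<^sup>2) - (\<Sum>n\<in>A. (norm (H n))\<^sup>2) / (2 * pi)"
    unfolding Ihp Ip by simp
  finally show ?thesis by (simp add: H_def field_simps)
qed

lemma integral_arclen_orthogonal_cnj:
  "(LINT \<zeta>|arclen. cnj \<zeta> ^ n * cnj (cnj \<zeta> ^ m)) = (if n = m then 2 * of_real pi else 0)"
  using integral_arclen_orthogonal[of m n] by (simp add: mult.commute eq_commute)

section \<open>Fatou's theorem and Parseval's identity in the Hardy space\<close>

lemma hardy2_sums:
  assumes "f \<in> hardy2" "norm w < 1"
  shows "(\<lambda>n. taylor_coeff f n * w ^ n) sums f w"
  using holomorphic_power_series[of f 0 1 w] assms by (simp add: hardy2_def taylor_coeff_def)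

lemma hardy2_continuous: "f \<in> hardy2 \<Longrightarrow> continuous_on (ball 0 1) f"
  by (simp add: hardy2_def holomorphic_on_imp_continuous_on)

text \<open>The rate \<open>(1/8) ^ k\<close> is set by the maximal estimate: divided by the square
  of the level \<open>(1/2) ^ k\<close> it leaves \<open>(1/2) ^ k\<close>, which is
  summable.\<close>

lemma hardy2_subsequence:
  assumes "f \<in> hardy2"
  obtains r :: "nat \<Rightarrow> nat" where "strict_mono r"
    "\<And>k m. (\<Sum>n\<in>{r k..<m}. (norm (taylor_coeff f n))\<^sup>2) \<le> (1/8) ^ k"
proof -
  have "summable (\<lambda>n. (norm (taylor_coeff f n))\<^sup>2)" using assms by (simp add: hardy2_def)
  then have "\<forall>k. \<exists>N. \<forall>m\<ge>N. \<forall>n. norm (\<Sum>n\<in>{m..<n}. (norm (taylor_coeff f n))\<^sup>2) < (1/8::real) ^ k"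
    unfolding summable_Cauchy by simp
  then obtain R where R: "\<And>k m n. m \<ge> R k \<Longrightarrow> norm (\<Sum>n\<in>{m..<n}. (norm (taylor_coeff f n))\<^sup>2) < (1/8::real) ^ k"
    by metis
  define r where "r k = k + (\<Sum>j\<le>k. R j)" for k
  have "R k \<le> r k" for k
    using member_le_sum[of k "{..k}" R] by (simp add: r_def)
  then have "(\<Sum>n\<in>{r k..<m}. (norm (taylor_coeff f n))\<^sup>2) \<le> (1/8) ^ k" for k m
    using R[of k "r k" m] by simp
  moreover have "strict_mono r" by (simp add: strict_mono_Suc_iff r_def)
  ultimately show ?thesis using that by blast
qed

text \<open>Borel-Cantelli for the sets where the maximal function of \<open>p k\<close> exceeds
  \<open>(1/2) ^ k\<close>; by the weak type bound their measures decrease like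
  \<open>(1/8) ^ k / (1/4) ^ k\<close>.\<close>

lemma AE_stolz_blocks_small:
  fixes p :: "nat \<Rightarrow> complex \<Rightarrow> complex"
  assumes p: "\<And>k. continuous_on (cball 0 1) (p k)" "\<And>k. p k holomorphic_on ball 0 1"
    and M: "0 < M"
    and p2: "\<And>k. (LINT \<zeta>|arclen. (norm (p k \<zeta>))\<^sup>2) \<le> 2 * pi * (1/8) ^ k"
  shows "AE \<xi> in arclen. \<forall>\<^sub>F k in sequentially. \<forall>z\<in>stolz \<xi> M. norm (p k z) \<le> (1/2) ^ k"
proof -
  interpret finite_measure arclen by (rule finite_measure_arclen)
  define E where "E k = {\<xi> \<in> sphere 0 1. \<exists>z\<in>stolz \<xi> M. (1/2) ^ k < norm (p k z)}" for k
  define K where "K = 80 * pi * (1 + M)\<^sup>2 * (2 * pi)"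
  have K0: "0 \<le> K" by (simp add: K_def)
  have E: "E k \<in> sets arclen" for k
    unfolding E_def using emeasure_nontangential_maximal(1)[OF p M, of "(1/2)^k" k] by simp
  have mE: "measure arclen (E k) \<le> K * (1/2) ^ k" for k
  proof -
    have "emeasure arclen (E k) \<le> ennreal (80 * pi * (1 + M)\<^sup>2 / ((1/2) ^ k)\<^sup>2 * (LINT \<zeta>|arclen. (norm (p k \<zeta>))\<^sup>2))"
      unfolding E_def by (rule emeasure_nontangential_maximal(2)[OF p M]) simp
    also have "\<dots> \<le> ennreal (80 * pi * (1 + M)\<^sup>2 / ((1/2) ^ k)\<^sup>2 * (2 * pi * (1/8) ^ k))"
      by (intro ennreal_leI mult_left_mono p2) auto
    also have "80 * pi * (1 + M)\<^sup>2 / ((1/2) ^ k)\<^sup>2 * (2 * pi * (1/8) ^ k) = K * ((1/8) ^ k / ((1/2) ^ k)\<^sup>2)"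
      by (simp add: K_def)
    also have "(1/8::real) ^ k / ((1/2) ^ k)\<^sup>2 = (1/2) ^ k"
      by (simp add: power2_eq_square flip: power_mult_distrib power_divide)
    finally show ?thesis using K0
      by (simp add: emeasure_eq_measure)
  qed
  have "AE \<xi> in arclen. \<forall>\<^sub>F k in sequentially. \<xi> \<in> space arclen - E k"
  proof (rule borel_cantelli_AE1)
    show "summable (\<lambda>k. measure arclen (E k))"
    proof (rule summable_comparison_test')
      show "summable (\<lambda>k. K * (1/2) ^ k)" by (intro summable_mult summable_geometric) simp
      show "norm (measure arclen (E k)) \<le> K * (1/2) ^ k" for k using mE[of k] by simp
    qed
    show "E k \<in> sets arclen" for k by (rule E)
    show "emeasure arclen (E k) < \<infinity>" for k by (simp add: less_top[symmetric])
  qed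
  then show ?thesis
  proof eventually_elim
    case (elim \<xi>)
    then show ?case
      by (rule eventually_mono) (auto simp: E_def not_less)
  qed
qed

text \<open>Almost everywhere the blocks of the Taylor series are dominated on each Stolz region by
  a geometric series. The partial sums along \<open>r\<close> then converge uniformly there, and the
  limits in \<open>k\<close> and in \<open>z\<close> may be interchanged. That the limit is also the
  limit of these partial sums at \<open>\<xi>\<close> ties the boundary function to the
  coefficients.\<close>

lemma hardy2_nt_limit:
  assumes f: "f \<in> hardy2" and r: "strict_mono r"
    and tail: "\<And>k m. (\<Sum>n\<in>{r k..<m}. (norm (taylor_coeff f n))\<^sup>2) \<le> (1/8) ^ k"
  shows "AE \<xi> in arclen. \<exists>L. has_nt_limit f \<xi> L \<and> (\<lambda>k. \<Sum>n<r k. taylor_coeff f n * \<xi> ^ n) \<longlonglongrightarrow> L"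
proof -
  define a where "a = taylor_coeff f"
  define s where "s k w = (\<Sum>n<r k. a n * w ^ n)" for k w
  define p where "p k w = (\<Sum>n\<in>{r k..<r (Suc k)}. a n * w ^ n)" for k w
  have rS: "r k \<le> r (Suc k)" for k using r by (simp add: strict_mono_Suc_iff less_imp_le)
  have sp: "s (Suc k) w = s k w + p k w" for k w
    using sum.atLeastLessThan_concat[of 0 "r k" "r (Suc k)" "\<lambda>n. a n * w ^ n"] rS[of k]
    by (simp add: s_def p_def lessThan_atLeast0)
  have p2: "(LINT \<zeta>|arclen. (norm (p k \<zeta>))\<^sup>2) \<le> 2 * pi * (1/8) ^ k" for k
    unfolding p_def
    by (subst orthogonal_L2_norm)
      (auto intro!: continuous_intros mult_left_mono tail simp: integral_arclen_orthogonal a_def)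
  have "AE \<xi> in arclen. \<forall>M::nat. \<forall>\<^sub>F k in sequentially. \<forall>z\<in>stolz \<xi> (real M + 2). norm (p k z) \<le> (1/2) ^ k"
    unfolding AE_all_countable
    by (intro allI AE_stolz_blocks_small p2) (auto simp: p_def intro!: continuous_intros holomorphic_intros)
  moreover have "AE \<xi> in arclen. norm \<xi> = 1" by (intro AE_I2) simp
  ultimately show ?thesis
  proof eventually_elim
    case (elim \<xi>)
    then have xi: "norm \<xi> = 1" by simp
    have sxi: "((\<lambda>z. s k z) \<longlongrightarrow> s k \<xi>) (at \<xi> within S)" for k S
      unfolding s_def by (intro tendsto_intros)
    have pxi: "((\<lambda>z. p k z) \<longlongrightarrow> p k \<xi>) (at \<xi> within S)" for k S
      unfolding p_def by (intro tendsto_intros)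
    have diff: "norm (s (K + j) z - s K z) \<le> 2 * (1/2) ^ K - 2 * (1/2) ^ (K + j)"
      if "\<And>k. k \<ge> K \<Longrightarrow> norm (p k z) \<le> (1/2) ^ k" for K j z
    proof (induction j)
      case (Suc j)
      have "norm (s (K + Suc j) z - s K z) \<le> norm (s (K + j) z - s K z) + norm (p (K + j) z)"
        using norm_triangle_ineq[of "s (K + j) z - s K z" "p (K + j) z"] by (simp add: sp algebra_simps)
      also have "\<dots> \<le> (2 * (1/2) ^ K - 2 * (1/2) ^ (K + j)) + (1/2) ^ (K + j)"
        using Suc.IH that[of "K + j"] by (intro add_mono) auto
      finally show ?case by simp
    qed simp
    have diff': "norm (s k z - s K z) \<le> 2 * (1/2) ^ K"
      if "\<And>k. k \<ge> K \<Longrightarrow> norm (p k z) \<le> (1/2) ^ k" "K \<le> k" for K k z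
      using diff[of K z "k - K", OF that(1)] that(2) by (smt (verit) le_add_diff_inverse zero_le_power divide_nonneg_nonneg)
    \<comment> \<open>The block bound extends to \<open>\<xi>\<close> itself, since
      \<open>\<xi>\<close> is a limit point of its Stolz region and the blocks are
      polynomials.\<close>
    have p_at: "\<exists>K. \<forall>k\<ge>K. norm (p k \<xi>) \<le> (1/2) ^ k"
    proof -
      obtain K where K: "\<And>k z. k \<ge> K \<Longrightarrow> z \<in> stolz \<xi> (real 0 + 2) \<Longrightarrow> norm (p k z) \<le> (1/2) ^ k"
        using elim(1) unfolding eventually_sequentially by blast
      have "norm (p k \<xi>) \<le> (1/2) ^ k" if "k \<ge> K" for k
      proof (rule tendsto_upperbound[OF tendsto_norm[OF pxi[of k "stolz \<xi> (real 0 + 2)"]]])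
        show "\<forall>\<^sub>F z in at \<xi> within stolz \<xi> (real 0 + 2). norm (p k z) \<le> (1/2) ^ k"
          using K[OF that] by (auto simp: eventually_at_filter)
        show "at \<xi> within stolz \<xi> (real 0 + 2) \<noteq> bot"
          using at_within_stolz_nontrivial[OF xi, of "real 0 + 2"] by simp
      qed
      then show ?thesis by blast
    qed
    have half: "(\<lambda>k. 2 * (1/2::real) ^ k) \<longlonglongrightarrow> 0"
      using LIMSEQ_power_zero[of "1/2::real"] tendsto_mult_right_zero by fastforce
    have "Cauchy (\<lambda>k. s k \<xi>)"
    proof (rule CauchyI')
      fix e :: real assume "0 < e"
      then have "\<forall>\<^sub>F k in sequentially. 2 * (1/2::real) ^ k < e"
        by (rule order_tendstoD(2)[OF half])
      moreover obtain K where K: "\<forall>k\<ge>K. norm (p k \<xi>) \<le> (1/2) ^ k" using p_at by blast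
      ultimately obtain N' where "\<And>k. k \<ge> N' \<Longrightarrow> 2 * (1/2::real) ^ k < e"
        unfolding eventually_sequentially by blast
      then have N: "\<And>k. k \<ge> max N' K \<Longrightarrow> 2 * (1/2::real) ^ k < e" by simp
      show "\<exists>M. \<forall>m\<ge>M. \<forall>n>m. dist (s m \<xi>) (s n \<xi>) < e"
      proof (intro exI allI impI)
        fix m n assume mn: "max N' K \<le> m" "m < n"
        then have "norm (s n \<xi> - s m \<xi>) \<le> 2 * (1/2) ^ m"
          using K by (intro diff') auto
        then show "dist (s m \<xi>) (s n \<xi>) < e"
          using N[OF mn(1)] by (simp add: dist_norm norm_minus_commute)
      qed
    qed
    then obtain L where L: "(\<lambda>k. s k \<xi>) \<longlonglongrightarrow> L" using Cauchy_convergent convergent_def by blast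
    have sf: "(\<lambda>k. s k z) \<longlonglongrightarrow> f z" if "norm z < 1" for z
      using hardy2_sums[OF f that] LIMSEQ_subseq_LIMSEQ[OF _ r, of "\<lambda>N. \<Sum>n<N. a n * z ^ n"]
      by (simp add: sums_def a_def s_def o_def)
    have "has_nt_limit f \<xi> L"
    proof (rule has_nt_limitI)
      fix M :: nat
      obtain K where K: "\<And>k z. k \<ge> K \<Longrightarrow> z \<in> stolz \<xi> (real M + 2) \<Longrightarrow> norm (p k z) \<le> (1/2) ^ k"
        using elim(1) unfolding eventually_sequentially by blast
      have near: "norm (f z - s k z) \<le> 2 * (1/2) ^ k" if "k \<ge> K" "z \<in> stolz \<xi> (real M + 2)" for k z
      proof (rule tendsto_upperbound)
        show "(\<lambda>j. norm (s j z - s k z)) \<longlonglongrightarrow> norm (f z - s k z)"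
          using that by (intro tendsto_intros sf) (auto simp: stolz_def)
        show "\<forall>\<^sub>F j in sequentially. norm (s j z - s k z) \<le> 2 * (1/2) ^ k"
          using eventually_ge_at_top[of k] by eventually_elim (rule diff', use K that in auto)
      qed auto
      have unif: "uniform_limit (stolz \<xi> (real M + 2)) s f sequentially"
      proof (rule uniform_limitI)
        fix e :: real assume "0 < e"
        then have "\<forall>\<^sub>F k in sequentially. 2 * (1/2::real) ^ k < e"
          by (rule order_tendstoD(2)[OF half])
        moreover have "\<forall>\<^sub>F k in sequentially. k \<ge> K" by (rule eventually_ge_at_top)
        ultimately show "\<forall>\<^sub>F k in sequentially. \<forall>z\<in>stolz \<xi> (real M + 2). dist (s k z) (f z) < e"
        proof eventually_elim
          case (elim k)
          then show ?case using near[of k] by (force simp: dist_norm norm_minus_commute)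
        qed
      qed
      show "(f \<longlongrightarrow> L) (at \<xi> within stolz \<xi> (real M + 2))"
        by (rule swap_uniform_limit[OF _ L unif]) (auto simp: sxi)
    qed
    then show ?case using L by (auto simp: s_def a_def)
  qed
qed

text \<open>Fatou's lemma along the convergent partial sums bounds \<open>b\<close> and the errors
  \<open>b - s j\<close> in square mean. The errors tend to 0, so the Fourier coefficients of
  \<open>b\<close> are those of the partial sums in the limit. Parseval is the bound from Fatou's
  lemma in one direction and Bessel's inequality in the other.\<close>

lemma hardy2_boundary:
  assumes f: "f \<in> hardy2"
  defines "a \<equiv> taylor_coeff f" and "b \<equiv> nt_lim f"
  shows hardy2_AE_nt_limit: "AE \<xi> in arclen. \<exists>L. has_nt_limit f \<xi> L"
    and hardy2_boundary_square_integrable: "integrable arclen (\<lambda>\<xi>. (norm (b \<xi>))\<^sup>2)"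
    and hardy2_parseval: "(LINT \<xi>|arclen. (norm (b \<xi>))\<^sup>2) = 2 * pi * (\<Sum>n. (norm (a n))\<^sup>2)"
    and hardy2_fourier_nonneg: "\<And>n. (LINT \<xi>|arclen. b \<xi> * cnj \<xi> ^ n) = 2 * of_real pi * a n"
    and hardy2_fourier_neg: "\<And>n. (LINT \<xi>|arclen. b \<xi> * \<xi> ^ Suc n) = 0"
proof -
  interpret finite_measure arclen by (rule finite_measure_arclen)
  have sum_a: "summable (\<lambda>n. (norm (a n))\<^sup>2)" using f by (simp add: hardy2_def a_def)
  obtain r :: "nat \<Rightarrow> nat" where r: "strict_mono r"
    and tail: "\<And>k m. (\<Sum>n\<in>{r k..<m}. (norm (a n))\<^sup>2) \<le> (1/8) ^ k"
    using hardy2_subsequence[OF f] unfolding a_def by blast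
  define s where "s k \<xi> = (\<Sum>n<r k. a n * \<xi> ^ n)" for k \<xi>
  have AE: "AE \<xi> in arclen. \<exists>L. has_nt_limit f \<xi> L \<and> (\<lambda>k. s k \<xi>) \<longlonglongrightarrow> L"
    using hardy2_nt_limit[OF f r] tail by (simp add: s_def a_def)
  then show "AE \<xi> in arclen. \<exists>L. has_nt_limit f \<xi> L"
    by eventually_elim blast
  have AE1: "AE \<xi> in arclen. norm \<xi> = 1" by (intro AE_I2) simp
  have AEb: "AE \<xi> in arclen. (\<lambda>k. s k \<xi>) \<longlonglongrightarrow> b \<xi>"
    using AE AE1
  proof eventually_elim
    case (elim \<xi>)
    then obtain L where "has_nt_limit f \<xi> L" "(\<lambda>k. s k \<xi>) \<longlonglongrightarrow> L" by blast
    then show ?case using nt_lim_eq[of \<xi> f L] elim by (simp add: b_def)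
  qed
  have bm[measurable]: "b \<in> borel_measurable circ"
    unfolding b_def by (intro borel_measurable_nt_lim hardy2_continuous f)
  have sc: "continuous_on S (s k)" for k S unfolding s_def by (intro continuous_intros)
  have sm[measurable]: "s k \<in> borel_measurable circ" for k by (rule measurable_circI[OF sc])
  have norm_block: "(LINT \<zeta>|arclen. (norm (\<Sum>n\<in>A. a n * \<zeta> ^ n))\<^sup>2) = 2 * pi * (\<Sum>n\<in>A. (norm (a n))\<^sup>2)"
    if "finite A" for A
    using that by (intro orthogonal_L2_norm) (auto intro!: continuous_intros simp: integral_arclen_orthogonal)
  \<comment> \<open>Used with \<open>g = 0\<close> for the norm of \<open>b\<close> and with
    \<open>g = s j\<close> for the error; in the second case the bound holds from index
    \<open>j\<close> on, hence the shifted sequence.\<close>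
  have fatou: "(\<integral>\<^sup>+\<xi>. ennreal ((norm (b \<xi> - g \<xi>))\<^sup>2) \<partial>arclen) \<le> ennreal C"
    if g: "continuous_on (sphere 0 1) g" and C: "\<And>k. j \<le> k \<Longrightarrow> (LINT \<xi>|arclen. (norm (s k \<xi> - g \<xi>))\<^sup>2) \<le> C" for g j C
  proof -
    have [measurable]: "g \<in> borel_measurable circ" by (rule measurable_circI[OF g])
    have "(\<integral>\<^sup>+\<xi>. ennreal ((norm (b \<xi> - g \<xi>))\<^sup>2) \<partial>arclen)
        = (\<integral>\<^sup>+\<xi>. liminf (\<lambda>k. ennreal ((norm (s (k + j) \<xi> - g \<xi>))\<^sup>2)) \<partial>arclen)"
    proof (rule nn_integral_cong_AE, use AEb in eventually_elim)
      case (elim \<xi>)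
      have "(\<lambda>k. s (k + j) \<xi>) \<longlonglongrightarrow> b \<xi>" using elim by (rule LIMSEQ_ignore_initial_segment)
      then have "(\<lambda>k. ennreal ((norm (s (k + j) \<xi> - g \<xi>))\<^sup>2)) \<longlonglongrightarrow> ennreal ((norm (b \<xi> - g \<xi>))\<^sup>2)"
        by (intro tendsto_intros tendsto_ennrealI)
      from lim_imp_Liminf[OF sequentially_bot this] show ?case by (rule sym)
    qed
    also have "\<dots> \<le> liminf (\<lambda>k. (\<integral>\<^sup>+\<xi>. ennreal ((norm (s (k + j) \<xi> - g \<xi>))\<^sup>2) \<partial>arclen))"
      by (rule nn_integral_liminf) simp
    also have "\<dots> \<le> liminf (\<lambda>k. ennreal C)"
    proof (rule Liminf_mono, rule always_eventually, rule allI)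
      fix k
      have "(\<integral>\<^sup>+\<xi>. ennreal ((norm (s (k + j) \<xi> - g \<xi>))\<^sup>2) \<partial>arclen) = ennreal (LINT \<xi>|arclen. (norm (s (k + j) \<xi> - g \<xi>))\<^sup>2)"
        by (intro nn_integral_eq_integral integrable_arclen_continuous continuous_intros sc g) auto
      also have "\<dots> \<le> ennreal C" by (intro ennreal_leI C) auto
      finally show "(\<integral>\<^sup>+\<xi>. ennreal ((norm (s (k + j) \<xi> - g \<xi>))\<^sup>2) \<partial>arclen) \<le> ennreal C" .
    qed
    also have "\<dots> = ennreal C" by (simp add: Liminf_const)
    finally show ?thesis .
  qed
  have integ: "integrable arclen (\<lambda>\<xi>. (norm (b \<xi> - g \<xi>))\<^sup>2)" "(LINT \<xi>|arclen. (norm (b \<xi> - g \<xi>))\<^sup>2) \<le> C"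
    if g: "continuous_on (sphere 0 1) g" and C: "\<And>k. j \<le> k \<Longrightarrow> (LINT \<xi>|arclen. (norm (s k \<xi> - g \<xi>))\<^sup>2) \<le> C" for g j C
  proof -
    have [measurable]: "g \<in> borel_measurable circ" by (rule measurable_circI[OF g])
    have C0: "0 \<le> C" using C[of j] by (rule order_trans[rotated]) auto
    show i: "integrable arclen (\<lambda>\<xi>. (norm (b \<xi> - g \<xi>))\<^sup>2)"
      using fatou[OF that] by (intro integrableI_bounded) (auto simp: less_top[symmetric] top_unique)
    show "(LINT \<xi>|arclen. (norm (b \<xi> - g \<xi>))\<^sup>2) \<le> C"
      using fatou[OF that] C0 by (subst (asm) nn_integral_eq_integral[OF i]) auto
  qed
  have upper: "(LINT \<xi>|arclen. (norm (s k \<xi> - 0))\<^sup>2) \<le> 2 * pi * (\<Sum>n. (norm (a n))\<^sup>2)" for k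
    using norm_block[of "{..<r k}"] sum_a by (simp add: s_def sum_le_suminf)
  show b2: "integrable arclen (\<lambda>\<xi>. (norm (b \<xi>))\<^sup>2)"
    using integ(1)[where g="\<lambda>_. 0", OF continuous_on_const upper] by simp
  have le: "(LINT \<xi>|arclen. (norm (b \<xi>))\<^sup>2) \<le> 2 * pi * (\<Sum>n. (norm (a n))\<^sup>2)"
    using integ(2)[where g="\<lambda>_. 0", OF continuous_on_const upper] by simp
  have block: "(LINT \<xi>|arclen. (norm (s k \<xi> - s j \<xi>))\<^sup>2) \<le> 2 * pi * (1/8) ^ j" if "j \<le> k" for j k
  proof -
    have "r j \<le> r k" using r that by (simp add: strict_mono_less_eq)
    then have "s k \<xi> - s j \<xi> = (\<Sum>n\<in>{r j..<r k}. a n * \<xi> ^ n)" for \<xi>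
      using sum.atLeastLessThan_concat[of 0 "r j" "r k" "\<lambda>n. a n * \<xi> ^ n"]
      by (simp add: s_def lessThan_atLeast0 diff_eq_eq add.commute)
    then show ?thesis using norm_block[of "{r j..<r k}"] tail by simp
  qed
  \<comment> \<open>Passage from square mean to mean by \<open>x \<le> d + x\<^sup>2 / d\<close>.
    With \<open>d = (1/2) ^ j\<close> the quadratic error \<open>(1/8) ^ j\<close> divided by
    \<open>d\<close> is \<open>(1/4) ^ j\<close>, which is below \<open>d\<close>.\<close>
  have L1: "integrable arclen (\<lambda>\<xi>. norm (b \<xi> - s j \<xi>))" "(LINT \<xi>|arclen. norm (b \<xi> - s j \<xi>)) \<le> 4 * pi * (1/2) ^ j" for j
  proof -
    define d where "d = (1/2::real) ^ j"
    have d: "0 < d" by (simp add: d_def)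
    note I = integ[OF sc block, of j]
    have pt: "x \<le> d + x\<^sup>2 / d" for x :: real
    proof -
      have "d * x \<le> d * d + x * x"
        using sum_squares_bound[of d x] sum_squares_ge_zero[of d x]
        unfolding power2_eq_square by linarith
      then show ?thesis using d by (simp add: field_simps power2_eq_square)
    qed
    show i: "integrable arclen (\<lambda>\<xi>. norm (b \<xi> - s j \<xi>))"
    proof (rule Bochner_Integration.integrable_bound)
      show "integrable arclen (\<lambda>\<xi>. d + (norm (b \<xi> - s j \<xi>))\<^sup>2 / d)" using I(1) by simp
      show "AE \<xi> in arclen. norm (norm (b \<xi> - s j \<xi>)) \<le> norm (d + (norm (b \<xi> - s j \<xi>))\<^sup>2 / d)"
        using pt d by (intro AE_I2) (simp add: abs_of_nonneg)
    qed simp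
    have "(LINT \<xi>|arclen. norm (b \<xi> - s j \<xi>)) \<le> (LINT \<xi>|arclen. d + (norm (b \<xi> - s j \<xi>))\<^sup>2 / d)"
      using i I(1) pt by (intro integral_mono) auto
    also have "\<dots> = 2 * pi * d + (LINT \<xi>|arclen. (norm (b \<xi> - s j \<xi>))\<^sup>2) / d"
      using I(1) by (simp add: measure_def emeasure_arclen_space)
    also have "\<dots> \<le> 2 * pi * d + (2 * pi * (1/8) ^ j) / d"
      using I(2) d by (intro add_left_mono divide_right_mono) auto
    also have "(1/8::real) ^ j = (1/4) ^ j * d" by (simp add: d_def flip: power_mult_distrib)
    also have "2 * pi * d + 2 * pi * ((1/4) ^ j * d) / d = 2 * pi * d + 2 * pi * (1/4) ^ j"
      using d by simp
    also have "\<dots> \<le> 2 * pi * d + 2 * pi * (1/2) ^ j"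
      by (intro add_left_mono mult_left_mono power_mono) auto
    finally show "(LINT \<xi>|arclen. norm (b \<xi> - s j \<xi>)) \<le> 4 * pi * (1/2) ^ j" by (simp add: d_def)
  qed
  have conv: "(\<lambda>j. (LINT \<xi>|arclen. s j \<xi> * e \<xi>)) \<longlonglongrightarrow> (LINT \<xi>|arclen. b \<xi> * e \<xi>)"
    if e: "continuous_on (sphere 0 1) e" "\<And>\<xi>. norm \<xi> = 1 \<Longrightarrow> norm (e \<xi>) = 1" for e :: "complex \<Rightarrow> complex"
  proof (rule metric_tendsto_imp_tendsto)
    show "(\<lambda>j. 4 * pi * (1/2) ^ j) \<longlonglongrightarrow> 0"
      by (intro tendsto_mult_right_zero LIMSEQ_power_zero) simp
    have [measurable]: "e \<in> borel_measurable circ" by (rule measurable_circI[OF e(1)])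
    have i: "integrable arclen (\<lambda>\<xi>. (b \<xi> - s j \<xi>) * e \<xi>)" for j
      by (rule Bochner_Integration.integrable_bound[OF L1(1)[of j]]) (use e(2) in \<open>auto simp: norm_mult intro!: AE_I2\<close>)
    have si: "integrable arclen (\<lambda>\<xi>. s j \<xi> * e \<xi>)" for j
      by (intro integrable_arclen_continuous continuous_intros sc e)
    have "dist (LINT \<xi>|arclen. s j \<xi> * e \<xi>) (LINT \<xi>|arclen. b \<xi> * e \<xi>) \<le> dist (4 * pi * (1/2) ^ j) 0" for j
    proof -
      have "(LINT \<xi>|arclen. b \<xi> * e \<xi>) = (LINT \<xi>|arclen. (b \<xi> - s j \<xi>) * e \<xi> + s j \<xi> * e \<xi>)"
        by (intro Bochner_Integration.integral_cong) (auto simp: algebra_simps)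
      also have "\<dots> = (LINT \<xi>|arclen. (b \<xi> - s j \<xi>) * e \<xi>) + (LINT \<xi>|arclen. s j \<xi> * e \<xi>)"
        by (rule Bochner_Integration.integral_add[OF i si])
      finally have "dist (LINT \<xi>|arclen. s j \<xi> * e \<xi>) (LINT \<xi>|arclen. b \<xi> * e \<xi>) = norm (LINT \<xi>|arclen. (b \<xi> - s j \<xi>) * e \<xi>)"
        by (simp add: dist_norm norm_minus_commute)
      also have "\<dots> \<le> (LINT \<xi>|arclen. norm ((b \<xi> - s j \<xi>) * e \<xi>))" by (rule integral_norm_bound)
      also have "\<dots> = (LINT \<xi>|arclen. norm (b \<xi> - s j \<xi>))"
        using e(2) by (intro Bochner_Integration.integral_cong) (auto simp: norm_mult)
      also have "\<dots> \<le> 4 * pi * (1/2) ^ j" by (rule L1(2))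
      finally show ?thesis by simp
    qed
    then show "\<forall>\<^sub>F j in sequentially. dist (LINT \<xi>|arclen. s j \<xi> * e \<xi>) (LINT \<xi>|arclen. b \<xi> * e \<xi>) \<le> dist (4 * pi * (1/2) ^ j) 0"
      by (rule always_eventually[OF allI])
  qed
  have se: "(LINT \<xi>|arclen. s j \<xi> * e \<xi>) = (\<Sum>m<r j. a m * (LINT \<xi>|arclen. \<xi> ^ m * e \<xi>))"
    if e: "continuous_on (sphere 0 1) e" for e j
  proof -
    have "s j \<xi> * e \<xi> = (\<Sum>m<r j. a m * (\<xi> ^ m * e \<xi>))" for \<xi>
      by (simp add: s_def sum_distrib_right mult.assoc)
    moreover have "integrable arclen (\<lambda>\<xi>. a m * (\<xi> ^ m * e \<xi>))" for m
      by (intro integrable_arclen_continuous continuous_intros e)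
    ultimately show ?thesis by (simp add: Bochner_Integration.integral_sum)
  qed
  show coef: "(LINT \<xi>|arclen. b \<xi> * cnj \<xi> ^ n) = 2 * of_real pi * a n" for n
  proof -
    have "(\<lambda>j. (LINT \<xi>|arclen. s j \<xi> * cnj \<xi> ^ n)) \<longlonglongrightarrow> (LINT \<xi>|arclen. b \<xi> * cnj \<xi> ^ n)"
      by (intro conv continuous_intros) (simp add: norm_power)
    moreover have "(LINT \<xi>|arclen. s j \<xi> * cnj \<xi> ^ n) = 2 * of_real pi * a n" if "n < j" for j
    proof -
      have nr: "n < r j" using strict_mono_imp_increasing[OF r, of j] that by simp
      have "(LINT \<xi>|arclen. s j \<xi> * cnj \<xi> ^ n) = (\<Sum>m<r j. if m = n then a m * (2 * of_real pi) else 0)"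
        unfolding se[OF continuous_on_power[OF continuous_on_cnj[OF continuous_on_id]]]
        by (intro sum.cong refl) (simp add: integral_arclen_orthogonal)
      then show ?thesis using nr by (simp add: sum.delta mult.commute)
    qed
    then have "(\<lambda>j. (LINT \<xi>|arclen. s j \<xi> * cnj \<xi> ^ n)) \<longlonglongrightarrow> 2 * of_real pi * a n"
      by (intro tendsto_eventually) (auto simp: eventually_sequentially intro!: exI[of _ "Suc n"])
    ultimately show ?thesis by (rule LIMSEQ_unique)
  qed
  show "(LINT \<xi>|arclen. b \<xi> * \<xi> ^ Suc n) = 0" for n
  proof -
    have "(\<lambda>j. (LINT \<xi>|arclen. s j \<xi> * \<xi> ^ Suc n)) \<longlonglongrightarrow> (LINT \<xi>|arclen. b \<xi> * \<xi> ^ Suc n)"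
      by (intro conv continuous_intros) (simp add: norm_power norm_mult)
    moreover have "(LINT \<xi>|arclen. s j \<xi> * \<xi> ^ Suc n) = 0" for j
    proof -
      have "(LINT \<xi>|arclen. \<xi> ^ m * \<xi> ^ Suc n) = 0" for m
        using integral_arclen_orthogonal[of "m + Suc n" 0] by (simp add: power_add mult_ac)
      then show ?thesis by (subst se) (auto intro!: continuous_intros)
    qed
    ultimately show ?thesis by (simp add: LIMSEQ_const_iff)
  qed
  have "2 * pi * (\<Sum>n<N. (norm (a n))\<^sup>2) \<le> (LINT \<xi>|arclen. (norm (b \<xi>))\<^sup>2)" for N
  proof -
    have "(\<Sum>n<N. (norm (LINT \<zeta>|arclen. b \<zeta> * cnj (\<zeta> ^ n)))\<^sup>2) \<le> 2 * pi * (LINT \<zeta>|arclen. (norm (b \<zeta>))\<^sup>2)"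
      using b2 by (intro bessel_arclen[where e = "\<lambda>n \<zeta>. \<zeta> ^ n"])
        (auto intro!: continuous_intros simp: integral_arclen_orthogonal)
    moreover have "(norm (LINT \<zeta>|arclen. b \<zeta> * cnj (\<zeta> ^ n)))\<^sup>2 = (2 * pi) * (2 * pi * (norm (a n))\<^sup>2)" for n
      by (simp add: coef norm_mult power_mult_distrib power2_eq_square)
    ultimately have "(2 * pi) * (2 * pi * (\<Sum>n<N. (norm (a n))\<^sup>2)) \<le> (2 * pi) * (LINT \<zeta>|arclen. (norm (b \<zeta>))\<^sup>2)"
      by (simp only: sum_distrib_left)
    then show ?thesis by (rule mult_left_le_imp_le) simp
  qed
  then have "(\<Sum>n<N. (norm (a n))\<^sup>2) \<le> (LINT \<xi>|arclen. (norm (b \<xi>))\<^sup>2) / (2 * pi)" for N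
    by (simp add: field_simps)
  then have "(\<Sum>n. (norm (a n))\<^sup>2) \<le> (LINT \<xi>|arclen. (norm (b \<xi>))\<^sup>2) / (2 * pi)"
    by (intro suminf_le_const sum_a)
  then have "2 * pi * (\<Sum>n. (norm (a n))\<^sup>2) \<le> (LINT \<xi>|arclen. (norm (b \<xi>))\<^sup>2)"
    by (simp add: field_simps)
  with le show "(LINT \<xi>|arclen. (norm (b \<xi>))\<^sup>2) = 2 * pi * (\<Sum>n. (norm (a n))\<^sup>2)"
    by (rule antisym)
qed

section \<open>The local Dirichlet integral\<close>

definition power_fun :: "(nat \<Rightarrow> complex) \<Rightarrow> complex \<Rightarrow> complex" where
  "power_fun g z = (\<Sum>n. g n * z ^ n)"

lemma taylor_coeff_eqI:
  assumes "\<And>z. norm z < 1 \<Longrightarrow> (\<lambda>n. g n * z ^ n) sums f z"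
  shows "taylor_coeff f = g"
proof
  fix n
  have "f has_fps_expansion Abs_fps g"
  proof (rule has_fps_expansionI)
    have "\<forall>\<^sub>F u in nhds 0. u \<in> ball (0::complex) 1" by (intro eventually_nhds_in_open) auto
    then show "\<forall>\<^sub>F u in nhds 0. (\<lambda>n. fps_nth (Abs_fps g) n * u ^ n) sums f u"
      by eventually_elim (use assms in auto)
  qed
  then have "fps_expansion f 0 = Abs_fps g" by (rule fps_expansion_eqI)
  then have "fps_nth (fps_expansion f 0) n = g n" by simp
  then show "taylor_coeff f n = g n" by (simp add: fps_expansion_def taylor_coeff_def)
qed

lemma hardy2I:
  assumes "\<And>z. norm z < 1 \<Longrightarrow> (\<lambda>n. g n * z ^ n) sums f z" "summable (\<lambda>n. (norm (g n))\<^sup>2)"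
  shows "f \<in> hardy2" "taylor_coeff f = g"
proof -
  show "taylor_coeff f = g" using assms(1) by (rule taylor_coeff_eqI)
  moreover have "f holomorphic_on ball 0 1"
    by (rule power_series_holomorphic) (use assms(1) in auto)
  ultimately show "f \<in> hardy2" using assms(2) by (simp add: hardy2_def)
qed

lemma summable_power_square:
  fixes g :: "nat \<Rightarrow> complex"
  assumes "summable (\<lambda>n. (norm (g n))\<^sup>2)" "norm z < 1"
  shows "summable (\<lambda>n. norm (g n) * norm z ^ n)"
proof (rule summable_comparison_test')
  have "(norm z)\<^sup>2 < 1" using assms(2) by (simp add: abs_square_less_1)
  then show "summable (\<lambda>n. (norm (g n))\<^sup>2 + ((norm z)\<^sup>2) ^ n)"
    by (intro summable_add assms summable_geometric) simp
  show "norm (norm (g n) * norm z ^ n) \<le> (norm (g n))\<^sup>2 + ((norm z)\<^sup>2) ^ n" for n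
  proof -
    have "(norm z ^ n)\<^sup>2 = ((norm z)\<^sup>2) ^ n" by (simp add: power_mult[symmetric] mult.commute)
    then show ?thesis using mult_le_sum_squares[of "norm (g n)" "norm z ^ n"] by simp
  qed
qed

lemma power_fun_sums:
  assumes "summable (\<lambda>n. (norm (g n))\<^sup>2)" "norm z < 1"
  shows "(\<lambda>n. g n * z ^ n) sums power_fun g z"
proof -
  have "summable (\<lambda>n. norm (g n * z ^ n))"
    using summable_power_square[OF assms] by (simp add: norm_mult norm_power)
  then show ?thesis
    unfolding power_fun_def by (rule summable_sums[OF summable_norm_cancel])
qed

lemma power_fun_hardy2:
  assumes "summable (\<lambda>n. (norm (g n))\<^sup>2)"
  shows "power_fun g \<in> hardy2" "taylor_coeff (power_fun g) = g"
  using hardy2I[OF power_fun_sums[OF assms] assms] by auto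

lemma hardy2_summable: "f \<in> hardy2 \<Longrightarrow> summable (\<lambda>n. (norm (taylor_coeff f n))\<^sup>2)"
  by (simp add: hardy2_def)

text \<open>Cauchy-Schwarz against the geometric series; \<open>1 / (1 - |z|\<^sup>2)\<close> is the
  diagonal of the Szego kernel.\<close>

lemma hardy2_pointwise_bound:
  assumes f: "f \<in> hardy2" and z: "norm z < 1"
  shows "(norm (f z))\<^sup>2 \<le> (\<Sum>n. (norm (taylor_coeff f n))\<^sup>2) / (1 - (norm z)\<^sup>2)"
proof -
  define a where "a = taylor_coeff f"
  have z2: "(norm z)\<^sup>2 < 1" using z by (simp add: abs_square_less_1)
  have "(norm (\<Sum>n<N. a n * z ^ n))\<^sup>2 \<le> (\<Sum>n. (norm (a n))\<^sup>2) / (1 - (norm z)\<^sup>2)" for N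
  proof -
    have "norm (\<Sum>n<N. a n * z ^ n) \<le> (\<Sum>n<N. norm (a n) * norm z ^ n)"
      by (rule order_trans[OF norm_sum]) (simp add: norm_mult norm_power)
    then have "(norm (\<Sum>n<N. a n * z ^ n))\<^sup>2 \<le> (\<Sum>n<N. norm (a n) * norm z ^ n)\<^sup>2"
      by (intro power_mono) auto
    also have "\<dots> \<le> (\<Sum>n<N. (norm (a n))\<^sup>2) * (\<Sum>n<N. (norm z ^ n)\<^sup>2)"
      by (rule Cauchy_Schwarz_ineq_sum)
    also have "\<dots> \<le> (\<Sum>n. (norm (a n))\<^sup>2) * (1 / (1 - (norm z)\<^sup>2))"
    proof (intro mult_mono sum_nonneg)
      show "(\<Sum>n<N. (norm (a n))\<^sup>2) \<le> (\<Sum>n. (norm (a n))\<^sup>2)"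
        using hardy2_summable[OF f] by (intro sum_le_suminf) (auto simp: a_def)
      have "(\<Sum>n<N. (norm z ^ n)\<^sup>2) = (\<Sum>n<N. ((norm z)\<^sup>2) ^ n)"
        by (simp add: power_mult[symmetric] mult.commute)
      also have "\<dots> \<le> (\<Sum>n. ((norm z)\<^sup>2) ^ n)"
        using z2 by (intro sum_le_suminf summable_geometric) auto
      also have "\<dots> = 1 / (1 - (norm z)\<^sup>2)" using z2 by (intro suminf_geometric) simp
      finally show "(\<Sum>n<N. (norm z ^ n)\<^sup>2) \<le> 1 / (1 - (norm z)\<^sup>2)" .
      show "0 \<le> (\<Sum>n. (norm (a n))\<^sup>2)"
        using hardy2_summable[OF f] by (intro suminf_nonneg) (auto simp: a_def)
    qed auto
    finally show ?thesis by simp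
  qed
  moreover have "(\<lambda>N. (norm (\<Sum>n<N. a n * z ^ n))\<^sup>2) \<longlonglongrightarrow> (norm (f z))\<^sup>2"
    using hardy2_sums[OF f z] unfolding sums_def a_def by (intro tendsto_intros)
  ultimately show ?thesis
    unfolding a_def by (intro LIMSEQ_le_const2) auto
qed

text \<open>A function in the Hardy space grows at most like \<open>(1 - |z|)\<close> to the power
  -1/2, while \<open>|z - \<xi>|\<close> is at most \<open>M * (1 - |z|)\<close> in a Stolz region;
  the product vanishes at the vertex.\<close>

lemma has_nt_limit_mult_vanishing:
  assumes g: "g \<in> hardy2" and xi: "norm \<xi> = 1"
  shows "has_nt_limit (\<lambda>z. L + (z - \<xi>) * g z) \<xi> L"
  unfolding has_nt_limit_def
proof (intro allI impI)
  fix M :: real assume M: "1 < M"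
  define S where "S = (\<Sum>n. (norm (taylor_coeff g n))\<^sup>2)"
  have S0: "0 \<le> S" using hardy2_summable[OF g] by (auto simp: S_def intro!: suminf_nonneg)
  have bound: "norm ((z - \<xi>) * g z) \<le> M * sqrt S * sqrt (1 - norm z)" if z: "z \<in> stolz \<xi> M" for z
  proof -
    define h where "h = 1 - norm z"
    have h: "0 < h" "norm (z - \<xi>) \<le> M * h" "norm z < 1"
      using z by (auto simp: stolz_def h_def)
    have "1 - (norm z)\<^sup>2 = h * (1 + norm z)" by (simp add: h_def power2_eq_square algebra_simps)
    then have "h \<le> 1 - (norm z)\<^sup>2" using h by simp
    then have "S / (1 - (norm z)\<^sup>2) \<le> S / h" using h S0 by (intro divide_left_mono) auto
    then have "(norm (g z))\<^sup>2 \<le> S / h"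
      using hardy2_pointwise_bound[OF g h(3)] by (simp add: S_def)
    then have "norm (g z) \<le> sqrt (S / h)" by (rule real_le_rsqrt)
    then have "norm (z - \<xi>) * norm (g z) \<le> (M * h) * sqrt (S / h)"
      using h M by (intro mult_mono) auto
    also have "\<dots> = M * sqrt S * sqrt h"
      using h by (simp add: real_sqrt_divide field_simps)
    finally show ?thesis by (simp add: norm_mult h_def)
  qed
  have "((\<lambda>z. M * sqrt S * sqrt (1 - norm z)) \<longlongrightarrow> M * sqrt S * sqrt (1 - norm \<xi>)) (at \<xi> within stolz \<xi> M)"
    by (intro tendsto_intros)
  then have "((\<lambda>z. M * sqrt S * sqrt (1 - norm z)) \<longlongrightarrow> 0) (at \<xi> within stolz \<xi> M)"
    using xi by simp
  then have "((\<lambda>z. (z - \<xi>) * g z) \<longlongrightarrow> 0) (at \<xi> within stolz \<xi> M)"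
    by (rule Lim_null_comparison[rotated]) (use bound in \<open>auto simp: eventually_at_filter\<close>)
  from tendsto_add[OF tendsto_const[of L] this]
  show "((\<lambda>z. L + (z - \<xi>) * g z) \<longlongrightarrow> L) (at \<xi> within stolz \<xi> M)" by simp
qed

section \<open>Division of f - L by z - \<xi>\<close>

definition partial_taylor :: "(complex \<Rightarrow> complex) \<Rightarrow> nat \<Rightarrow> complex \<Rightarrow> complex" where
  "partial_taylor f n \<xi> = (\<Sum>k\<le>n. taylor_coeff f k * \<xi> ^ k)"

text \<open>Taylor coefficients of the formal quotient of \<open>f - L\<close> by
  \<open>z - \<xi>\<close>: the closed solution of the recurrence in
  \<open>quotient_coeff_recurrence\<close>, with \<open>cnj \<xi>\<close> standing for the inverse
  of \<open>\<xi>\<close>.\<close>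

definition quotient_coeff :: "(complex \<Rightarrow> complex) \<Rightarrow> complex \<Rightarrow> complex \<Rightarrow> nat \<Rightarrow> complex" where
  "quotient_coeff f \<xi> L n = cnj \<xi> ^ Suc n * (L - partial_taylor f n \<xi>)"

lemma unimodular_mult_cnj: "norm \<xi> = 1 \<Longrightarrow> \<xi> * cnj \<xi> = 1"
  by (metis complex_norm_square of_real_1 one_power2)

lemma norm_quotient_coeff: "norm \<xi> = 1 \<Longrightarrow> norm (quotient_coeff f \<xi> L n) = norm (L - partial_taylor f n \<xi>)"
  by (simp add: quotient_coeff_def norm_mult norm_power)

lemma quotient_coeff_recurrence:
  assumes "norm \<xi> = 1"
  shows "- \<xi> * quotient_coeff f \<xi> L 0 = taylor_coeff f 0 - L"
    and "quotient_coeff f \<xi> L n - \<xi> * quotient_coeff f \<xi> L (Suc n) = taylor_coeff f (Suc n)"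
proof -
  have x: "\<xi> * cnj \<xi> = 1" "\<And>w. \<xi> * (cnj \<xi> * w) = w"
    using unimodular_mult_cnj[OF assms] by (auto simp flip: mult.assoc)
  then have "(cnj \<xi> * \<xi>) ^ Suc n = 1" by (simp add: mult.commute)
  then have x': "cnj \<xi> ^ Suc n * \<xi> ^ Suc n = 1" by (simp only: power_mult_distrib)
  show "- \<xi> * quotient_coeff f \<xi> L 0 = taylor_coeff f 0 - L"
    by (simp add: quotient_coeff_def partial_taylor_def x)
  have "\<xi> * quotient_coeff f \<xi> L (Suc n) = cnj \<xi> ^ Suc n * (L - partial_taylor f (Suc n) \<xi>)"
    unfolding quotient_coeff_def power_Suc[of _ "Suc n"] mult.assoc by (rule x)
  then have "quotient_coeff f \<xi> L n - \<xi> * quotient_coeff f \<xi> L (Suc n)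
      = cnj \<xi> ^ Suc n * (partial_taylor f (Suc n) \<xi> - partial_taylor f n \<xi>)"
    by (simp add: quotient_coeff_def algebra_simps)
  also have "\<dots> = taylor_coeff f (Suc n) * (cnj \<xi> ^ Suc n * \<xi> ^ Suc n)"
    by (simp add: partial_taylor_def)
  finally show "quotient_coeff f \<xi> L n - \<xi> * quotient_coeff f \<xi> L (Suc n) = taylor_coeff f (Suc n)"
    by (simp only: x' mult_1_right)
qed

text \<open>Here \<open>L\<close> is any number with square summable deviations; that it is the
  boundary value of \<open>f\<close> at \<open>\<xi>\<close> is a conclusion, because the quotient
  then lies in the Hardy space. This lets a limit of boundary values be recognized as a boundary
  value.\<close>

lemma local_quotient:
  assumes f: "f \<in> hardy2" and xi: "norm \<xi> = 1"
    and sm: "summable (\<lambda>n. (norm (L - partial_taylor f n \<xi>))\<^sup>2)"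
  defines "G \<equiv> power_fun (quotient_coeff f \<xi> L)"
  shows local_quotient_hardy2: "G \<in> hardy2"
    and local_quotient_coeff: "taylor_coeff G = quotient_coeff f \<xi> L"
    and local_quotient_eq: "\<And>z. norm z < 1 \<Longrightarrow> f z = L + (z - \<xi>) * G z"
    and local_quotient_nt_limit: "has_nt_limit f \<xi> L"
proof -
  let ?g = "quotient_coeff f \<xi> L"
  have sg: "summable (\<lambda>n. (norm (?g n))\<^sup>2)" using sm by (simp add: norm_quotient_coeff xi)
  show G: "G \<in> hardy2" and "taylor_coeff G = ?g"
    unfolding G_def by (rule power_fun_hardy2[OF sg])+
  show eq: "f z = L + (z - \<xi>) * G z" if z: "norm z < 1" for z
  proof -
    have 1: "(\<lambda>n. ?g n * z ^ n) sums G z" unfolding G_def by (rule power_fun_sums[OF sg z])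
    \<comment> \<open>The series of \<open>z * G z\<close>, shifted by one place so that it can be
      subtracted coefficientwise from that of \<open>\<xi> * G z\<close>.\<close>
    define F where "F n = (if n = 0 then 0 else ?g (n - 1) * z ^ n)" for n
    have "(\<lambda>n. F (Suc n)) sums (z * G z)"
      using sums_mult[OF 1, of z] by (simp add: F_def mult_ac)
    then have "F sums (z * G z)" by (subst (asm) sums_Suc_iff) (simp add: F_def)
    from sums_diff[OF this sums_mult[OF 1, of \<xi>]]
    have "(\<lambda>n. F n - \<xi> * (?g n * z ^ n)) sums (z * G z - \<xi> * G z)" .
    moreover have "F n - \<xi> * (?g n * z ^ n) = taylor_coeff f n * z ^ n - (if n = 0 then L else 0)" for n
    proof (cases n)
      case 0
      then show ?thesis using quotient_coeff_recurrence(1)[OF xi, of f L] by (simp add: F_def)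
    next
      case (Suc m)
      have "F n - \<xi> * (?g n * z ^ n) = (?g m - \<xi> * ?g (Suc m)) * z ^ n"
        by (simp add: F_def Suc algebra_simps)
      then show ?thesis unfolding quotient_coeff_recurrence(2)[OF xi] by (simp add: Suc)
    qed
    moreover have "(\<lambda>n. taylor_coeff f n * z ^ n - (if n = 0 then L else 0)) sums (f z - L)"
      using sums_single[of 0 "\<lambda>_. L"] by (intro sums_diff hardy2_sums[OF f z]) simp
    ultimately have "z * G z - \<xi> * G z = f z - L" using sums_unique2 by simp
    then show ?thesis by (simp add: algebra_simps)
  qed
  show "has_nt_limit f \<xi> L"
    using has_nt_limit_mult_vanishing[OF G xi, of L] eq
    by (subst has_nt_limit_cong[where g="\<lambda>z. L + (z - \<xi>) * G z"]) auto
qed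

section \<open>The local Dirichlet integral in terms of Taylor partial sums\<close>

lemma has_nt_limit_affine:
  assumes "has_nt_limit g \<zeta> M"
  shows "has_nt_limit (\<lambda>z. L + (z - \<xi>) * g z) \<zeta> (L + (\<zeta> - \<xi>) * M)"
  using assms unfolding has_nt_limit_def by (intro allI impI tendsto_intros) auto

lemma AE_arclen_neq: "AE \<zeta> in arclen. \<zeta> \<noteq> \<xi>"
proof (cases "norm \<xi> = 1")
  case True
  then have "emeasure arclen {\<xi>} = 0"
    using emeasure_arclen_cball[of \<xi> 0] by simp
  moreover have "{\<xi>} \<in> sets arclen"
    using sets_circI[of "{\<xi>}"] True by simp
  ultimately show ?thesis by (intro AE_I[of _ _ "{\<xi>}"]) auto
next
  case False
  then show ?thesis by (intro AE_I2) auto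
qed

lemma AE_arclen_norm: "AE \<zeta> in arclen. norm \<zeta> = 1"
  by (intro AE_I2) simp

lemma borel_measurable_local_quotient:
  assumes "continuous_on (ball 0 1) f"
  shows "(\<lambda>\<zeta>. (nt_lim f \<zeta> - L) / (\<zeta> - \<xi>)) \<in> borel_measurable circ"
proof -
  have [measurable]: "nt_lim f \<in> borel_measurable circ" by (rule borel_measurable_nt_lim[OF assms])
  have [measurable]: "(\<lambda>\<zeta>. \<zeta>) \<in> borel_measurable circ" by (intro measurable_circI continuous_intros)
  show ?thesis by measurable
qed

lemma local_dirichlet_arclen:
  assumes f: "f \<in> hardy2" and xi: "norm \<xi> = 1" and L: "has_nt_limit f \<xi> L"
  shows "local_dirichlet f \<xi> = (\<integral>\<^sup>+\<zeta>. ennreal ((norm ((nt_lim f \<zeta> - L) / (\<zeta> - \<xi>)))\<^sup>2) \<partial>arclen)"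
proof -
  have [measurable]: "(\<lambda>\<zeta>. (nt_lim f \<zeta> - L) / (\<zeta> - \<xi>)) \<in> borel_measurable circ"
    by (intro borel_measurable_local_quotient hardy2_continuous f)
  have "(\<integral>\<^sup>+\<zeta>. ennreal ((norm ((nt_lim f \<zeta> - L) / (\<zeta> - \<xi>)))\<^sup>2) \<partial>arclen)
      = (\<integral>\<^sup>+t\<in>{0..2*pi}. ennreal ((norm ((nt_lim f (cis t) - L) / (cis t - \<xi>)))\<^sup>2) \<partial>lborel)"
    by (rule nn_integral_arclen) measurable
  also have "\<dots> = local_dirichlet f \<xi>"
    unfolding local_dirichlet_def using L nt_lim_eq[OF xi L] by (auto simp: norm_divide power_divide)
  finally show ?thesis ..
qed

text \<open>Almost everywhere on the circle the difference quotient of \<open>f\<close> at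
  \<open>\<xi>\<close> is the boundary function of the Hardy space quotient \<open>G\<close>, so the
  integral is given by Parseval's identity for \<open>G\<close>.\<close>

lemma local_dirichlet_summable:
  assumes f: "f \<in> hardy2" and xi: "norm \<xi> = 1"
    and sm: "summable (\<lambda>n. (norm (L - partial_taylor f n \<xi>))\<^sup>2)"
  shows "local_dirichlet f \<xi> = ennreal (2 * pi) * (\<Sum>n. ennreal ((norm (L - partial_taylor f n \<xi>))\<^sup>2))"
proof -
  define G where "G = power_fun (quotient_coeff f \<xi> L)"
  note lq = local_quotient[OF f xi sm, folded G_def]
  have "local_dirichlet f \<xi> = (\<integral>\<^sup>+\<zeta>. ennreal ((norm ((nt_lim f \<zeta> - L) / (\<zeta> - \<xi>)))\<^sup>2) \<partial>arclen)"
    by (rule local_dirichlet_arclen[OF f xi lq(4)])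
  also have "\<dots> = (\<integral>\<^sup>+\<zeta>. ennreal ((norm (nt_lim G \<zeta>))\<^sup>2) \<partial>arclen)"
  proof (rule nn_integral_cong_AE, use AE_arclen_neq[of \<xi>] AE_arclen_norm hardy2_AE_nt_limit[OF lq(1)] in eventually_elim)
    case (elim \<zeta>)
    then obtain M where M: "has_nt_limit G \<zeta> M" by blast
    have "has_nt_limit f \<zeta> (L + (\<zeta> - \<xi>) * M)"
      using has_nt_limit_affine[OF M, of L \<xi>] lq(3)
      by (subst has_nt_limit_cong[where g="\<lambda>z. L + (z - \<xi>) * G z"]) auto
    then have "nt_lim f \<zeta> = L + (\<zeta> - \<xi>) * nt_lim G \<zeta>"
      using nt_lim_eq[of \<zeta>] elim M by simp
    then show ?case using elim by simp
  qed
  also have "\<dots> = ennreal (LINT \<zeta>|arclen. (norm (nt_lim G \<zeta>))\<^sup>2)"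
    by (intro nn_integral_eq_integral hardy2_boundary_square_integrable lq(1)) auto
  also have "\<dots> = ennreal (2 * pi * (\<Sum>n. (norm (L - partial_taylor f n \<xi>))\<^sup>2))"
    by (simp add: hardy2_parseval[OF lq(1)] lq(2) norm_quotient_coeff xi)
  also have "\<dots> = ennreal (2 * pi) * (\<Sum>n. ennreal ((norm (L - partial_taylor f n \<xi>))\<^sup>2))"
    using sm by (simp add: ennreal_mult suminf_nonneg suminf_ennreal2)
  finally show ?thesis .
qed

text \<open>The converse direction. A priori the boundary quotient \<open>h\<close> is only square
  integrable. Multiplying it by \<open>\<zeta> - \<xi>\<close> gives a recurrence for its Fourier
  coefficients: the negative ones vanish, and the others then satisfy the recurrence of
  \<open>quotient_coeff\<close> with the right starting value, so that Bessel's inequality applies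
  to them.\<close>

lemma local_dirichlet_finite_summable:
  assumes f: "f \<in> hardy2" and xi: "norm \<xi> = 1" and L: "has_nt_limit f \<xi> L"
    and fin: "local_dirichlet f \<xi> \<noteq> \<infinity>"
  shows "summable (\<lambda>n. (norm (L - partial_taylor f n \<xi>))\<^sup>2)"
proof -
  define b where "b = nt_lim f"
  define h where "h \<zeta> = (b \<zeta> - L) / (\<zeta> - \<xi>)" for \<zeta>
  have hm[measurable]: "h \<in> borel_measurable circ"
    unfolding h_def b_def by (intro borel_measurable_local_quotient hardy2_continuous f)
  have h2: "integrable arclen (\<lambda>\<zeta>. (norm (h \<zeta>))\<^sup>2)"
  proof (rule integrableI_bounded)
    show "(\<lambda>\<zeta>. (norm (h \<zeta>))\<^sup>2) \<in> borel_measurable arclen" by measurable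
    show "(\<integral>\<^sup>+\<zeta>. ennreal (norm ((norm (h \<zeta>))\<^sup>2)) \<partial>arclen) < \<infinity>"
      using fin local_dirichlet_arclen[OF f xi L] by (simp add: h_def b_def less_top[symmetric])
  qed
  have bm: "b \<in> borel_measurable circ"
    unfolding b_def by (intro borel_measurable_nt_lim hardy2_continuous f)
  have b2: "integrable arclen (\<lambda>\<zeta>. (norm (b \<zeta>))\<^sup>2)"
    unfolding b_def by (rule hardy2_boundary_square_integrable[OF f])
  \<comment> \<open>The relation \<open>(\<zeta> - \<xi>) h = b - L\<close>, valid off the null set
    \<open>{\<xi>}\<close>, tested against \<open>e\<close>; powers of \<open>\<zeta>\<close> and of
    its conjugate turn it into relations between neighbouring Fourier coefficients.\<close>
  have rec: "(LINT \<zeta>|arclen. h \<zeta> * (\<zeta> * e \<zeta>)) - \<xi> * (LINT \<zeta>|arclen. h \<zeta> * e \<zeta>)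
      = (LINT \<zeta>|arclen. b \<zeta> * e \<zeta>) - L * (LINT \<zeta>|arclen. e \<zeta>)"
    if e: "continuous_on (sphere 0 1) e" for e
  proof -
    have i1: "integrable arclen (\<lambda>\<zeta>. h \<zeta> * (\<zeta> * e \<zeta>))"
      by (intro integrable_arclen_square_mult hm h2 continuous_intros e)
    have i2: "integrable arclen (\<lambda>\<zeta>. \<xi> * (h \<zeta> * e \<zeta>))"
      by (intro integrable_mult_right integrable_arclen_square_mult hm h2 continuous_intros e)
    have i3: "integrable arclen (\<lambda>\<zeta>. b \<zeta> * e \<zeta>)"
      by (intro integrable_arclen_square_mult bm b2 e)
    have i4: "integrable arclen (\<lambda>\<zeta>. L * e \<zeta>)"
      by (intro integrable_arclen_continuous continuous_intros e)
    have "(LINT \<zeta>|arclen. h \<zeta> * (\<zeta> * e \<zeta>)) - \<xi> * (LINT \<zeta>|arclen. h \<zeta> * e \<zeta>)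
        = (LINT \<zeta>|arclen. h \<zeta> * (\<zeta> * e \<zeta>) - \<xi> * (h \<zeta> * e \<zeta>))"
      by (simp add: Bochner_Integration.integral_diff[OF i1 i2])
    also have "\<dots> = (LINT \<zeta>|arclen. b \<zeta> * e \<zeta> - L * e \<zeta>)"
    proof (rule integral_cong_AE)
      show "(\<lambda>\<zeta>. h \<zeta> * (\<zeta> * e \<zeta>) - \<xi> * (h \<zeta> * e \<zeta>)) \<in> borel_measurable arclen"
        using i1 i2 by (intro borel_measurable_diff) auto
      show "(\<lambda>\<zeta>. b \<zeta> * e \<zeta> - L * e \<zeta>) \<in> borel_measurable arclen"
        using i3 i4 by (intro borel_measurable_diff) auto
      show "AE \<zeta> in arclen. h \<zeta> * (\<zeta> * e \<zeta>) - \<xi> * (h \<zeta> * e \<zeta>) = b \<zeta> * e \<zeta> - L * e \<zeta>"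
        using AE_arclen_neq[of \<xi>]
      proof eventually_elim
        case (elim \<zeta>)
        have "h \<zeta> * (\<zeta> * e \<zeta>) - \<xi> * (h \<zeta> * e \<zeta>) = (\<zeta> - \<xi>) * h \<zeta> * e \<zeta>" by (simp add: algebra_simps)
        also have "(\<zeta> - \<xi>) * h \<zeta> = b \<zeta> - L" using elim by (simp add: h_def)
        finally show ?case by (simp add: algebra_simps)
      qed
    qed
    also have "\<dots> = (LINT \<zeta>|arclen. b \<zeta> * e \<zeta>) - L * (LINT \<zeta>|arclen. e \<zeta>)"
      by (simp add: Bochner_Integration.integral_diff[OF i3 i4])
    finally show ?thesis .
  qed
  define C where "C = 2 * pi * (LINT \<zeta>|arclen. (norm (h \<zeta>))\<^sup>2)"
  \<comment> \<open>Up to \<open>2 * pi\<close>, \<open>H n\<close> is the Fourier coefficient of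
    index \<open>- (n + 1)\<close>.\<close>
  define H where "H n = (LINT \<zeta>|arclen. h \<zeta> * \<zeta> ^ Suc n)" for n
  have Hrec: "H (Suc n) = \<xi> * H n" for n
  proof -
    have "(LINT \<zeta>|arclen. \<zeta> ^ Suc n) = 0"
      using integral_arclen_orthogonal[of "Suc n" 0] by simp
    moreover have "(LINT \<zeta>|arclen. b \<zeta> * \<zeta> ^ Suc n) = 0"
      unfolding b_def by (rule hardy2_fourier_neg[OF f])
    ultimately show ?thesis
      using rec[of "\<lambda>\<zeta>. \<zeta> ^ Suc n"] by (simp add: H_def continuous_intros)
  qed
  \<comment> \<open>the negative Fourier coefficients of \<open>h\<close> have constant modulus and are square summable\<close>
  have Hn: "norm (H n) = norm (H 0)" for n
    by (induction n) (simp_all add: Hrec norm_mult xi)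
  have "real m * (norm (H 0))\<^sup>2 \<le> C" for m
  proof -
    have "(\<Sum>n\<in>{Suc 0..m}. (norm (LINT \<zeta>|arclen. h \<zeta> * cnj (cnj \<zeta> ^ n)))\<^sup>2) \<le> C"
      unfolding C_def
      by (rule bessel_arclen[where e="\<lambda>n \<zeta>. cnj \<zeta> ^ n"])
        (intro continuous_intros integral_arclen_orthogonal_cnj hm h2 finite_atLeastAtMost)+
    moreover have "(norm (LINT \<zeta>|arclen. h \<zeta> * cnj (cnj \<zeta> ^ n)))\<^sup>2 = (norm (H 0))\<^sup>2" if "n \<in> {Suc 0..m}" for n
      using that Hn[of "n - 1"] by (simp add: H_def)
    ultimately show ?thesis by simp
  qed
  \<comment> \<open>A nonnegative number all of whose natural multiples stay below \<open>C\<close>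
    is 0.\<close>
  then have "(norm (H 0))\<^sup>2 = 0"
    by (intro real_archimedian_rdiv_eq_0[of _ C]) (auto simp: C_def)
  then have H0: "(LINT \<zeta>|arclen. h \<zeta> * \<zeta>) = 0" by (simp add: H_def)
  define c where "c n = (LINT \<zeta>|arclen. h \<zeta> * cnj \<zeta> ^ n)" for n
  have fb: "(LINT \<zeta>|arclen. b \<zeta> * cnj \<zeta> ^ n) = 2 * of_real pi * taylor_coeff f n" for n
    unfolding b_def by (rule hardy2_fourier_nonneg[OF f])
  have int1: "(LINT \<zeta>|arclen. cnj \<zeta> ^ n) = (if n = 0 then 2 * of_real pi else 0)" for n
    using integral_arclen_orthogonal[of 0 n] by (cases "n = 0") simp_all
  \<comment> \<open>The vanishing coefficient of index -1 drops out of the relation at index 0,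
    which thereby fixes the starting value of the recurrence.\<close>
  have c0: "- \<xi> * c 0 = 2 * of_real pi * (taylor_coeff f 0 - L)"
    using rec[of "\<lambda>\<zeta>. cnj \<zeta> ^ 0"] fb[of 0] H0
    by (simp add: c_def measure_def emeasure_arclen_space scaleR_conv_of_real algebra_simps)
  have cS: "c n - \<xi> * c (Suc n) = 2 * of_real pi * taylor_coeff f (Suc n)" for n
  proof -
    have "(LINT \<zeta>|arclen. h \<zeta> * (\<zeta> * cnj \<zeta> ^ Suc n)) = c n"
      unfolding c_def
    proof (rule Bochner_Integration.integral_cong[OF refl])
      fix \<zeta> assume "\<zeta> \<in> space arclen"
      then have "\<zeta> * cnj \<zeta> = 1" by (intro unimodular_mult_cnj) simp
      then show "h \<zeta> * (\<zeta> * cnj \<zeta> ^ Suc n) = h \<zeta> * cnj \<zeta> ^ n"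
        by (simp add: mult.assoc[symmetric])
    qed
    then show ?thesis
      using rec[of "\<lambda>\<zeta>. cnj \<zeta> ^ Suc n"] fb[of "Suc n"] int1[of "Suc n"]
      by (simp add: c_def continuous_intros)
  qed
  have xi0: "\<xi> \<noteq> 0" using xi by auto
  have cq: "c n = 2 * of_real pi * quotient_coeff f \<xi> L n" for n
  proof (induction n)
    case 0
    have "- \<xi> * c 0 = - \<xi> * (2 * of_real pi * quotient_coeff f \<xi> L 0)"
      unfolding c0 quotient_coeff_recurrence(1)[OF xi, symmetric] by simp
    then show ?case using xi0 by simp
  next
    case (Suc n)
    have "\<xi> * c (Suc n) = c n - 2 * of_real pi * taylor_coeff f (Suc n)"
      using cS[of n] by (simp add: algebra_simps)
    also have "\<dots> = \<xi> * (2 * of_real pi * quotient_coeff f \<xi> L (Suc n))"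
      unfolding Suc.IH quotient_coeff_recurrence(2)[OF xi, of f L, symmetric] by (simp add: algebra_simps)
    finally show ?case using xi0 by simp
  qed
  show ?thesis
  proof (rule summableI_nonneg_bounded)
    fix N
    have "(\<Sum>n<N. (norm (LINT \<zeta>|arclen. h \<zeta> * cnj (\<zeta> ^ n)))\<^sup>2) \<le> C"
      unfolding C_def
      by (rule bessel_arclen[where e="\<lambda>n \<zeta>. \<zeta> ^ n"])
        (auto intro!: continuous_intros hm h2 simp: integral_arclen_orthogonal)
    moreover have "(norm (LINT \<zeta>|arclen. h \<zeta> * cnj (\<zeta> ^ n)))\<^sup>2 = (2 * pi)\<^sup>2 * (norm (L - partial_taylor f n \<xi>))\<^sup>2" for n
      using cq[of n] by (simp add: c_def norm_mult norm_quotient_coeff xi power_mult_distrib)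
    ultimately have "(2 * pi)\<^sup>2 * (\<Sum>n<N. (norm (L - partial_taylor f n \<xi>))\<^sup>2) \<le> C"
      by (simp only: sum_distrib_left)
    then show "(\<Sum>n<N. (norm (L - partial_taylor f n \<xi>))\<^sup>2) \<le> C / (2 * pi)\<^sup>2"
      by (simp add: field_simps)
  qed simp
qed

lemma local_dirichlet_finite_imp_nt_limit:
  "local_dirichlet f \<xi> \<noteq> \<infinity> \<Longrightarrow> \<exists>L. has_nt_limit f \<xi> L"
  unfolding local_dirichlet_def by meson

section \<open>The Dirichlet type space as an inner product space\<close>

lemma hardy2_add_scale:
  assumes f: "f \<in> hardy2" and g: "g \<in> hardy2"
  shows "(\<lambda>z. f z + c * g z) \<in> hardy2"
    and "taylor_coeff (\<lambda>z. f z + c * g z) = (\<lambda>n. taylor_coeff f n + c * taylor_coeff g n)"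
proof -
  have s: "(\<lambda>n. (taylor_coeff f n + c * taylor_coeff g n) * z ^ n) sums (f z + c * g z)" if "norm z < 1" for z
    using sums_add[OF hardy2_sums[OF f that] sums_mult[OF hardy2_sums[OF g that], of c]]
    by (simp add: algebra_simps)
  have sm: "summable (\<lambda>n. (norm (taylor_coeff f n + c * taylor_coeff g n))\<^sup>2)"
  proof (rule summable_comparison_test')
    show "summable (\<lambda>n. 2 * (norm (taylor_coeff f n))\<^sup>2 + 2 * (norm c)\<^sup>2 * (norm (taylor_coeff g n))\<^sup>2)"
      by (intro summable_add summable_mult hardy2_summable f g)
    show "norm ((norm (taylor_coeff f n + c * taylor_coeff g n))\<^sup>2)
        \<le> 2 * (norm (taylor_coeff f n))\<^sup>2 + 2 * (norm c)\<^sup>2 * (norm (taylor_coeff g n))\<^sup>2" for n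
      using norm_add_mult_square_le[of "taylor_coeff f n" c "taylor_coeff g n"] by simp
  qed
  show "(\<lambda>z. f z + c * g z) \<in> hardy2" "taylor_coeff (\<lambda>z. f z + c * g z) = (\<lambda>n. taylor_coeff f n + c * taylor_coeff g n)"
    using hardy2I[OF s sm] by auto
qed

lemma has_nt_limit_add_scale:
  assumes "has_nt_limit f \<xi> L" "has_nt_limit g \<xi> M"
  shows "has_nt_limit (\<lambda>z. f z + c * g z) \<xi> (L + c * M)"
  using assms unfolding has_nt_limit_def by (intro allI impI tendsto_intros) auto

text \<open>The first component is the variable of \<open>\<mu>\<close>, the second that of arc
  length. Dividing by the modulus instead of by \<open>\<zeta> - \<xi>\<close> changes the quotient
  only by a unimodular factor common to all functions, which cancels in products with a
  conjugate.\<close>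

definition diff_quot :: "(complex \<Rightarrow> complex) \<Rightarrow> complex \<times> complex \<Rightarrow> complex" where
  "diff_quot f p = (nt_lim f (snd p) - nt_lim f (fst p)) / of_real (norm (snd p - fst p))"

lemma borel_measurable_diff_quot:
  assumes "f \<in> hardy2"
  shows "diff_quot f \<in> borel_measurable (circ \<Otimes>\<^sub>M circ)"
proof -
  have [measurable]: "nt_lim f \<in> borel_measurable circ"
    by (intro borel_measurable_nt_lim hardy2_continuous assms)
  have [measurable]: "(\<lambda>\<zeta>. \<zeta>) \<in> borel_measurable circ" by (intro measurable_circI continuous_intros)
  have [measurable]: "fst \<in> borel_measurable (circ \<Otimes>\<^sub>M circ)" "snd \<in> borel_measurable (circ \<Otimes>\<^sub>M circ)"
    using measurable_compose[OF measurable_fst, of "\<lambda>\<zeta>. \<zeta>" circ borel circ]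
      measurable_compose[OF measurable_snd, of "\<lambda>\<zeta>. \<zeta>" circ borel circ] by simp_all
  show ?thesis unfolding diff_quot_def by measurable
qed

lemma local_dirichlet_diff_quot:
  assumes "f \<in> hardy2" "norm \<xi> = 1" "\<exists>L. has_nt_limit f \<xi> L"
  shows "local_dirichlet f \<xi> = (\<integral>\<^sup>+\<zeta>. ennreal ((norm (diff_quot f (\<xi>, \<zeta>)))\<^sup>2) \<partial>arclen)"
proof -
  obtain L where L: "has_nt_limit f \<xi> L" using assms(3) by blast
  show ?thesis
    using local_dirichlet_arclen[OF assms(1,2) L] nt_lim_eq[OF assms(2) L]
    by (simp add: diff_quot_def norm_divide)
qed

text \<open>Meaningful on the space only: \<open>enn2real\<close> sends an infinite Dirichlet
  integral to 0.\<close>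

definition dirichlet_normsq :: "complex measure \<Rightarrow> (complex \<Rightarrow> complex) \<Rightarrow> real" where
  "dirichlet_normsq \<mu> f = (\<Sum>n. (norm (taylor_coeff f n))\<^sup>2) + enn2real (dirichlet_integral \<mu> f)"

section \<open>The Dirichlet integral as a square norm over the product of the measure with arc
  length\<close>

context
  fixes \<mu> :: "complex measure"
  assumes mu: "circle_measure \<mu>"
begin

lemma sets_mu [measurable_cong]: "sets \<mu> = sets circ"
  using mu by (simp add: circle_measure_def)

lemma space_mu: "space \<mu> = sphere 0 1"
  using sets_eq_imp_space_eq[OF sets_mu] by simp

lemma pair_mu: "pair_sigma_finite \<mu> arclen"
proof -
  interpret m: finite_measure \<mu> using mu by (simp add: circle_measure_def)
  interpret a: finite_measure arclen by (rule finite_measure_arclen)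
  show ?thesis by unfold_locales
qed

lemma sets_pair_mu: "sets (\<mu> \<Otimes>\<^sub>M arclen) = sets (circ \<Otimes>\<^sub>M circ)"
  by (intro sets_pair_measure_cong sets_mu sets_arclen)

lemma measurable_pair_mu: "borel_measurable (\<mu> \<Otimes>\<^sub>M arclen) = borel_measurable (circ \<Otimes>\<^sub>M circ)"
  by (rule measurable_cong_sets[OF sets_pair_mu refl])

lemma borel_measurable_local_dirichlet:
  assumes f: "f \<in> hardy2"
  shows "local_dirichlet f \<in> borel_measurable \<mu>"
proof -
  interpret pair_sigma_finite \<mu> arclen by (rule pair_mu)
  let ?E = "{\<xi> \<in> sphere 0 1. \<exists>L. has_nt_limit f \<xi> L}"
  have E: "?E \<inter> space \<mu> \<in> sets \<mu>"
  proof -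
    have "?E \<inter> space \<mu> = ?E" by (auto simp: space_mu)
    then show ?thesis using sets_nt_limit_exists[of f] by (simp only: sets_mu)
  qed
  have [measurable]: "diff_quot f \<in> borel_measurable (\<mu> \<Otimes>\<^sub>M arclen)"
    using borel_measurable_diff_quot[OF f] by (simp add: measurable_pair_mu)
  have "(\<lambda>\<xi>. if \<xi> \<in> ?E then (\<integral>\<^sup>+\<zeta>. ennreal ((norm (diff_quot f (\<xi>, \<zeta>)))\<^sup>2) \<partial>arclen) else \<infinity>) \<in> borel_measurable \<mu>"
    by (rule measurable_If_set[OF _ _ E]) measurable
  also have "?this \<longleftrightarrow> ?thesis"
  proof (rule measurable_cong)
    fix \<xi> assume "\<xi> \<in> space \<mu>"
    then have xi: "norm \<xi> = 1" by (simp add: space_mu)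
    have "local_dirichlet f \<xi> = \<infinity>" if "\<not> (\<exists>L. has_nt_limit f \<xi> L)"
      using that local_dirichlet_finite_imp_nt_limit[of f \<xi>] by blast
    then show "(if \<xi> \<in> ?E then (\<integral>\<^sup>+\<zeta>. ennreal ((norm (diff_quot f (\<xi>, \<zeta>)))\<^sup>2) \<partial>arclen) else \<infinity>) = local_dirichlet f \<xi>"
      using local_dirichlet_diff_quot[OF f xi] xi by simp
  qed
  finally show ?thesis .
qed

lemma dirichlet_integral_diff_quot:
  assumes f: "f \<in> hardy2" and AE: "AE \<xi> in \<mu>. \<exists>L. has_nt_limit f \<xi> L"
  shows "dirichlet_integral \<mu> f = ennreal (1 / (2*pi)) * (\<integral>\<^sup>+p. ennreal ((norm (diff_quot f p))\<^sup>2) \<partial>(\<mu> \<Otimes>\<^sub>M arclen))"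
proof -
  interpret pair_sigma_finite \<mu> arclen by (rule pair_mu)
  have [measurable]: "diff_quot f \<in> borel_measurable (\<mu> \<Otimes>\<^sub>M arclen)"
    using borel_measurable_diff_quot[OF f] by (simp add: measurable_pair_mu)
  have "(\<integral>\<^sup>+\<xi>. local_dirichlet f \<xi> \<partial>\<mu>) = (\<integral>\<^sup>+\<xi>. \<integral>\<^sup>+\<zeta>. ennreal ((norm (diff_quot f (\<xi>, \<zeta>)))\<^sup>2) \<partial>arclen \<partial>\<mu>)"
  proof (rule nn_integral_cong_AE)
    have "AE \<xi> in \<mu>. norm \<xi> = 1" by (intro AE_I2) (simp add: space_mu)
    with AE show "AE \<xi> in \<mu>. local_dirichlet f \<xi> = (\<integral>\<^sup>+\<zeta>. ennreal ((norm (diff_quot f (\<xi>, \<zeta>)))\<^sup>2) \<partial>arclen)"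
      by eventually_elim (rule local_dirichlet_diff_quot[OF f])
  qed
  also have "\<dots> = (\<integral>\<^sup>+p. ennreal ((norm (diff_quot f p))\<^sup>2) \<partial>(\<mu> \<Otimes>\<^sub>M arclen))"
    by (rule M2.nn_integral_fst) measurable
  finally show ?thesis by (simp add: dirichlet_integral_def)
qed

text \<open>The condition on limits stands beside integrability because \<open>nt_lim\<close> takes
  an arbitrary value where no limit exists, whereas \<open>local_dirichlet\<close> is infinite
  there.\<close>

lemma dirichlet_space_iff:
  "f \<in> dirichlet_space \<mu> \<longleftrightarrow> f \<in> hardy2 \<and> (AE \<xi> in \<mu>. \<exists>L. has_nt_limit f \<xi> L) \<and>
    integrable (\<mu> \<Otimes>\<^sub>M arclen) (\<lambda>p. (norm (diff_quot f p))\<^sup>2)"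
proof (cases "f \<in> hardy2")
  case f: True
  have m[measurable]: "diff_quot f \<in> borel_measurable (\<mu> \<Otimes>\<^sub>M arclen)"
    using borel_measurable_diff_quot[OF f] by (simp add: measurable_pair_mu)
  have iff: "integrable (\<mu> \<Otimes>\<^sub>M arclen) (\<lambda>p. (norm (diff_quot f p))\<^sup>2) \<longleftrightarrow> dirichlet_integral \<mu> f < \<infinity>"
    if "AE \<xi> in \<mu>. \<exists>L. has_nt_limit f \<xi> L"
    unfolding dirichlet_integral_diff_quot[OF f that] integrable_iff_bounded
    by (auto simp: ennreal_mult_less_top ennreal_zero_less_divide)
  have "AE \<xi> in \<mu>. \<exists>L. has_nt_limit f \<xi> L" if "dirichlet_integral \<mu> f < \<infinity>"
  proof -
    have "(\<integral>\<^sup>+\<xi>. local_dirichlet f \<xi> \<partial>\<mu>) \<noteq> \<infinity>"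
      using that by (auto simp: dirichlet_integral_def ennreal_mult_less_top ennreal_zero_less_divide)
    from nn_integral_noteq_infinite[OF borel_measurable_local_dirichlet[OF f] this]
    show ?thesis by eventually_elim (rule local_dirichlet_finite_imp_nt_limit)
  qed
  then show ?thesis using f iff by (auto simp: dirichlet_space_def)
qed (simp add: dirichlet_space_def)

lemma dirichlet_space_hardy2: "f \<in> dirichlet_space \<mu> \<Longrightarrow> f \<in> hardy2"
  by (simp add: dirichlet_space_def)

lemma borel_measurable_diff_quot_mu:
  "f \<in> dirichlet_space \<mu> \<Longrightarrow> diff_quot f \<in> borel_measurable (\<mu> \<Otimes>\<^sub>M arclen)"
  unfolding measurable_pair_mu by (intro borel_measurable_diff_quot dirichlet_space_hardy2)

lemma dirichlet_integral_real:
  assumes "f \<in> dirichlet_space \<mu>"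
  shows "enn2real (dirichlet_integral \<mu> f) = 1 / (2*pi) * (LINT p|(\<mu> \<Otimes>\<^sub>M arclen). (norm (diff_quot f p))\<^sup>2)"
proof -
  have i: "integrable (\<mu> \<Otimes>\<^sub>M arclen) (\<lambda>p. (norm (diff_quot f p))\<^sup>2)"
    and "f \<in> hardy2" "AE \<xi> in \<mu>. \<exists>L. has_nt_limit f \<xi> L"
    using assms by (auto simp: dirichlet_space_iff)
  then show ?thesis
    by (simp add: dirichlet_integral_diff_quot nn_integral_eq_integral enn2real_mult)
qed

text \<open>Two different reasons: in the variable of \<open>\<mu>\<close> limits exist because the
  Dirichlet integral is finite, in the variable of arc length by Fatou's theorem.\<close>

lemma AE_pair_nt_limit:
  assumes "f \<in> dirichlet_space \<mu>"
  shows "AE p in \<mu> \<Otimes>\<^sub>M arclen. norm (fst p) = 1 \<and> norm (snd p) = 1 \<and>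
    (\<exists>L. has_nt_limit f (fst p) L) \<and> (\<exists>L. has_nt_limit f (snd p) L)"
proof -
  interpret pair_sigma_finite \<mu> arclen by (rule pair_mu)
  let ?E = "{\<xi> \<in> sphere 0 1. \<exists>L. has_nt_limit f \<xi> L}"
  have E: "?E \<in> sets circ" by (rule sets_nt_limit_exists)
  have "AE p in \<mu> \<Otimes>\<^sub>M arclen. p \<in> ?E \<times> ?E"
  proof (rule AE_pair_measure)
    have "{p \<in> space (\<mu> \<Otimes>\<^sub>M arclen). p \<in> ?E \<times> ?E} = ?E \<times> ?E"
      by (auto simp: space_pair_measure space_mu)
    also have "\<dots> \<in> sets (\<mu> \<Otimes>\<^sub>M arclen)" using E by (intro pair_measureI) (simp_all add: sets_mu)
    finally show "{p \<in> space (\<mu> \<Otimes>\<^sub>M arclen). p \<in> ?E \<times> ?E} \<in> sets (\<mu> \<Otimes>\<^sub>M arclen)" .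
    have 1: "AE \<xi> in \<mu>. norm \<xi> = 1" by (intro AE_I2) (simp add: space_mu)
    have 2: "AE \<xi> in \<mu>. \<exists>L. has_nt_limit f \<xi> L" using assms by (simp add: dirichlet_space_iff)
    have 3: "AE \<zeta> in arclen. \<zeta> \<in> ?E"
      using AE_arclen_norm hardy2_AE_nt_limit[OF dirichlet_space_hardy2[OF assms]]
      by eventually_elim auto
    from 1 2 show "AE \<xi> in \<mu>. AE \<zeta> in arclen. (\<xi>, \<zeta>) \<in> ?E \<times> ?E"
    proof eventually_elim
      case (elim \<xi>)
      from 3 show ?case by eventually_elim (use elim in auto)
    qed
  qed
  then show ?thesis by eventually_elim auto
qed

lemma AE_diff_quot_add_scale:
  assumes "f \<in> dirichlet_space \<mu>" "g \<in> dirichlet_space \<mu>"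
  shows "AE p in \<mu> \<Otimes>\<^sub>M arclen. diff_quot (\<lambda>z. f z + c * g z) p = diff_quot f p + c * diff_quot g p"
  using AE_pair_nt_limit[OF assms(1)] AE_pair_nt_limit[OF assms(2)]
proof eventually_elim
  case (elim p)
  have "nt_lim (\<lambda>z. f z + c * g z) w = nt_lim f w + c * nt_lim g w" if "w \<in> {fst p, snd p}" for w
  proof -
    have "norm w = 1" "\<exists>L. has_nt_limit f w L" "\<exists>L. has_nt_limit g w L" using elim that by auto
    then show ?thesis
      using nt_lim_eq has_nt_limit_add_scale by metis
  qed
  then show ?case by (simp add: diff_quot_def add_divide_distrib diff_divide_distrib algebra_simps)
qed

lemma dirichlet_space_add_scale:
  assumes f: "f \<in> dirichlet_space \<mu>" and g: "g \<in> dirichlet_space \<mu>"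
  shows "(\<lambda>z. f z + c * g z) \<in> dirichlet_space \<mu>"
proof -
  let ?h = "\<lambda>z. f z + c * g z"
  have h: "?h \<in> hardy2" by (intro hardy2_add_scale dirichlet_space_hardy2 f g)
  have "AE \<xi> in \<mu>. \<exists>L. has_nt_limit f \<xi> L" "AE \<xi> in \<mu>. \<exists>L. has_nt_limit g \<xi> L"
    using f g by (auto simp: dirichlet_space_iff)
  then have "AE \<xi> in \<mu>. \<exists>L. has_nt_limit ?h \<xi> L"
    by eventually_elim (blast intro: has_nt_limit_add_scale)
  moreover have "integrable (\<mu> \<Otimes>\<^sub>M arclen) (\<lambda>p. (norm (diff_quot ?h p))\<^sup>2)"
  proof (rule Bochner_Integration.integrable_bound)
    show "integrable (\<mu> \<Otimes>\<^sub>M arclen) (\<lambda>p. 2 * (norm (diff_quot f p))\<^sup>2 + 2 * (norm c)\<^sup>2 * (norm (diff_quot g p))\<^sup>2)"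
      using f g by (intro Bochner_Integration.integrable_add integrable_mult_right) (auto simp: dirichlet_space_iff)
    show "(\<lambda>p. (norm (diff_quot ?h p))\<^sup>2) \<in> borel_measurable (\<mu> \<Otimes>\<^sub>M arclen)"
      using borel_measurable_diff_quot[OF h] unfolding measurable_pair_mu by simp
    show "AE p in \<mu> \<Otimes>\<^sub>M arclen. norm ((norm (diff_quot ?h p))\<^sup>2)
        \<le> norm (2 * (norm (diff_quot f p))\<^sup>2 + 2 * (norm c)\<^sup>2 * (norm (diff_quot g p))\<^sup>2)"
      using AE_diff_quot_add_scale[OF f g, of c]
    proof eventually_elim
      case (elim p)
      show ?case using norm_add_mult_square_le[of "diff_quot f p" c "diff_quot g p"] by (simp add: elim)
    qed
  qed
  ultimately show ?thesis using h by (simp add: dirichlet_space_iff)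
qed

lemma integrable_diff_quot_mult:
  assumes f: "f \<in> dirichlet_space \<mu>" and g: "g \<in> dirichlet_space \<mu>"
  shows "integrable (\<mu> \<Otimes>\<^sub>M arclen) (\<lambda>p. diff_quot f p * cnj (diff_quot g p))"
proof (rule Bochner_Integration.integrable_bound)
  have [measurable]: "diff_quot f \<in> borel_measurable (\<mu> \<Otimes>\<^sub>M arclen)" "diff_quot g \<in> borel_measurable (\<mu> \<Otimes>\<^sub>M arclen)"
    using f g by (auto intro: borel_measurable_diff_quot_mu)
  show "integrable (\<mu> \<Otimes>\<^sub>M arclen) (\<lambda>p. (norm (diff_quot f p))\<^sup>2 + (norm (diff_quot g p))\<^sup>2)"
    using f g by (intro Bochner_Integration.integrable_add) (auto simp: dirichlet_space_iff)
  show "(\<lambda>p. diff_quot f p * cnj (diff_quot g p)) \<in> borel_measurable (\<mu> \<Otimes>\<^sub>M arclen)" by measurable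
  show "AE p in \<mu> \<Otimes>\<^sub>M arclen. norm (diff_quot f p * cnj (diff_quot g p))
      \<le> norm ((norm (diff_quot f p))\<^sup>2 + (norm (diff_quot g p))\<^sup>2)"
    by (intro AE_I2) (simp add: norm_mult mult_le_sum_squares)
qed

lemma summable_taylor_coeff_mult:
  assumes "f \<in> hardy2" "g \<in> hardy2"
  shows "summable (\<lambda>n. taylor_coeff f n * cnj (taylor_coeff g n))"
proof (rule summable_norm_cancel, rule summable_comparison_test')
  show "summable (\<lambda>n. (norm (taylor_coeff f n))\<^sup>2 + (norm (taylor_coeff g n))\<^sup>2)"
    by (intro summable_add hardy2_summable assms)
  show "norm (norm (taylor_coeff f n * cnj (taylor_coeff g n)))
      \<le> (norm (taylor_coeff f n))\<^sup>2 + (norm (taylor_coeff g n))\<^sup>2" for n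
    by (simp add: norm_mult mult_le_sum_squares)
qed

lemma dirichlet_inner_diff_quot:
  assumes f: "f \<in> dirichlet_space \<mu>" and g: "g \<in> dirichlet_space \<mu>"
  shows "dirichlet_inner \<mu> f g = (\<Sum>n. taylor_coeff f n * cnj (taylor_coeff g n)) +
    of_real (1 / (2*pi)) * (LINT p|(\<mu> \<Otimes>\<^sub>M arclen). diff_quot f p * cnj (diff_quot g p))"
proof -
  interpret pair_sigma_finite \<mu> arclen by (rule pair_mu)
  have [measurable]: "nt_lim f \<in> borel_measurable circ" "nt_lim g \<in> borel_measurable circ"
    using f g by (auto intro!: borel_measurable_nt_lim hardy2_continuous dirichlet_space_hardy2)
  have [measurable]: "(\<lambda>\<zeta>. \<zeta>) \<in> borel_measurable circ" by (intro measurable_circI continuous_intros)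
  have "(LINT t:{0..2 * pi}|lborel.
          (nt_lim f (cis t) - nt_lim f \<xi>) * cnj (nt_lim g (cis t) - nt_lim g \<xi>)
            / complex_of_real ((norm (cis t - \<xi>))\<^sup>2)) =
      (LINT \<zeta>|arclen. diff_quot f (\<xi>, \<zeta>) * cnj (diff_quot g (\<xi>, \<zeta>)))" for \<xi>
  proof -
    have "(LINT t:{0..2 * pi}|lborel.
          (nt_lim f (cis t) - nt_lim f \<xi>) * cnj (nt_lim g (cis t) - nt_lim g \<xi>)
            / complex_of_real ((norm (cis t - \<xi>))\<^sup>2)) =
        (LINT \<zeta>|arclen. (nt_lim f \<zeta> - nt_lim f \<xi>) * cnj (nt_lim g \<zeta> - nt_lim g \<xi>)
            / complex_of_real ((norm (\<zeta> - \<xi>))\<^sup>2))"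
      by (rule integral_arclen[symmetric]) measurable
    also have "\<dots> = (LINT \<zeta>|arclen. diff_quot f (\<xi>, \<zeta>) * cnj (diff_quot g (\<xi>, \<zeta>)))"
      by (intro Bochner_Integration.integral_cong refl) (simp add: diff_quot_def power2_eq_square)
    finally show ?thesis .
  qed
  then show ?thesis
    unfolding dirichlet_inner_def
    using integral_fst'[OF integrable_diff_quot_mult[OF f g]] by simp
qed

lemma dirichlet_inner_add_scale:
  assumes f: "f \<in> dirichlet_space \<mu>" and g: "g \<in> dirichlet_space \<mu>" and h: "h \<in> dirichlet_space \<mu>"
  shows "dirichlet_inner \<mu> (\<lambda>z. f z + c * g z) h = dirichlet_inner \<mu> f h + c * dirichlet_inner \<mu> g h"
proof -
  let ?k = "\<lambda>z. f z + c * g z"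
  note H = dirichlet_space_hardy2[OF f] dirichlet_space_hardy2[OF g] dirichlet_space_hardy2[OF h]
  have k: "?k \<in> dirichlet_space \<mu>" by (rule dirichlet_space_add_scale[OF f g])
  note I = integrable_diff_quot_mult
  have s: "(\<Sum>n. taylor_coeff ?k n * cnj (taylor_coeff h n)) =
      (\<Sum>n. taylor_coeff f n * cnj (taylor_coeff h n)) + c * (\<Sum>n. taylor_coeff g n * cnj (taylor_coeff h n))"
    using summable_taylor_coeff_mult[OF H(1,3)] summable_taylor_coeff_mult[OF H(2,3)]
    by (simp add: hardy2_add_scale[OF H(1,2)] distrib_right mult.assoc suminf_mult flip: suminf_add)
  have "(LINT p|(\<mu> \<Otimes>\<^sub>M arclen). diff_quot ?k p * cnj (diff_quot h p)) =
      (LINT p|(\<mu> \<Otimes>\<^sub>M arclen). diff_quot f p * cnj (diff_quot h p) + c * (diff_quot g p * cnj (diff_quot h p)))"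
  proof (rule integral_cong_AE)
    show "(\<lambda>p. diff_quot ?k p * cnj (diff_quot h p)) \<in> borel_measurable (\<mu> \<Otimes>\<^sub>M arclen)"
      using I[OF k h] by (rule borel_measurable_integrable)
    show "(\<lambda>p. diff_quot f p * cnj (diff_quot h p) + c * (diff_quot g p * cnj (diff_quot h p))) \<in> borel_measurable (\<mu> \<Otimes>\<^sub>M arclen)"
      using I[OF f h] I[OF g h]
      by (intro borel_measurable_integrable Bochner_Integration.integrable_add integrable_mult_right)
    show "AE p in \<mu> \<Otimes>\<^sub>M arclen. diff_quot ?k p * cnj (diff_quot h p) =
        diff_quot f p * cnj (diff_quot h p) + c * (diff_quot g p * cnj (diff_quot h p))"
      using AE_diff_quot_add_scale[OF f g, of c] by eventually_elim (simp add: algebra_simps)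
  qed
  also have "\<dots> = (LINT p|(\<mu> \<Otimes>\<^sub>M arclen). diff_quot f p * cnj (diff_quot h p))
      + c * (LINT p|(\<mu> \<Otimes>\<^sub>M arclen). diff_quot g p * cnj (diff_quot h p))"
    using I[OF f h] I[OF g h] by simp
  finally show ?thesis
    unfolding dirichlet_inner_diff_quot[OF k h] dirichlet_inner_diff_quot[OF f h] dirichlet_inner_diff_quot[OF g h] s
    by (simp add: algebra_simps)
qed

lemma dirichlet_inner_commute:
  assumes f: "f \<in> dirichlet_space \<mu>" and g: "g \<in> dirichlet_space \<mu>"
  shows "dirichlet_inner \<mu> g f = cnj (dirichlet_inner \<mu> f g)"
proof -
  have "cnj (\<Sum>n. taylor_coeff f n * cnj (taylor_coeff g n)) = (\<Sum>n. cnj (taylor_coeff f n * cnj (taylor_coeff g n)))"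
    using sums_cnj[THEN iffD2, OF summable_sums[OF summable_taylor_coeff_mult[OF f[THEN dirichlet_space_hardy2] g[THEN dirichlet_space_hardy2]]]]
    by (simp add: sums_iff)
  moreover have "cnj (LINT p|(\<mu> \<Otimes>\<^sub>M arclen). diff_quot f p * cnj (diff_quot g p)) =
      (LINT p|(\<mu> \<Otimes>\<^sub>M arclen). cnj (diff_quot f p * cnj (diff_quot g p)))"
    by (rule integral_bounded_linear[OF bounded_linear_cnj integrable_diff_quot_mult[OF f g], symmetric])
  ultimately show ?thesis
    unfolding dirichlet_inner_diff_quot[OF f g] dirichlet_inner_diff_quot[OF g f]
    by (simp add: mult.commute)
qed

lemma dirichlet_inner_self:
  assumes f: "f \<in> dirichlet_space \<mu>"
  shows "dirichlet_inner \<mu> f f = of_real (dirichlet_normsq \<mu> f)"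
proof -
  have "(\<Sum>n. taylor_coeff f n * cnj (taylor_coeff f n)) = of_real (\<Sum>n. (norm (taylor_coeff f n))\<^sup>2)"
    using hardy2_summable[OF dirichlet_space_hardy2[OF f]]
    by (subst suminf_of_real) (simp_all add: complex_norm_square del: of_real_power)
  moreover have "(LINT p|(\<mu> \<Otimes>\<^sub>M arclen). diff_quot f p * cnj (diff_quot f p)) =
      of_real (LINT p|(\<mu> \<Otimes>\<^sub>M arclen). (norm (diff_quot f p))\<^sup>2)"
    unfolding complex_norm_square[symmetric] by (rule integral_complex_of_real)
  ultimately show ?thesis
    unfolding dirichlet_inner_diff_quot[OF f f] dirichlet_normsq_def dirichlet_integral_real[OF f] by simp
qed

end

section \<open>Existence of the reproducing kernel\<close>

lemma local_dirichlet_representation: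
  assumes f: "f \<in> hardy2" and xi: "norm \<xi> = 1" and fin: "local_dirichlet f \<xi> \<noteq> \<infinity>"
  obtains L where "summable (\<lambda>n. (norm (L - partial_taylor f n \<xi>))\<^sup>2)"
    "local_dirichlet f \<xi> = ennreal (2 * pi * (\<Sum>n. (norm (L - partial_taylor f n \<xi>))\<^sup>2))"
proof -
  obtain L where "has_nt_limit f \<xi> L" using local_dirichlet_finite_imp_nt_limit[OF fin] by blast
  then have sm: "summable (\<lambda>n. (norm (L - partial_taylor f n \<xi>))\<^sup>2)"
    by (rule local_dirichlet_finite_summable[OF f xi _ fin])
  moreover have "local_dirichlet f \<xi> = ennreal (2 * pi * (\<Sum>n. (norm (L - partial_taylor f n \<xi>))\<^sup>2))"
    using sm local_dirichlet_summable[OF f xi sm] by (simp add: ennreal_mult suminf_nonneg suminf_ennreal2)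
  ultimately show ?thesis by (rule that)
qed

text \<open>Coefficientwise convergence says nothing directly about boundary values at
  \<open>\<xi>\<close>. On a subsequence with bounded local integrals, however, the boundary values
  are bounded, so a further subsequence of them converges to some \<open>l\<close>. Partial sums of
  the square series pass to the limit, and summability makes \<open>l\<close> the boundary value of
  \<open>f\<close>.\<close>

lemma local_dirichlet_lower_semicontinuous:
  assumes F: "\<And>n. F n \<in> hardy2" and f: "f \<in> hardy2" and xi: "norm \<xi> = 1"
    and conv: "\<And>k. (\<lambda>n. taylor_coeff (F n) k) \<longlonglongrightarrow> taylor_coeff f k"
  shows "local_dirichlet f \<xi> \<le> liminf (\<lambda>n. local_dirichlet (F n) \<xi>)"
  unfolding le_Liminf_iff
proof (intro allI impI, rule ccontr)
  fix c assume c: "c < local_dirichlet f \<xi>"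
    and neg: "\<not> (\<forall>\<^sub>F n in sequentially. c < local_dirichlet (F n) \<xi>)"
  have ctop: "c \<noteq> top" using c by auto
  define C where "C = enn2real c / (2 * pi)"
  have "\<forall>k. \<exists>n\<ge>k. local_dirichlet (F n) \<xi> \<le> c"
    using neg unfolding eventually_sequentially not_less[symmetric] by blast
  then obtain m where m: "\<And>k. k \<le> m k" "\<And>k. local_dirichlet (F (m k)) \<xi> \<le> c" by metis
  \<comment> \<open>Only partial sums of the square series are recorded: each involves finitely many
    coefficients and is therefore continuous under the given convergence.\<close>
  have "\<exists>L. \<forall>N. (\<Sum>n<N. (norm (L - partial_taylor (F (m k)) n \<xi>))\<^sup>2) \<le> C" for k
  proof -
    have "local_dirichlet (F (m k)) \<xi> \<noteq> \<infinity>" using m(2)[of k] ctop by (auto simp: top_unique)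
    then obtain L where L: "summable (\<lambda>n. (norm (L - partial_taylor (F (m k)) n \<xi>))\<^sup>2)"
      "local_dirichlet (F (m k)) \<xi> = ennreal (2 * pi * (\<Sum>n. (norm (L - partial_taylor (F (m k)) n \<xi>))\<^sup>2))"
      using local_dirichlet_representation[OF F xi] by blast
    have "ennreal (2 * pi * (\<Sum>n. (norm (L - partial_taylor (F (m k)) n \<xi>))\<^sup>2)) \<le> ennreal (enn2real c)"
      using m(2)[of k] L(2) ctop by (simp add: less_top)
    then have "2 * pi * (\<Sum>n. (norm (L - partial_taylor (F (m k)) n \<xi>))\<^sup>2) \<le> enn2real c"
      by simp
    then have "(\<Sum>n. (norm (L - partial_taylor (F (m k)) n \<xi>))\<^sup>2) \<le> C"
      by (simp add: C_def field_simps)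
    then show ?thesis
      using sum_le_suminf[OF L(1)] by (meson finite_lessThan order_trans zero_le_power2)
  qed
  then obtain L where L: "\<And>k N. (\<Sum>n<N. (norm (L k - partial_taylor (F (m k)) n \<xi>))\<^sup>2) \<le> C" by metis
  have mtop: "filterlim m at_top sequentially"
    by (rule filterlim_at_top_mono[OF filterlim_ident always_eventually]) (use m(1) in blast)
  have pt: "(\<lambda>k. partial_taylor (F (m k)) n \<xi>) \<longlonglongrightarrow> partial_taylor f n \<xi>" for n
    unfolding partial_taylor_def by (intro tendsto_intros filterlim_compose[OF conv mtop])
  have "bounded (range L)"
  proof -
    have "bounded (range (\<lambda>k. partial_taylor (F (m k)) 0 \<xi>))"
      using pt[of 0] by (rule convergent_imp_bounded)
    then obtain B where B: "\<And>k. norm (partial_taylor (F (m k)) 0 \<xi>) \<le> B" by (auto simp: bounded_iff)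
    have "norm (L k) \<le> B + sqrt C" for k
    proof -
      \<comment> \<open>The single term of index 0 already bounds the distance of \<open>L k\<close>
        from the convergent constant coefficients.\<close>
      have "(norm (L k - partial_taylor (F (m k)) 0 \<xi>))\<^sup>2 \<le> C" using L[of k 1] by simp
      then have "norm (L k - partial_taylor (F (m k)) 0 \<xi>) \<le> sqrt C" by (rule real_le_rsqrt)
      then show ?thesis
        using B[of k] norm_triangle_sub[of "L k" "partial_taylor (F (m k)) 0 \<xi>"] by linarith
    qed
    then show ?thesis by (auto simp: bounded_iff)
  qed
  then obtain l r where r: "strict_mono r" and l: "(L \<circ> r) \<longlonglongrightarrow> l"
    using bounded_imp_convergent_subsequence by blast
  have part: "(\<Sum>n<N. (norm (l - partial_taylor f n \<xi>))\<^sup>2) \<le> C" for N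
  proof (rule LIMSEQ_le_const2)
    show "(\<lambda>k. \<Sum>n<N. (norm (L (r k) - partial_taylor (F (m (r k))) n \<xi>))\<^sup>2)
        \<longlonglongrightarrow> (\<Sum>n<N. (norm (l - partial_taylor f n \<xi>))\<^sup>2)"
      using l LIMSEQ_subseq_LIMSEQ[OF pt r] by (intro tendsto_intros) (auto simp: o_def)
  qed (use L in auto)
  have sm: "summable (\<lambda>n. (norm (l - partial_taylor f n \<xi>))\<^sup>2)"
    by (rule summableI_nonneg_bounded[OF _ part]) simp
  have "(\<Sum>n. (norm (l - partial_taylor f n \<xi>))\<^sup>2) \<le> C"
    by (rule suminf_le_const[OF sm part])
  then have "2 * pi * (\<Sum>n. (norm (l - partial_taylor f n \<xi>))\<^sup>2) \<le> enn2real c"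
    by (simp add: C_def field_simps)
  then have "ennreal (2 * pi * (\<Sum>n. (norm (l - partial_taylor f n \<xi>))\<^sup>2)) \<le> c"
    using ctop by (metis ennreal_enn2real ennreal_leI less_top)
  moreover have "local_dirichlet f \<xi> = ennreal (2 * pi * (\<Sum>n. (norm (l - partial_taylor f n \<xi>))\<^sup>2))"
    using sm local_dirichlet_summable[OF f xi sm] by (simp add: ennreal_mult suminf_nonneg suminf_ennreal2)
  ultimately show False using c by (simp add: not_less[symmetric])
qed

lemma const_one_hardy2: "(\<lambda>z. 1) \<in> hardy2" "taylor_coeff (\<lambda>z. 1) = (\<lambda>n. if n = 0 then 1 else 0)"
proof -
  have s: "(\<lambda>n. (if n = 0 then 1 else 0) * z ^ n) sums 1" for z :: complex
    using sums_single[of 0 "\<lambda>n. 1 :: complex"] by (simp add: if_distrib[of "\<lambda>x. x * _"] cong: if_cong)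
  have "summable (\<lambda>n::nat. (norm (if n = 0 then 1 else 0 :: complex))\<^sup>2)"
    by (rule summable_finite[of "{0}"]) auto
  from hardy2I[OF s this]
  show "(\<lambda>z. 1) \<in> hardy2" "taylor_coeff (\<lambda>z. 1) = (\<lambda>n. if n = 0 then 1 else 0)" by auto
qed

lemma local_dirichlet_one:
  assumes "norm \<xi> = 1"
  shows "local_dirichlet (\<lambda>z. 1) \<xi> = 0"
proof -
  have "partial_taylor (\<lambda>z. 1) n \<xi> = 1" for n
    by (simp add: partial_taylor_def const_one_hardy2 if_distrib[of "\<lambda>x. x * _"] cong: if_cong)
  then show ?thesis
    using local_dirichlet_summable[OF const_one_hardy2(1) assms, of 1] by simp
qed

context
  fixes \<mu> :: "complex measure"
  assumes mu: "circle_measure \<mu>"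
begin

lemma dirichlet_integral_one: "dirichlet_integral \<mu> (\<lambda>z. 1) = 0"
proof -
  have "(\<integral>\<^sup>+\<xi>. local_dirichlet (\<lambda>z. 1) \<xi> \<partial>\<mu>) = (\<integral>\<^sup>+\<xi>. 0 \<partial>\<mu>)"
    by (intro nn_integral_cong local_dirichlet_one) (simp add: space_mu[OF mu])
  then show ?thesis by (simp add: dirichlet_integral_def)
qed

lemma one_dirichlet_space: "(\<lambda>z. 1) \<in> dirichlet_space \<mu>"
  by (simp add: dirichlet_space_def const_one_hardy2(1) dirichlet_integral_one)

lemma dirichlet_normsq_one: "dirichlet_normsq \<mu> (\<lambda>z. 1) = 1"
proof -
  have "(\<Sum>n. (norm (taylor_coeff (\<lambda>z. 1) n))\<^sup>2) = (\<Sum>n\<in>{0}. (norm (taylor_coeff (\<lambda>z. 1) n))\<^sup>2)"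
    by (rule suminf_finite) (auto simp: const_one_hardy2)
  then show ?thesis
    by (simp add: dirichlet_normsq_def dirichlet_integral_one const_one_hardy2)
qed

lemma dirichlet_integral_le_normsq:
  assumes "f \<in> dirichlet_space \<mu>"
  shows "dirichlet_integral \<mu> f = ennreal (enn2real (dirichlet_integral \<mu> f))"
    and "enn2real (dirichlet_integral \<mu> f) + (\<Sum>n<N. (norm (taylor_coeff f n))\<^sup>2) \<le> dirichlet_normsq \<mu> f"
    and "(\<Sum>n. (norm (taylor_coeff f n))\<^sup>2) \<le> dirichlet_normsq \<mu> f"
    and "0 \<le> dirichlet_normsq \<mu> f"
proof -
  have s: "summable (\<lambda>n. (norm (taylor_coeff f n))\<^sup>2)" and fin: "dirichlet_integral \<mu> f < \<infinity>"
    using assms by (auto simp: dirichlet_space_def hardy2_summable)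
  show "dirichlet_integral \<mu> f = ennreal (enn2real (dirichlet_integral \<mu> f))"
    using fin by simp
  show "(\<Sum>n. (norm (taylor_coeff f n))\<^sup>2) \<le> dirichlet_normsq \<mu> f"
    by (simp add: dirichlet_normsq_def)
  show "0 \<le> dirichlet_normsq \<mu> f"
    by (simp add: dirichlet_normsq_def suminf_nonneg s)
  have "(\<Sum>n<N. (norm (taylor_coeff f n))\<^sup>2) \<le> (\<Sum>n. (norm (taylor_coeff f n))\<^sup>2)"
    by (intro sum_le_suminf s) auto
  then show "enn2real (dirichlet_integral \<mu> f) + (\<Sum>n<N. (norm (taylor_coeff f n))\<^sup>2) \<le> dirichlet_normsq \<mu> f"
    by (simp add: dirichlet_normsq_def)
qed

lemma dirichlet_pointwise_bound:
  assumes "f \<in> dirichlet_space \<mu>" "norm z < 1"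
  shows "(norm (f z))\<^sup>2 \<le> dirichlet_normsq \<mu> f / (1 - (norm z)\<^sup>2)"
proof -
  have "(norm z)\<^sup>2 < 1" using assms by (simp add: abs_square_less_1)
  then have "(\<Sum>n. (norm (taylor_coeff f n))\<^sup>2) / (1 - (norm z)\<^sup>2) \<le> dirichlet_normsq \<mu> f / (1 - (norm z)\<^sup>2)"
    by (intro divide_right_mono dirichlet_integral_le_normsq assms) auto
  then show ?thesis
    using hardy2_pointwise_bound[OF dirichlet_space_hardy2[OF mu assms(1)] assms(2)] by linarith
qed

lemma dirichlet_normsq_add_scale:
  assumes f: "f \<in> dirichlet_space \<mu>" and g: "g \<in> dirichlet_space \<mu>"
  shows "dirichlet_normsq \<mu> (\<lambda>z. f z + c * g z) =
    dirichlet_normsq \<mu> f + 2 * Re (c * dirichlet_inner \<mu> g f) + (norm c)\<^sup>2 * dirichlet_normsq \<mu> g"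
proof -
  let ?h = "\<lambda>z. f z + c * g z"
  have h: "?h \<in> dirichlet_space \<mu>" by (rule dirichlet_space_add_scale[OF mu f g])
  have 1: "dirichlet_inner \<mu> f ?h = cnj (dirichlet_inner \<mu> f f + c * dirichlet_inner \<mu> g f)"
    unfolding dirichlet_inner_commute[OF mu h f] dirichlet_inner_add_scale[OF mu f g f] ..
  have 2: "dirichlet_inner \<mu> g ?h = cnj (dirichlet_inner \<mu> f g + c * dirichlet_inner \<mu> g g)"
    unfolding dirichlet_inner_commute[OF mu h g] dirichlet_inner_add_scale[OF mu f g g] ..
  have "of_real (dirichlet_normsq \<mu> ?h) = dirichlet_inner \<mu> f ?h + c * dirichlet_inner \<mu> g ?h"
    unfolding dirichlet_inner_self[OF mu h, symmetric] by (rule dirichlet_inner_add_scale[OF mu f g h])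
  also have "\<dots> = of_real (dirichlet_normsq \<mu> f) + (c * dirichlet_inner \<mu> g f + cnj (c * dirichlet_inner \<mu> g f))
      + (c * cnj c) * of_real (dirichlet_normsq \<mu> g)"
    unfolding 1 2 dirichlet_inner_self[OF mu f] dirichlet_inner_self[OF mu g] dirichlet_inner_commute[OF mu g f]
    by (simp add: algebra_simps)
  also have "\<dots> = of_real (dirichlet_normsq \<mu> f + 2 * Re (c * dirichlet_inner \<mu> g f) + (norm c)\<^sup>2 * dirichlet_normsq \<mu> g)"
    unfolding complex_norm_square[symmetric] complex_add_cnj by simp
  finally show ?thesis by (simp only: of_real_eq_iff)
qed

lemma dirichlet_parallelogram:
  assumes f: "f \<in> dirichlet_space \<mu>" and g: "g \<in> dirichlet_space \<mu>"
  shows "dirichlet_normsq \<mu> (\<lambda>z. f z + (- 1) * g z) + dirichlet_normsq \<mu> (\<lambda>z. f z + 1 * g z)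
    = 2 * dirichlet_normsq \<mu> f + 2 * dirichlet_normsq \<mu> g"
  unfolding dirichlet_normsq_add_scale[OF f g] by simp

lemma zero_dirichlet_space: "(\<lambda>z. 0) \<in> dirichlet_space \<mu>"
  using dirichlet_space_add_scale[OF mu one_dirichlet_space one_dirichlet_space, of "-1"] by simp

lemma dirichlet_space_scale:
  assumes f: "f \<in> dirichlet_space \<mu>"
  shows "(\<lambda>z. c * f z) \<in> dirichlet_space \<mu>"
    and "dirichlet_normsq \<mu> (\<lambda>z. c * f z) = (norm c)\<^sup>2 * dirichlet_normsq \<mu> f"
proof -
  show "(\<lambda>z. c * f z) \<in> dirichlet_space \<mu>"
    using dirichlet_space_add_scale[OF mu zero_dirichlet_space f, of c] by simp
  have z: "dirichlet_normsq \<mu> (\<lambda>z. 0) = 0"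
    using dirichlet_normsq_add_scale[OF one_dirichlet_space one_dirichlet_space, of "-1"]
    by (simp add: dirichlet_inner_self[OF mu one_dirichlet_space] dirichlet_normsq_one)
  have i: "dirichlet_inner \<mu> f (\<lambda>z. 0) = 0"
    using dirichlet_inner_add_scale[OF mu one_dirichlet_space one_dirichlet_space f, of "-1"]
      dirichlet_inner_commute[OF mu zero_dirichlet_space f] by simp
  show "dirichlet_normsq \<mu> (\<lambda>z. c * f z) = (norm c)\<^sup>2 * dirichlet_normsq \<mu> f"
    using dirichlet_normsq_add_scale[OF zero_dirichlet_space f, of c] by (simp add: z i)
qed

end

context
  fixes \<mu> :: "complex measure"
  assumes mu: "circle_measure \<mu>"
begin

text \<open>Direct method. The parallelogram law makes the coefficients of a minimizing sequence
  Cauchy; the coefficientwise limit keeps the value 1 at \<open>z\<close> by the Hardy space bound,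
  and lower semicontinuity shows that its norm does not exceed the infimum.\<close>

lemma dirichlet_minimizer:
  assumes z: "norm z < 1"
  obtains f where "f \<in> dirichlet_space \<mu>" "f z = 1" "0 < dirichlet_normsq \<mu> f"
    "\<And>g. g \<in> dirichlet_space \<mu> \<Longrightarrow> g z = 1 \<Longrightarrow> dirichlet_normsq \<mu> f \<le> dirichlet_normsq \<mu> g"
proof -
  let ?Q = "dirichlet_normsq \<mu>"
  define A where "A = {f \<in> dirichlet_space \<mu>. f z = 1}"
  define m where "m = Inf (?Q ` A)"
  have bdd: "bdd_below (?Q ` A)"
    by (intro bdd_belowI[of _ 0]) (auto simp: A_def dirichlet_integral_le_normsq(4)[OF mu])
  have one: "(\<lambda>z. 1) \<in> A" using one_dirichlet_space[OF mu] by (simp add: A_def)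
  have m_le: "m \<le> ?Q g" if "g \<in> A" for g unfolding m_def using that bdd by (intro cInf_lower) auto
  have "\<exists>f\<in>A. ?Q f < m + 1 / (real n + 1)" for n
  proof -
    have "Inf (?Q ` A) < m + 1 / (real n + 1)" by (simp add: m_def)
    then show ?thesis using one by (subst (asm) cInf_less_iff[OF _ bdd]) auto
  qed
  then obtain F where FA: "\<And>n. F n \<in> A" and FQ: "\<And>n. ?Q (F n) < m + 1 / (real n + 1)" by metis
  have FD: "F n \<in> dirichlet_space \<mu>" and Fz: "F n z = 1" for n using FA by (auto simp: A_def)
  have FH: "F n \<in> hardy2" for n by (rule dirichlet_space_hardy2[OF mu FD])
  let ?a = "\<lambda>n. taylor_coeff (F n)"
  have diffQ: "?Q (\<lambda>w. F n w + (- 1) * F k w) \<le> 2 / (real n + 1) + 2 / (real k + 1)" for n k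
  proof -
    have s: "(\<lambda>w. F n w + 1 * F k w) \<in> dirichlet_space \<mu>" by (rule dirichlet_space_add_scale[OF mu FD FD])
    \<comment> \<open>The midpoint of two competitors is a competitor, so its squared norm is at
      least \<open>m\<close>; the parallelogram law then leaves only the excesses of the two for the
      difference.\<close>
    have "(\<lambda>w. (1/2) * (F n w + 1 * F k w)) \<in> A"
      using dirichlet_space_scale(1)[OF mu s, of "1/2"] by (simp add: A_def Fz)
    from m_le[OF this] have "4 * m \<le> ?Q (\<lambda>w. F n w + 1 * F k w)"
      using dirichlet_space_scale(2)[OF mu s, of "1/2"] by (simp add: power2_eq_square norm_divide)
    then show ?thesis
      using dirichlet_parallelogram[OF mu FD FD, of n k] FQ[of n] FQ[of k] by simp
  qed
  have diffS: "(\<Sum>j<N. (norm (?a n j - ?a k j))\<^sup>2) \<le> 2 / (real n + 1) + 2 / (real k + 1)" for N n k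
  proof -
    have "enn2real (dirichlet_integral \<mu> (\<lambda>w. F n w + (- 1) * F k w)) +
        (\<Sum>j<N. (norm (taylor_coeff (\<lambda>w. F n w + (- 1) * F k w) j))\<^sup>2) \<le> ?Q (\<lambda>w. F n w + (- 1) * F k w)"
      by (intro dirichlet_integral_le_normsq(2)[OF mu] dirichlet_space_add_scale[OF mu] FD)
    then have "(\<Sum>j<N. (norm (taylor_coeff (\<lambda>w. F n w + (- 1) * F k w) j))\<^sup>2) \<le> 2 / (real n + 1) + 2 / (real k + 1)"
      using diffQ[of n k] enn2real_nonneg[of "dirichlet_integral \<mu> (\<lambda>w. F n w + (- 1) * F k w)"] by linarith
    then show ?thesis
      unfolding hardy2_add_scale(2)[OF FH FH] by simp
  qed
  have inv0: "(\<lambda>n. 2 / (real n + 1)) \<longlonglongrightarrow> 0" by real_asymp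
  have "convergent (\<lambda>n. ?a n j)" for j
  proof (rule Cauchy_convergent, rule metric_CauchyI)
    fix e :: real assume e: "0 < e"
    then have "\<forall>\<^sub>F n in sequentially. 2 / (real n + 1) < e\<^sup>2 / 2"
      by (intro order_tendstoD(2)[OF inv0]) auto
    then obtain N where N: "\<And>n. n \<ge> N \<Longrightarrow> 2 / (real n + 1) < e\<^sup>2 / 2" by (auto simp: eventually_sequentially)
    show "\<exists>M. \<forall>n\<ge>M. \<forall>k\<ge>M. dist (?a n j) (?a k j) < e"
    proof (intro exI allI impI)
      fix n k assume nk: "N \<le> n" "N \<le> k"
      have "(norm (?a n j - ?a k j))\<^sup>2 \<le> (\<Sum>i<Suc j. (norm (?a n i - ?a k i))\<^sup>2)"
        by (rule member_le_sum[of j]) auto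
      also have "\<dots> < e\<^sup>2" using diffS[where N = "Suc j" and n = n and k = k] N[OF nk(1)] N[OF nk(2)] by simp
      finally show "dist (?a n j) (?a k j) < e"
        using e unfolding dist_norm by (meson less_imp_le power_less_imp_less_base)
    qed
  qed
  then obtain a where a: "\<And>j. (\<lambda>n. ?a n j) \<longlonglongrightarrow> a j" unfolding convergent_def by metis
  have part: "(\<Sum>j<N. (norm (a j))\<^sup>2) \<le> m" for N
  proof (rule LIMSEQ_le)
    show "(\<lambda>n. \<Sum>j<N. (norm (?a n j))\<^sup>2) \<longlonglongrightarrow> (\<Sum>j<N. (norm (a j))\<^sup>2)" by (intro tendsto_intros a)
    have "(\<lambda>n. m + 1 / (real n + 1)) \<longlonglongrightarrow> m + 0" by (intro tendsto_intros) real_asymp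
    then show "(\<lambda>n. m + 1 / (real n + 1)) \<longlonglongrightarrow> m" by simp
    have "(\<Sum>j<N. (norm (?a n j))\<^sup>2) \<le> m + 1 / (real n + 1)" for n
      using dirichlet_integral_le_normsq(2)[OF mu FD, of n N] FQ[of n]
        enn2real_nonneg[of "dirichlet_integral \<mu> (F n)"] by linarith
    then show "\<exists>N'. \<forall>n\<ge>N'. (\<Sum>j<N. (norm (?a n j))\<^sup>2) \<le> m + 1 / (real n + 1)" by blast
  qed
  have sa: "summable (\<lambda>j. (norm (a j))\<^sup>2)"
    by (rule summableI_nonneg_bounded[OF _ part]) simp
  define f where "f = power_fun a"
  have fH: "f \<in> hardy2" and fa: "taylor_coeff f = a"
    unfolding f_def by (rule power_fun_hardy2[OF sa])+
  have fz: "f z = 1"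
  proof -
    have z2: "0 < 1 - (norm z)\<^sup>2" using z by (simp add: abs_square_less_1)
    have bound: "(norm (1 - f z))\<^sup>2 \<le> 2 / (real n + 1) / (1 - (norm z)\<^sup>2)" for n
    proof -
      have h: "(\<lambda>w. F n w + (- 1) * f w) \<in> hardy2"
        and ha: "taylor_coeff (\<lambda>w. F n w + (- 1) * f w) = (\<lambda>j. ?a n j + (- 1) * a j)"
        unfolding fa[symmetric] by (rule hardy2_add_scale[OF FH fH])+
      have "(\<Sum>j<N. (norm (?a n j - a j))\<^sup>2) \<le> 2 / (real n + 1)" for N
      proof (rule LIMSEQ_le)
        show "(\<lambda>k. \<Sum>j<N. (norm (?a n j - ?a k j))\<^sup>2) \<longlonglongrightarrow> (\<Sum>j<N. (norm (?a n j - a j))\<^sup>2)"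
          by (intro tendsto_intros a)
        have "(\<lambda>k. 2 / (real n + 1) + 2 / (real k + 1)) \<longlonglongrightarrow> 2 / (real n + 1) + 0"
          by (intro tendsto_add tendsto_const inv0)
        then show "(\<lambda>k. 2 / (real n + 1) + 2 / (real k + 1)) \<longlonglongrightarrow> 2 / (real n + 1)" by simp
      qed (use diffS in blast)
      then have "(\<Sum>j. (norm (taylor_coeff (\<lambda>w. F n w + (- 1) * f w) j))\<^sup>2) \<le> 2 / (real n + 1)"
        by (intro suminf_le_const hardy2_summable h) (simp only: ha, simp)
      then have "(\<Sum>j. (norm (taylor_coeff (\<lambda>w. F n w + (- 1) * f w) j))\<^sup>2) / (1 - (norm z)\<^sup>2) \<le> 2 / (real n + 1) / (1 - (norm z)\<^sup>2)"
        using z2 by (intro divide_right_mono) auto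
      then show ?thesis using hardy2_pointwise_bound[OF h z] by (simp add: Fz)
    qed
    have "(\<lambda>n. 2 / (real n + 1) / (1 - (norm z)\<^sup>2)) \<longlonglongrightarrow> 0"
      using tendsto_divide[OF inv0 tendsto_const, of "1 - (norm z)\<^sup>2"] z2 by simp
    then have "(norm (1 - f z))\<^sup>2 \<le> 0"
      by (rule LIMSEQ_le_const) (use bound in blast)
    then show ?thesis by simp
  qed
  \<comment> \<open>Both parts of the norm must be bounded together. For fixed \<open>N\<close> the
    finite coefficient sum converges and may be moved to the other side before taking the lower
    limit of the Dirichlet integrals; \<open>N\<close> is sent to infinity afterwards.\<close>
  have dir: "dirichlet_integral \<mu> f \<le> ennreal (m - (\<Sum>j<N. (norm (a j))\<^sup>2))" for N
  proof -
    have "(\<integral>\<^sup>+\<xi>. local_dirichlet f \<xi> \<partial>\<mu>) \<le> (\<integral>\<^sup>+\<xi>. liminf (\<lambda>n. local_dirichlet (F n) \<xi>) \<partial>\<mu>)"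
      using a fa by (intro nn_integral_mono local_dirichlet_lower_semicontinuous FH fH)
        (auto simp: space_mu[OF mu])
    also have "\<dots> \<le> liminf (\<lambda>n. \<integral>\<^sup>+\<xi>. local_dirichlet (F n) \<xi> \<partial>\<mu>)"
      by (rule nn_integral_liminf) (rule borel_measurable_local_dirichlet[OF mu FH])
    finally have "dirichlet_integral \<mu> f \<le> ennreal (1 / (2*pi)) * liminf (\<lambda>n. \<integral>\<^sup>+\<xi>. local_dirichlet (F n) \<xi> \<partial>\<mu>)"
      unfolding dirichlet_integral_def by (rule mult_left_mono) simp
    also have "\<dots> = liminf (\<lambda>n. dirichlet_integral \<mu> (F n))"
      unfolding dirichlet_integral_def
    proof (rule Liminf_compose_continuous_mono[symmetric])
      show "continuous_on UNIV (\<lambda>x. ennreal (1 / (2*pi)) * x)"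
        unfolding continuous_on_def by (auto intro!: ennreal_tendsto_cmult tendsto_ident_at)
      show "mono (\<lambda>x. ennreal (1 / (2*pi)) * x)" by (auto simp: mono_def intro: mult_left_mono)
    qed simp
    also have "\<dots> \<le> liminf (\<lambda>n. ennreal (m + 1 / (real n + 1) - (\<Sum>j<N. (norm (?a n j))\<^sup>2)))"
    proof (rule Liminf_mono, rule always_eventually, rule allI)
      fix n
      have "enn2real (dirichlet_integral \<mu> (F n)) \<le> m + 1 / (real n + 1) - (\<Sum>j<N. (norm (?a n j))\<^sup>2)"
        using dirichlet_integral_le_normsq(2)[OF mu FD, of n N] FQ[of n] by linarith
      then show "dirichlet_integral \<mu> (F n) \<le> ennreal (m + 1 / (real n + 1) - (\<Sum>j<N. (norm (?a n j))\<^sup>2))"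
        using dirichlet_integral_le_normsq(1)[OF mu FD[of n]] by (metis ennreal_leI)
    qed
    also have "\<dots> = ennreal (m - (\<Sum>j<N. (norm (a j))\<^sup>2))"
    proof (rule lim_imp_Liminf[OF sequentially_bot], rule tendsto_ennrealI)
      have "(\<lambda>n. m + 1 / (real n + 1) - (\<Sum>j<N. (norm (?a n j))\<^sup>2)) \<longlonglongrightarrow> m + 0 - (\<Sum>j<N. (norm (a j))\<^sup>2)"
        by (intro tendsto_diff tendsto_add tendsto_const tendsto_sum tendsto_power tendsto_norm a) real_asymp
      then show "(\<lambda>n. m + 1 / (real n + 1) - (\<Sum>j<N. (norm (?a n j))\<^sup>2)) \<longlonglongrightarrow> m - (\<Sum>j<N. (norm (a j))\<^sup>2)" by simp
    qed
    finally show ?thesis .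
  qed
  have fD: "f \<in> dirichlet_space \<mu>"
    using dir[of 0] fH by (auto simp: dirichlet_space_def intro: le_less_trans)
  have "(\<Sum>j. (norm (a j))\<^sup>2) \<le> m - enn2real (dirichlet_integral \<mu> f)"
  proof (rule suminf_le_const[OF sa])
    fix N
    have "enn2real (dirichlet_integral \<mu> f) \<le> m - (\<Sum>j<N. (norm (a j))\<^sup>2)"
      using dir[of N] part[of N] by (simp add: enn2real_leI)
    then show "(\<Sum>j<N. (norm (a j))\<^sup>2) \<le> m - enn2real (dirichlet_integral \<mu> f)" by linarith
  qed
  then have fQ: "?Q f \<le> m" by (simp add: dirichlet_normsq_def fa)
  \<comment> \<open>The minimum is positive because evaluation at \<open>z\<close> is bounded and
    takes the value 1 here.\<close>
  have "1 \<le> ?Q f / (1 - (norm z)\<^sup>2)"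
    using dirichlet_pointwise_bound[OF mu fD z] by (simp add: fz)
  moreover have "0 < 1 - (norm z)\<^sup>2" using z by (simp add: abs_square_less_1)
  ultimately have "0 < ?Q f" by (smt (verit) divide_nonpos_pos)
  then show ?thesis
    using that[OF fD fz] fQ m_le by (force simp: A_def)
qed

text \<open>The minimizer is orthogonal to every element vanishing at \<open>z\<close>, so a
  multiple of it represents evaluation. The last two claims say that the diagonal value is the least
  constant in the evaluation inequality: the lower estimate of the kernel uses one test function,
  the upper one an inequality for all elements.\<close>

lemma dirichlet_kernel_characterization:
  assumes z: "norm z < 1"
  shows "dirichlet_kernel \<mu> z z \<in> \<real>"
    and "\<And>f. f \<in> dirichlet_space \<mu> \<Longrightarrow>
      (norm (f z))\<^sup>2 \<le> Re (dirichlet_kernel \<mu> z z) * dirichlet_normsq \<mu> f"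
    and "\<And>B. (\<And>f. f \<in> dirichlet_space \<mu> \<Longrightarrow> (norm (f z))\<^sup>2 \<le> B * dirichlet_normsq \<mu> f) \<Longrightarrow>
      Re (dirichlet_kernel \<mu> z z) \<le> B"
proof -
  let ?Q = "dirichlet_normsq \<mu>"
  obtain f where f: "f \<in> dirichlet_space \<mu>" "f z = 1" "0 < ?Q f"
    and min: "\<And>g. g \<in> dirichlet_space \<mu> \<Longrightarrow> g z = 1 \<Longrightarrow> ?Q f \<le> ?Q g"
    using dirichlet_minimizer[OF z] by blast
  have orth: "dirichlet_inner \<mu> h f = 0" if h: "h \<in> dirichlet_space \<mu>" "h z = 0" for h
  proof -
    \<comment> \<open>A step length short enough that the quadratic term cannot offset the linear
      one; the added 1 covers a vanishing norm of \<open>h\<close>.\<close>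
    define t where "t = 1 / (?Q h + 1)"
    have Qh: "0 \<le> ?Q h" by (rule dirichlet_integral_le_normsq(4)[OF mu h(1)])
    then have t: "0 < t" "t * ?Q h < 1" by (auto simp: t_def)
    define i where "i = dirichlet_inner \<mu> h f"
    define c where "c = - (of_real t * cnj i)"
    have "?Q f \<le> ?Q (\<lambda>w. f w + c * h w)"
      by (rule min) (use dirichlet_space_add_scale[OF mu f(1) h(1)] f(2) h(2) in auto)
    also have "\<dots> = ?Q f + 2 * Re (c * i) + (norm c)\<^sup>2 * ?Q h"
      unfolding i_def by (rule dirichlet_normsq_add_scale[OF mu f(1) h(1)])
    also have "Re (c * i) = - t * (norm i)\<^sup>2"
    proof -
      have "c * i = - of_real (t * (norm i)\<^sup>2)"
        unfolding c_def of_real_mult complex_norm_square by simp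
      then show ?thesis by (simp only: uminus_complex.simps Re_complex_of_real mult_minus_left)
    qed
    also have "(norm c)\<^sup>2 = t\<^sup>2 * (norm i)\<^sup>2"
      by (simp add: c_def norm_mult power_mult_distrib)
    finally have "0 \<le> t * (norm i)\<^sup>2 * (t * ?Q h - 2)"
      by (simp add: algebra_simps power2_eq_square)
    then have "(norm i)\<^sup>2 \<le> 0"
      using t by (auto simp: zero_le_mult_iff mult_le_0_iff)
    then show ?thesis by (simp add: i_def)
  qed
  have repr: "dirichlet_inner \<mu> u f = u z * of_real (?Q f)" if u: "u \<in> dirichlet_space \<mu>" for u
  proof -
    have "dirichlet_inner \<mu> (\<lambda>w. u w + (- u z) * f w) f = 0"
      by (rule orth[OF dirichlet_space_add_scale[OF mu u f(1)]]) (simp add: f(2))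
    then show ?thesis
      unfolding dirichlet_inner_add_scale[OF mu u f(1) f(1)] dirichlet_inner_self[OF mu f(1)]
      by (simp add: algebra_simps)
  qed
  define k where "k = 1 / ?Q f"
  define g where "g = (\<lambda>w. complex_of_real k * f w)"
  have gD: "g \<in> dirichlet_space \<mu>" unfolding g_def by (rule dirichlet_space_scale(1)[OF mu f(1)])
  have g: "u z = dirichlet_inner \<mu> u g" if u: "u \<in> dirichlet_space \<mu>" for u
  proof -
    have "dirichlet_inner \<mu> g u = dirichlet_inner \<mu> (\<lambda>w. 0) u + of_real k * dirichlet_inner \<mu> f u"
      using dirichlet_inner_add_scale[OF mu zero_dirichlet_space[OF mu] f(1) u, of "of_real k"] by (simp add: g_def)
    also have "dirichlet_inner \<mu> (\<lambda>w. 0) u = 0"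
      using dirichlet_inner_add_scale[OF mu f(1) f(1) u, of "-1"] by simp
    finally have "dirichlet_inner \<mu> u g = of_real k * dirichlet_inner \<mu> u f"
      using dirichlet_inner_commute[OF mu gD u] dirichlet_inner_commute[OF mu f(1) u] by simp
    then show ?thesis using f(3) by (simp add: repr[OF u] k_def)
  qed
  have kern: "dirichlet_kernel \<mu> z z = of_real k"
    unfolding dirichlet_kernel_def
  proof (rule the_equality)
    show "\<exists>g\<in>dirichlet_space \<mu>. (\<forall>f\<in>dirichlet_space \<mu>. f z = dirichlet_inner \<mu> f g) \<and> complex_of_real k = g z"
      using gD g f(2) by (intro bexI[of _ g]) (auto simp: g_def)
    \<comment> \<open>Two representing elements have the same value at \<open>z\<close>: represent
      each by the other and use conjugate symmetry.\<close>
    fix v assume "\<exists>g\<in>dirichlet_space \<mu>. (\<forall>f\<in>dirichlet_space \<mu>. f z = dirichlet_inner \<mu> f g) \<and> v = g z"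
    then obtain g' where g': "g' \<in> dirichlet_space \<mu>" "\<And>u. u \<in> dirichlet_space \<mu> \<Longrightarrow> u z = dirichlet_inner \<mu> u g'" "v = g' z"
      by blast
    have "v = dirichlet_inner \<mu> g' g" using g[OF g'(1)] g'(3) by simp
    also have "\<dots> = cnj (dirichlet_inner \<mu> g g')" by (rule dirichlet_inner_commute[OF mu gD g'(1)])
    also have "dirichlet_inner \<mu> g g' = g z" using g'(2)[OF gD] by simp
    also have "g z = of_real k" using f(2) by (simp add: g_def)
    finally show "v = of_real k" by simp
  qed
  show "dirichlet_kernel \<mu> z z \<in> \<real>" by (simp add: kern)
  show "(norm (u z))\<^sup>2 \<le> Re (dirichlet_kernel \<mu> z z) * ?Q u" if u: "u \<in> dirichlet_space \<mu>" for u
  proof (cases "u z = 0")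
    case True
    then show ?thesis using f(3) dirichlet_integral_le_normsq(4)[OF mu u] by (simp add: kern k_def)
  next
    case False
    have "?Q f \<le> ?Q (\<lambda>w. (1 / u z) * u w)"
      by (rule min[OF dirichlet_space_scale(1)[OF mu u]]) (use False in simp)
    also have "\<dots> = ?Q u / (norm (u z))\<^sup>2"
      unfolding dirichlet_space_scale(2)[OF mu u] by (simp add: norm_divide power_divide)
    finally show ?thesis using False f(3) by (simp add: kern k_def field_simps)
  qed
  show "Re (dirichlet_kernel \<mu> z z) \<le> B"
    if "\<And>f. f \<in> dirichlet_space \<mu> \<Longrightarrow> (norm (f z))\<^sup>2 \<le> B * ?Q f" for B
    using that[OF f(1)] f by (simp add: kern k_def field_simps)
qed

end

section \<open>The upper bound\<close>

lemma ennreal_norm_sums_le: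
  fixes x :: "nat \<Rightarrow> 'a :: banach"
  assumes "x sums s"
  shows "ennreal (norm s) \<le> (\<Sum>n. ennreal (norm (x n)))"
proof (cases "summable (\<lambda>n. norm (x n))")
  case True
  then have "norm s \<le> (\<Sum>n. norm (x n))"
    using summable_norm[OF True] assms by (simp add: sums_iff)
  then show ?thesis using True by (simp add: suminf_ennreal2 ennreal_leI)
next
  case False
  then show ?thesis by (simp add: summable_iff_suminf_neq_top)
qed

lemma hardy2_deriv_sums:
  assumes f: "f \<in> hardy2" and z: "norm z < 1"
  shows "(\<lambda>n. of_nat n * taylor_coeff f n * z ^ (n - 1)) sums deriv f z"
proof -
  have "deriv f holomorphic_on ball 0 1"
    using f by (intro holomorphic_deriv) (auto simp: hardy2_def)
  from holomorphic_power_series[OF this, of z]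
  have "(\<lambda>n. (deriv ^^ n) (deriv f) 0 / fact n * z ^ n) sums deriv f z" using z by simp
  moreover have "(deriv ^^ n) (deriv f) 0 / fact n = of_nat (Suc n) * taylor_coeff f (Suc n)" for n
  proof -
    have "(deriv ^^ n) (deriv f) 0 = (deriv ^^ Suc n) f 0" by (simp only: funpow_Suc_right o_apply)
    then show ?thesis by (simp add: taylor_coeff_def del: of_nat_Suc funpow.simps)
  qed
  ultimately have "(\<lambda>n. of_nat (Suc n) * taylor_coeff f (Suc n) * z ^ (Suc n - 1)) sums deriv f z"
    by simp
  then show ?thesis by (subst (asm) sums_Suc_iff) simp
qed

text \<open>A Fejer-Riesz inequality on a radius with a cruder constant. Passing to absolute values
  of the coefficients reduces it to Hilbert's inequality for monomials.\<close>

lemma hardy2_ray_square_integral: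
  assumes f: "f \<in> hardy2" and w: "norm \<omega> = 1"
  shows "(\<integral>\<^sup>+r. ennreal ((norm (f (of_real r * \<omega>)))\<^sup>2) * indicator {0..<1} r \<partial>lborel)
    \<le> 8 * (\<Sum>n. ennreal ((norm (taylor_coeff f n))\<^sup>2))"
proof -
  have "(\<integral>\<^sup>+r. ennreal ((norm (f (of_real r * \<omega>)))\<^sup>2) * indicator {0..<1} r \<partial>lborel)
    \<le> (\<integral>\<^sup>+r. (\<Sum>n. ennreal (norm (taylor_coeff f n) * (indicator {0..1} r * r ^ n)))\<^sup>2 \<partial>lborel)"
  proof (rule nn_integral_mono)
    fix r :: real
    show "ennreal ((norm (f (of_real r * \<omega>)))\<^sup>2) * indicator {0..<1} r
        \<le> (\<Sum>n. ennreal (norm (taylor_coeff f n) * (indicator {0..1} r * r ^ n)))\<^sup>2"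
    proof (cases "r \<in> {0..<1}")
      case True
      then have "norm (of_real r * \<omega>) < 1" using w by (simp add: norm_mult)
      from ennreal_norm_sums_le[OF hardy2_sums[OF f this]]
      have "ennreal (norm (f (of_real r * \<omega>))) \<le> (\<Sum>n. ennreal (norm (taylor_coeff f n) * (indicator {0..1} r * r ^ n)))"
        using True w by (simp add: norm_mult norm_power)
      then have "(ennreal (norm (f (of_real r * \<omega>))))\<^sup>2 \<le> (\<Sum>n. ennreal (norm (taylor_coeff f n) * (indicator {0..1} r * r ^ n)))\<^sup>2"
        by (rule power_mono) simp
      then show ?thesis using True by (simp add: ennreal_power)
    qed simp
  qed
  also have "\<dots> \<le> 8 * (\<Sum>n. ennreal ((norm (taylor_coeff f n))\<^sup>2))"
  proof (rule nn_integral_hilbert)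
    show "(\<integral>\<^sup>+r. ennreal (indicator {0..1} r * r ^ n * (indicator {0..1} r * r ^ m)) \<partial>lborel)
        \<le> ennreal (1 / (real n + real m + 1))" for n m
      by (rule monomials_gram)
  qed (auto simp: indicator_def)
  finally show ?thesis .
qed

text \<open>The same reduction; the factor \<open>1 - r\<close> keeps the Gram matrix of the
  differentiated monomials below the Hilbert matrix.\<close>

lemma hardy2_ray_deriv_square_integral:
  assumes f: "f \<in> hardy2" and w: "norm \<omega> = 1"
  shows "(\<integral>\<^sup>+r. ennreal (((1 - r) * norm (deriv f (of_real r * \<omega>)))\<^sup>2) * indicator {0..<1} r \<partial>lborel)
    \<le> 8 * (\<Sum>n. ennreal ((norm (taylor_coeff f n))\<^sup>2))"
proof -
  let ?e = "\<lambda>n r. indicator {0..1} r * ((1 - r) * (real n * r ^ (n - 1)))"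
  have "(\<integral>\<^sup>+r. ennreal (((1 - r) * norm (deriv f (of_real r * \<omega>)))\<^sup>2) * indicator {0..<1} r \<partial>lborel)
    \<le> (\<integral>\<^sup>+r. (\<Sum>n. ennreal (norm (taylor_coeff f n) * ?e n r))\<^sup>2 \<partial>lborel)"
  proof (rule nn_integral_mono)
    fix r :: real
    show "ennreal (((1 - r) * norm (deriv f (of_real r * \<omega>)))\<^sup>2) * indicator {0..<1} r
        \<le> (\<Sum>n. ennreal (norm (taylor_coeff f n) * ?e n r))\<^sup>2"
    proof (cases "r \<in> {0..<1}")
      case True
      then have "norm (of_real r * \<omega>) < 1" using w by (simp add: norm_mult)
      from ennreal_norm_sums_le[OF sums_mult[OF hardy2_deriv_sums[OF f this], of "of_real (1 - r)"]]
      have "ennreal ((1 - r) * norm (deriv f (of_real r * \<omega>))) \<le> (\<Sum>n. ennreal (norm (taylor_coeff f n) * ?e n r))"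
        using True w by (simp add: norm_mult norm_power mult_ac del: of_real_diff)
      then have "(ennreal ((1 - r) * norm (deriv f (of_real r * \<omega>))))\<^sup>2 \<le> (\<Sum>n. ennreal (norm (taylor_coeff f n) * ?e n r))\<^sup>2"
        by (rule power_mono) simp
      then show ?thesis using True by (simp add: ennreal_power)
    qed simp
  qed
  also have "\<dots> \<le> 8 * (\<Sum>n. ennreal ((norm (taylor_coeff f n))\<^sup>2))"
  proof (rule nn_integral_hilbert)
    show "(\<integral>\<^sup>+r. ennreal (?e n r * ?e m r) \<partial>lborel) \<le> ennreal (1 / (real n + real m + 1))" for n m
      by (rule weighted_monomial_derivs_gram)
  qed (auto simp: indicator_def)
  finally show ?thesis .
qed

section \<open>Weighted estimates for derivatives along a radius\<close>

lemma norm_circle_minus_ray: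
  fixes \<xi> \<omega> :: complex
  assumes "norm \<xi> = 1" "norm \<omega> = 1" "0 \<le> r"
  shows "1 - r \<le> norm (\<xi> - of_real r * \<omega>)"
  using norm_triangle_ineq2[of \<xi> "of_real r * \<omega>"] assms by (simp add: norm_mult)

lemma continuous_on_ray:
  fixes g :: "complex \<Rightarrow> complex"
  assumes "continuous_on (ball 0 1) g" "norm \<omega> = 1"
  shows "continuous_on {0..<1} (\<lambda>r. g (of_real r * \<omega>))"
proof (rule continuous_on_compose2[OF assms(1)])
  show "continuous_on {0..<1} (\<lambda>r. complex_of_real r * \<omega>)" by (intro continuous_intros)
  show "(\<lambda>r. complex_of_real r * \<omega>) ` {0..<1} \<subseteq> ball 0 1"
    using assms(2) by (auto simp: norm_mult)
qed

lemma borel_measurable_ray_deriv: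
  assumes f: "f \<in> hardy2" and w: "norm \<omega> = 1"
  shows "(\<lambda>r. indicator {0..<1} r * norm (deriv f (of_real r * \<omega>))) \<in> borel_measurable borel"
proof -
  have "deriv f holomorphic_on ball 0 1"
    using f by (intro holomorphic_deriv) (auto simp: hardy2_def)
  then have "continuous_on (ball 0 1) (deriv f)" by (rule holomorphic_on_imp_continuous_on)
  from continuous_on_ray[OF this w] have "continuous_on {0..<1} (\<lambda>r. norm (deriv f (of_real r * \<omega>)))"
    by (rule continuous_on_norm)
  from borel_measurable_continuous_on_indicator[OF _ this] show ?thesis by simp
qed

text \<open>This is the derivative estimate for a unit point mass at \<open>\<xi>\<close>: the
  Poisson kernel of \<open>\<xi>\<close> appears in place of the Poisson integral, and the constant
  depends neither on \<open>\<xi>\<close> nor on \<open>\<omega>\<close>.\<close>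

lemma local_dirichlet_ray_bound:
  assumes f: "f \<in> hardy2" and xi: "norm \<xi> = 1" and w: "norm \<omega> = 1"
  shows "(\<integral>\<^sup>+r. ennreal ((1 - r) * ((1 - r\<^sup>2) / (norm (\<xi> - of_real r * \<omega>))\<^sup>2) * (norm (deriv f (of_real r * \<omega>)))\<^sup>2)
      * indicator {0..<1} r \<partial>lborel) \<le> 64 * local_dirichlet f \<xi>"
proof (cases "local_dirichlet f \<xi> = \<infinity>")
  case True
  then show ?thesis by (simp add: ennreal_mult_top)
next
  case False
  obtain L where sm: "summable (\<lambda>n. (norm (L - partial_taylor f n \<xi>))\<^sup>2)"
    by (rule local_dirichlet_representation[OF f xi False])
  define G where "G = power_fun (quotient_coeff f \<xi> L)"
  note lq = local_quotient[OF f xi sm, folded G_def]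
  have Gh: "G holomorphic_on ball 0 1" using lq(1) by (simp add: hardy2_def)
  have df: "deriv f z = G z + (z - \<xi>) * deriv G z" if z: "norm z < 1" for z
  proof -
    have "deriv f z = deriv (\<lambda>z. L + (z - \<xi>) * G z) z"
    proof (rule complex_derivative_transform_within_open[of _ "ball 0 1"])
      show "f holomorphic_on ball 0 1" using f by (simp add: hardy2_def)
      show "(\<lambda>z. L + (z - \<xi>) * G z) holomorphic_on ball 0 1" by (intro holomorphic_intros Gh)
    qed (use z lq(3) in auto)
    also have "\<dots> = G z + (z - \<xi>) * deriv G z"
    proof (rule DERIV_imp_deriv)
      have "(G has_field_derivative deriv G z) (at z)"
        using Gh z by (intro holomorphic_derivI[of G "ball 0 1"]) auto
      then show "((\<lambda>z. L + (z - \<xi>) * G z) has_field_derivative G z + (z - \<xi>) * deriv G z) (at z)"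
        by (auto intro!: derivative_eq_intros)
    qed
    finally show ?thesis .
  qed
  let ?S = "\<Sum>n. ennreal ((norm (taylor_coeff G n))\<^sup>2)"
  have [measurable]: "(\<lambda>r. indicator {0..<1} r * norm (deriv G (of_real r * \<omega>))) \<in> borel_measurable borel"
    by (rule borel_measurable_ray_deriv[OF lq(1) w])
  define A where "A r = ennreal ((norm (G (of_real r * \<omega>)))\<^sup>2) * indicator {0..<1} r" for r :: real
  define B where "B r = ennreal (((1 - r) * norm (deriv G (of_real r * \<omega>)))\<^sup>2) * indicator {0..<1} r" for r :: real
  have Bm: "B \<in> borel_measurable lborel"
  proof -
    have "B = (\<lambda>r. ennreal (((1 - r) * (indicator {0..<1} r * norm (deriv G (of_real r * \<omega>))))\<^sup>2))"
      by (auto simp: B_def indicator_def)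
    then show ?thesis by simp
  qed
  have Am: "A \<in> borel_measurable lborel"
  proof -
    have "continuous_on (ball 0 1) G" using Gh by (rule holomorphic_on_imp_continuous_on)
    from continuous_on_ray[OF this w] have "continuous_on {0..<1} (\<lambda>r. (norm (G (of_real r * \<omega>)))\<^sup>2)"
      by (intro continuous_on_power continuous_on_norm)
    from borel_measurable_continuous_on_indicator[OF _ this]
    have "(\<lambda>r. indicator {0..<1} r *\<^sub>R (norm (G (of_real r * \<omega>)))\<^sup>2) \<in> borel_measurable borel" by simp
    moreover have "A = (\<lambda>r. ennreal (indicator {0..<1} r *\<^sub>R (norm (G (of_real r * \<omega>)))\<^sup>2))"
      by (auto simp: A_def indicator_def)
    ultimately show ?thesis by simp
  qed
  have "(\<integral>\<^sup>+r. ennreal ((1 - r) * ((1 - r\<^sup>2) / (norm (\<xi> - of_real r * \<omega>))\<^sup>2) * (norm (deriv f (of_real r * \<omega>)))\<^sup>2)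
      * indicator {0..<1} r \<partial>lborel) \<le> (\<integral>\<^sup>+r. 4 * A r + 4 * B r \<partial>lborel)"
  proof (rule nn_integral_mono)
    fix r :: real
    show "ennreal ((1 - r) * ((1 - r\<^sup>2) / (norm (\<xi> - of_real r * \<omega>))\<^sup>2) * (norm (deriv f (of_real r * \<omega>)))\<^sup>2)
      * indicator {0..<1} r \<le> 4 * A r + 4 * B r"
    proof (cases "r \<in> {0..<1}")
      case True
      then have r: "0 \<le> r" "r < 1" by auto
      define z where "z = of_real r * \<omega>"
      define D where "D = norm (\<xi> - z)"
      have z: "norm z < 1" using r w by (simp add: z_def norm_mult)
      have D: "1 - r \<le> D" unfolding D_def z_def by (rule norm_circle_minus_ray[OF xi w r(1)])
      then have D0: "0 < D" using r by linarith
      have df2: "(norm (deriv f z))\<^sup>2 \<le> 2 * (norm (G z))\<^sup>2 + 2 * D\<^sup>2 * (norm (deriv G z))\<^sup>2"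
        unfolding df[OF z] D_def norm_minus_commute[of \<xi> z] by (rule norm_add_mult_square_le)
      \<comment> \<open>Since \<open>1 + r \<le> 2\<close>, the kernel factor is at most
        \<open>2 * ((1 - r) / D)\<^sup>2\<close>; its denominator cancels the
        \<open>D\<^sup>2\<close> in front of the derivative of \<open>G\<close>.\<close>
      have k: "0 \<le> (1 - r) * ((1 - r\<^sup>2) / D\<^sup>2)" "(1 - r) * ((1 - r\<^sup>2) / D\<^sup>2) \<le> 2 * (1 - r)\<^sup>2 / D\<^sup>2"
      proof -
        have e: "1 - r\<^sup>2 = (1 - r) * (1 + r)" by (simp add: power2_eq_square algebra_simps)
        moreover have "(1 - r) * (1 + r) \<le> (1 - r) * 2" using r by (intro mult_left_mono) auto
        ultimately have "0 \<le> 1 - r\<^sup>2" "1 - r\<^sup>2 \<le> (1 - r) * 2" using r by auto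
        then show "0 \<le> (1 - r) * ((1 - r\<^sup>2) / D\<^sup>2)" using r by simp
        have "(1 - r) * (1 - r\<^sup>2) \<le> (1 - r) * ((1 - r) * 2)"
          using \<open>1 - r\<^sup>2 \<le> (1 - r) * 2\<close> r by (intro mult_left_mono) auto
        also have "\<dots> = 2 * (1 - r)\<^sup>2" unfolding power2_eq_square by (simp only: mult_ac)
        finally show "(1 - r) * ((1 - r\<^sup>2) / D\<^sup>2) \<le> 2 * (1 - r)\<^sup>2 / D\<^sup>2"
          unfolding times_divide_eq_right by (intro divide_right_mono) auto
      qed
      have "(1 - r) * ((1 - r\<^sup>2) / D\<^sup>2) * (norm (deriv f z))\<^sup>2
          \<le> (2 * (1 - r)\<^sup>2 / D\<^sup>2) * (2 * (norm (G z))\<^sup>2 + 2 * D\<^sup>2 * (norm (deriv G z))\<^sup>2)"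
        using k df2 by (intro mult_mono) auto
      also have "\<dots> = 4 * ((1 - r)\<^sup>2 / D\<^sup>2 * (norm (G z))\<^sup>2) + 4 * ((1 - r) * norm (deriv G z))\<^sup>2"
      proof -
        have "(2 * h\<^sup>2 / D\<^sup>2) * (2 * x\<^sup>2 + 2 * D\<^sup>2 * y\<^sup>2) = 4 * (h\<^sup>2 / D\<^sup>2 * x\<^sup>2) + 4 * (h * y)\<^sup>2" for h x y :: real
          using D0 by (simp add: power_mult_distrib field_simps)
        then show ?thesis .
      qed
      also have "(1 - r)\<^sup>2 / D\<^sup>2 * (norm (G z))\<^sup>2 \<le> 1 * (norm (G z))\<^sup>2"
      proof (rule mult_right_mono)
        have "(1 - r)\<^sup>2 \<le> D\<^sup>2" using D r by (intro power_mono) auto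
        then show "(1 - r)\<^sup>2 / D\<^sup>2 \<le> 1" using D0 by (simp add: divide_le_eq)
      qed simp
      finally have "(1 - r) * ((1 - r\<^sup>2) / D\<^sup>2) * (norm (deriv f z))\<^sup>2
          \<le> 4 * (norm (G z))\<^sup>2 + 4 * ((1 - r) * norm (deriv G z))\<^sup>2" by simp
      then have "ennreal ((1 - r) * ((1 - r\<^sup>2) / D\<^sup>2) * (norm (deriv f z))\<^sup>2)
          \<le> ennreal (4 * (norm (G z))\<^sup>2 + 4 * ((1 - r) * norm (deriv G z))\<^sup>2)" by (rule ennreal_leI)
      also have "\<dots> = 4 * ennreal ((norm (G z))\<^sup>2) + 4 * ennreal (((1 - r) * norm (deriv G z))\<^sup>2)"
        by (simp add: ennreal_mult)
      finally show ?thesis using True by (simp add: A_def B_def D_def z_def)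
    qed (simp add: A_def B_def)
  qed
  also have "\<dots> = 4 * (\<integral>\<^sup>+r. A r \<partial>lborel) + 4 * (\<integral>\<^sup>+r. B r \<partial>lborel)"
    using Am Bm by (simp add: nn_integral_add nn_integral_cmult)
  also have "\<dots> \<le> 4 * (8 * ?S) + 4 * (8 * ?S)"
    unfolding A_def B_def
    by (intro add_mono mult_left_mono hardy2_ray_square_integral hardy2_ray_deriv_square_integral lq(1) w) auto
  \<comment> \<open>The 64 collects 4 times 8 from each of the two terms. The factor
    \<open>2 * pi\<close> in the formula for the local integral is then estimated below by
    1.\<close>
  also have "\<dots> = 64 * ?S" by (simp add: mult.assoc[symmetric] distrib_right[symmetric])
  also have "?S = (\<Sum>n. ennreal ((norm (L - partial_taylor f n \<xi>))\<^sup>2))"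
    by (simp add: lq(2) norm_quotient_coeff xi)
  also have "64 * \<dots> \<le> 64 * local_dirichlet f \<xi>"
  proof (rule mult_left_mono)
    have "1 * (\<Sum>n. ennreal ((norm (L - partial_taylor f n \<xi>))\<^sup>2)) \<le> ennreal (2 * pi) * (\<Sum>n. ennreal ((norm (L - partial_taylor f n \<xi>))\<^sup>2))"
      using pi_gt3 by (intro mult_right_mono) (auto simp flip: ennreal_1)
    then show "(\<Sum>n. ennreal ((norm (L - partial_taylor f n \<xi>))\<^sup>2)) \<le> local_dirichlet f \<xi>"
      using local_dirichlet_summable[OF f xi sm] by simp
  qed simp
  finally show ?thesis .
qed

text \<open>The reciprocal of \<open>\<phi>\<close>. The summand \<open>(1 - r)\<^sup>2\<close>
  corresponds to the Hardy space part of the norm and keeps the weight positive on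
  \<open>[0, 1)\<close> even for the zero measure.\<close>

definition ray_weight :: "complex measure \<Rightarrow> complex \<Rightarrow> real \<Rightarrow> real" where
  "ray_weight \<mu> \<omega> r = (1 - r) * poisson \<mu> (of_real r * \<omega>) + (1 - r)\<^sup>2"

section \<open>The Poisson integral and the weight on a fixed radius\<close>

context
  fixes \<mu> :: "complex measure" and \<omega> :: complex
  assumes mu: "circle_measure \<mu>" and w: "norm \<omega> = 1"
begin

lemma measurable_circ_mu: "F \<in> borel_measurable circ \<Longrightarrow> F \<in> borel_measurable \<mu>"
  using measurable_cong_sets[OF sets_mu[OF mu] refl] by blast

lemma borel_measurable_ray_kernel:
  "(\<lambda>p. (norm (snd p - of_real (fst p) * \<omega>))\<^sup>2) \<in> borel_measurable (lborel \<Otimes>\<^sub>M \<mu>)"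
proof -
  have "(\<lambda>\<xi>. \<xi>) \<in> borel_measurable \<mu>"
    by (intro measurable_circ_mu measurable_circI continuous_intros)
  then have 1: "snd \<in> borel_measurable (lborel \<Otimes>\<^sub>M \<mu>)"
    using measurable_compose[OF measurable_snd, of "\<lambda>\<xi>. \<xi>" \<mu> borel lborel] by simp
  have 2: "fst \<in> borel_measurable (lborel \<Otimes>\<^sub>M \<mu>)"
    using measurable_fst[of lborel \<mu>] by simp
  have 3: "(\<lambda>p. complex_of_real (fst p)) \<in> borel_measurable (lborel \<Otimes>\<^sub>M \<mu>)"
    using measurable_compose[OF 2, of complex_of_real borel] by simp
  have "(\<lambda>p. snd p - of_real (fst p) * \<omega>) \<in> borel_measurable (lborel \<Otimes>\<^sub>M \<mu>)"
    by (intro borel_measurable_diff borel_measurable_times borel_measurable_const 1 3)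
  then show ?thesis by measurable
qed

lemma poisson_ray:
  "poisson \<mu> (of_real r * \<omega>) = (LINT \<xi>|\<mu>. (1 - r\<^sup>2) / (norm (\<xi> - of_real r * \<omega>))\<^sup>2)"
  by (simp add: poisson_def norm_mult w power_mult_distrib)

lemma borel_measurable_poisson_ray [measurable]:
  "(\<lambda>r. poisson \<mu> (of_real r * \<omega>)) \<in> borel_measurable borel"
proof -
  interpret finite_measure \<mu> using mu by (simp add: circle_measure_def)
  define N where "N p = (norm (snd p - complex_of_real (fst p) * \<omega>))\<^sup>2" for p
  have [measurable]: "N \<in> borel_measurable (lborel \<Otimes>\<^sub>M \<mu>)"
    unfolding N_def by (rule borel_measurable_ray_kernel)
  have [measurable]: "fst \<in> borel_measurable (lborel \<Otimes>\<^sub>M \<mu>)"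
    using measurable_fst[of lborel \<mu>] by simp
  have "(\<lambda>(r, \<xi>). (1 - r\<^sup>2) / (norm (\<xi> - of_real r * \<omega>))\<^sup>2) \<in> borel_measurable (lborel \<Otimes>\<^sub>M \<mu>)"
  proof -
    have "(\<lambda>p. (1 - (fst p)\<^sup>2) / N p) \<in> borel_measurable (lborel \<Otimes>\<^sub>M \<mu>)" by measurable
    then show ?thesis by (simp add: N_def case_prod_beta)
  qed
  from borel_measurable_lebesgue_integral[OF this] show ?thesis by (simp add: poisson_ray)
qed

lemma borel_measurable_ray_weight [measurable]: "ray_weight \<mu> \<omega> \<in> borel_measurable borel"
  unfolding ray_weight_def by measurable

lemma poisson_ray_kernel:
  assumes r: "0 \<le> r" "r < 1"
  shows "integrable \<mu> (\<lambda>\<xi>. (1 - r\<^sup>2) / (norm (\<xi> - of_real r * \<omega>))\<^sup>2)"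
    and "\<And>\<xi>. 0 \<le> (1 - r\<^sup>2) / (norm (\<xi> - of_real r * \<omega>))\<^sup>2"
    and "0 \<le> poisson \<mu> (of_real r * \<omega>)"
proof -
  interpret finite_measure \<mu> using mu by (simp add: circle_measure_def)
  have r2: "0 \<le> 1 - r\<^sup>2" using r by (simp add: abs_square_le_1)
  show nn: "0 \<le> (1 - r\<^sup>2) / (norm (\<xi> - of_real r * \<omega>))\<^sup>2" for \<xi> using r2 by simp
  show "0 \<le> poisson \<mu> (of_real r * \<omega>)" unfolding poisson_ray using nn by (intro integral_nonneg_AE AE_I2)
  show "integrable \<mu> (\<lambda>\<xi>. (1 - r\<^sup>2) / (norm (\<xi> - of_real r * \<omega>))\<^sup>2)"
  proof (rule integrable_const_bound[where B = "1 / (1 - r)\<^sup>2"])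
    show "AE \<xi> in \<mu>. norm ((1 - r\<^sup>2) / (norm (\<xi> - of_real r * \<omega>))\<^sup>2) \<le> 1 / (1 - r)\<^sup>2"
    proof (rule AE_I2)
      fix \<xi> assume "\<xi> \<in> space \<mu>"
      then have "1 - r \<le> norm (\<xi> - of_real r * \<omega>)"
        using r w by (intro norm_circle_minus_ray) (auto simp: space_mu[OF mu])
      then have "(1 - r)\<^sup>2 \<le> (norm (\<xi> - of_real r * \<omega>))\<^sup>2" using r by (intro power_mono) auto
      then have "(1 - r\<^sup>2) / (norm (\<xi> - of_real r * \<omega>))\<^sup>2 \<le> 1 / (1 - r)\<^sup>2"
        using r by (intro frac_le) auto
      then show "norm ((1 - r\<^sup>2) / (norm (\<xi> - of_real r * \<omega>))\<^sup>2) \<le> 1 / (1 - r)\<^sup>2"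
        using nn[of \<xi>] by simp
    qed
    have "\<xi> - of_real r * \<omega> \<noteq> 0" if "norm \<xi> = 1" for \<xi>
      using norm_circle_minus_ray[OF that w r(1)] r by auto
    then show "(\<lambda>\<xi>. (1 - r\<^sup>2) / (norm (\<xi> - of_real r * \<omega>))\<^sup>2) \<in> borel_measurable \<mu>"
      by (intro measurable_circ_mu measurable_circI continuous_intros) auto
  qed
qed

lemma ray_weight_ge:
  assumes "0 \<le> r" "r < 1"
  shows "(1 - r)\<^sup>2 \<le> ray_weight \<mu> \<omega> r" "(1 - r) * poisson \<mu> (of_real r * \<omega>) \<le> ray_weight \<mu> \<omega> r"
    "0 < ray_weight \<mu> \<omega> r"
  using poisson_ray_kernel(3)[OF assms] assms by (auto simp: ray_weight_def add_nonneg_pos)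

lemma ray_weight_inverse_integrable:
  assumes "0 \<le> \<rho>" "\<rho> < 1"
  shows "set_integrable lborel {0..\<rho>} (\<lambda>r. 1 / ray_weight \<mu> \<omega> r)"
    and "(LINT r:{0..\<rho>}|lborel. 1 / ray_weight \<mu> \<omega> r) = integral {0..\<rho>} (\<lambda>r. 1 / ray_weight \<mu> \<omega> r)"
    and "0 \<le> integral {0..\<rho>} (\<lambda>r. 1 / ray_weight \<mu> \<omega> r)"
proof -
  have b: "0 \<le> 1 / ray_weight \<mu> \<omega> r" "1 / ray_weight \<mu> \<omega> r \<le> 1 / (1 - \<rho>)\<^sup>2" if "r \<in> {0..\<rho>}" for r
  proof -
    have r: "0 \<le> r" "r < 1" "r \<le> \<rho>" using that assms by auto
    have "(1 - \<rho>)\<^sup>2 \<le> (1 - r)\<^sup>2" using r assms by (intro power_mono) auto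
    also note ray_weight_ge(1)[OF r(1,2)]
    finally show "1 / ray_weight \<mu> \<omega> r \<le> 1 / (1 - \<rho>)\<^sup>2" using assms ray_weight_ge(3)[OF r(1,2)] by (intro divide_left_mono mult_pos_pos) auto
    show "0 \<le> 1 / ray_weight \<mu> \<omega> r" using ray_weight_ge(3)[OF r(1,2)] by simp
  qed
  show i: "set_integrable lborel {0..\<rho>} (\<lambda>r. 1 / ray_weight \<mu> \<omega> r)"
    unfolding set_integrable_def
  proof (rule Bochner_Integration.integrable_bound)
    show "integrable lborel (\<lambda>r. indicator {0..\<rho>} r *\<^sub>R (1 / (1 - \<rho>)\<^sup>2))"
      using assms by (intro integrable_scaleR_left integrable_real_indicator) (auto simp: emeasure_lborel_Icc)
    show "(\<lambda>r. indicator {0..\<rho>} r *\<^sub>R (1 / ray_weight \<mu> \<omega> r)) \<in> borel_measurable lborel" by measurable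
    show "AE r in lborel. norm (indicator {0..\<rho>} r *\<^sub>R (1 / ray_weight \<mu> \<omega> r)) \<le> norm (indicator {0..\<rho>} r *\<^sub>R (1 / (1 - \<rho>)\<^sup>2))"
    proof (rule AE_I2)
      fix r show "norm (indicator {0..\<rho>} r *\<^sub>R (1 / ray_weight \<mu> \<omega> r)) \<le> norm (indicator {0..\<rho>} r *\<^sub>R (1 / (1 - \<rho>)\<^sup>2))"
        using b[of r] by (cases "r \<in> {0..\<rho>}") (auto simp: abs_of_nonneg)
    qed
  qed
  show e: "(LINT r:{0..\<rho>}|lborel. 1 / ray_weight \<mu> \<omega> r) = integral {0..\<rho>} (\<lambda>r. 1 / ray_weight \<mu> \<omega> r)"
    by (rule set_borel_integral_eq_integral(2)[OF i])
  show "0 \<le> integral {0..\<rho>} (\<lambda>r. 1 / ray_weight \<mu> \<omega> r)"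
    using b set_borel_integral_eq_integral(1)[OF i] by (intro integral_nonneg) auto
qed

text \<open>Tonelli's theorem integrates the point mass estimate against \<open>\<mu>\<close>, which
  restores the Poisson integral; the summand \<open>(1 - r)\<^sup>2\<close> is handled by
  \<open>hardy2_ray_deriv_square_integral\<close>. The constant is 64 times the
  \<open>2 * pi\<close> in the normalization of \<open>dirichlet_integral\<close>.\<close>

lemma poisson_ray_deriv_bound:
  assumes f: "f \<in> dirichlet_space \<mu>"
  shows "(\<integral>\<^sup>+r. ennreal (ray_weight \<mu> \<omega> r * (norm (deriv f (of_real r * \<omega>)))\<^sup>2) * indicator {0..<1} r \<partial>lborel)
    \<le> ennreal (128 * pi * dirichlet_normsq \<mu> f)"
proof -
  interpret m: finite_measure \<mu> using mu by (simp add: circle_measure_def)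
  interpret pair_sigma_finite lborel \<mu> by unfold_locales
  have fH: "f \<in> hardy2" by (rule dirichlet_space_hardy2[OF mu f])
  define d where "d r = indicator {0..<1} r * norm (deriv f (of_real r * \<omega>))" for r
  have dm[measurable]: "d \<in> borel_measurable borel" unfolding d_def by (rule borel_measurable_ray_deriv[OF fH w])
  define K where "K r \<xi> = ennreal ((1 - r) * ((1 - r\<^sup>2) / (norm (\<xi> - of_real r * \<omega>))\<^sup>2) * (norm (deriv f (of_real r * \<omega>)))\<^sup>2)
      * indicator {0..<1} r" for r \<xi>
  have K: "K = (\<lambda>r \<xi>. ennreal ((1 - r) * ((1 - r\<^sup>2) / (norm (\<xi> - of_real r * \<omega>))\<^sup>2) * (d r)\<^sup>2))"
    by (intro ext) (auto simp: K_def d_def indicator_def)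
  define N where "N p = (norm (snd p - complex_of_real (fst p) * \<omega>))\<^sup>2" for p
  have [measurable]: "N \<in> borel_measurable (lborel \<Otimes>\<^sub>M \<mu>)"
    unfolding N_def by (rule borel_measurable_ray_kernel)
  have [measurable]: "fst \<in> borel_measurable (lborel \<Otimes>\<^sub>M \<mu>)"
    using measurable_fst[of lborel \<mu>] by simp
  have Km: "(\<lambda>(r, \<xi>). K r \<xi>) \<in> borel_measurable (lborel \<Otimes>\<^sub>M \<mu>)"
  proof -
    have "(\<lambda>p. ennreal ((1 - fst p) * ((1 - (fst p)\<^sup>2) / N p) * (d (fst p))\<^sup>2)) \<in> borel_measurable (lborel \<Otimes>\<^sub>M \<mu>)"
      by measurable
    then show ?thesis by (simp add: K N_def case_prod_beta)
  qed
  have "(\<integral>\<^sup>+r. ennreal (ray_weight \<mu> \<omega> r * (norm (deriv f (of_real r * \<omega>)))\<^sup>2) * indicator {0..<1} r \<partial>lborel)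
      = (\<integral>\<^sup>+r. (\<integral>\<^sup>+\<xi>. K r \<xi> \<partial>\<mu>) + ennreal (((1 - r) * norm (deriv f (of_real r * \<omega>)))\<^sup>2) * indicator {0..<1} r \<partial>lborel)"
  proof (rule nn_integral_cong)
    fix r :: real
    show "ennreal (ray_weight \<mu> \<omega> r * (norm (deriv f (of_real r * \<omega>)))\<^sup>2) * indicator {0..<1} r
      = (\<integral>\<^sup>+\<xi>. K r \<xi> \<partial>\<mu>) + ennreal (((1 - r) * norm (deriv f (of_real r * \<omega>)))\<^sup>2) * indicator {0..<1} r"
    proof (cases "r \<in> {0..<1}")
      case True
      then have r: "0 \<le> r" "r < 1" by auto
      let ?D = "(norm (deriv f (of_real r * \<omega>)))\<^sup>2"
      have "(\<integral>\<^sup>+\<xi>. K r \<xi> \<partial>\<mu>) = (\<integral>\<^sup>+\<xi>. ennreal ((1 - r) * ?D * ((1 - r\<^sup>2) / (norm (\<xi> - of_real r * \<omega>))\<^sup>2)) \<partial>\<mu>)"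
        using True by (intro nn_integral_cong) (simp add: K_def mult_ac)
      also have "\<dots> = ennreal (LINT \<xi>|\<mu>. (1 - r) * ?D * ((1 - r\<^sup>2) / (norm (\<xi> - of_real r * \<omega>))\<^sup>2))"
        using r poisson_ray_kernel(2)[OF r]
        by (intro nn_integral_eq_integral integrable_mult_right poisson_ray_kernel(1)[OF r] AE_I2 mult_nonneg_nonneg) auto
      also have "(LINT \<xi>|\<mu>. (1 - r) * ?D * ((1 - r\<^sup>2) / (norm (\<xi> - of_real r * \<omega>))\<^sup>2)) = (1 - r) * ?D * poisson \<mu> (of_real r * \<omega>)"
        unfolding poisson_ray by (rule integral_mult_right_zero)
      finally have "(\<integral>\<^sup>+\<xi>. K r \<xi> \<partial>\<mu>) = ennreal ((1 - r) * ?D * poisson \<mu> (of_real r * \<omega>))" .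
      moreover have "ray_weight \<mu> \<omega> r * ?D = (1 - r) * ?D * poisson \<mu> (of_real r * \<omega>) + ((1 - r) * norm (deriv f (of_real r * \<omega>)))\<^sup>2"
        unfolding ray_weight_def power_mult_distrib by (simp only: distrib_right) (simp only: mult_ac)
      ultimately show ?thesis
        using True r poisson_ray_kernel(3)[OF r] by (simp add: ennreal_plus)
    qed (simp add: K_def)
  qed
  also have "\<dots> = (\<integral>\<^sup>+r. (\<integral>\<^sup>+\<xi>. K r \<xi> \<partial>\<mu>) \<partial>lborel) + (\<integral>\<^sup>+r. ennreal (((1 - r) * norm (deriv f (of_real r * \<omega>)))\<^sup>2) * indicator {0..<1} r \<partial>lborel)"
  proof (rule nn_integral_add)
    show "(\<lambda>r. \<integral>\<^sup>+\<xi>. K r \<xi> \<partial>\<mu>) \<in> borel_measurable lborel"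
      using m.borel_measurable_nn_integral_fst[OF Km] by simp
    have "(\<lambda>r. ennreal (((1 - r) * norm (deriv f (of_real r * \<omega>)))\<^sup>2) * indicator {0..<1} r) = (\<lambda>r. ennreal (((1 - r) * d r)\<^sup>2))"
      by (auto simp: d_def indicator_def)
    then show "(\<lambda>r. ennreal (((1 - r) * norm (deriv f (of_real r * \<omega>)))\<^sup>2) * indicator {0..<1} r) \<in> borel_measurable lborel"
      by simp
  qed
  also have "(\<integral>\<^sup>+r. (\<integral>\<^sup>+\<xi>. K r \<xi> \<partial>\<mu>) \<partial>lborel) = (\<integral>\<^sup>+\<xi>. (\<integral>\<^sup>+r. K r \<xi> \<partial>lborel) \<partial>\<mu>)"
    using Fubini'[OF Km] by simp
  also have "\<dots> + (\<integral>\<^sup>+r. ennreal (((1 - r) * norm (deriv f (of_real r * \<omega>)))\<^sup>2) * indicator {0..<1} r \<partial>lborel)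
      \<le> (\<integral>\<^sup>+\<xi>. 64 * local_dirichlet f \<xi> \<partial>\<mu>) + 8 * (\<Sum>n. ennreal ((norm (taylor_coeff f n))\<^sup>2))"
    unfolding K_def
    by (intro add_mono nn_integral_mono local_dirichlet_ray_bound hardy2_ray_deriv_square_integral fH w)
      (simp add: space_mu[OF mu])
  also have "(\<integral>\<^sup>+\<xi>. 64 * local_dirichlet f \<xi> \<partial>\<mu>) = ennreal (128 * pi) * dirichlet_integral \<mu> f"
  proof -
    have "ennreal (128 * pi) * ennreal (1 / (2*pi)) = 64" by (simp flip: ennreal_mult)
    then show ?thesis
      using borel_measurable_local_dirichlet[OF mu fH]
      by (simp add: dirichlet_integral_def nn_integral_cmult mult.assoc[symmetric])
  qed
  also have "\<dots> = ennreal (128 * pi * enn2real (dirichlet_integral \<mu> f))"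
    by (subst dirichlet_integral_le_normsq(1)[OF mu f]) (simp add: ennreal_mult)
  also have "8 * (\<Sum>n. ennreal ((norm (taylor_coeff f n))\<^sup>2)) = ennreal (8 * (\<Sum>n. (norm (taylor_coeff f n))\<^sup>2))"
    using hardy2_summable[OF fH] by (simp add: suminf_ennreal2 ennreal_mult suminf_nonneg)
  also have "ennreal (128 * pi * enn2real (dirichlet_integral \<mu> f)) + \<dots>
      = ennreal (128 * pi * enn2real (dirichlet_integral \<mu> f) + 8 * (\<Sum>n. (norm (taylor_coeff f n))\<^sup>2))"
    using hardy2_summable[OF fH] by (simp add: suminf_nonneg)
  \<comment> \<open>The constant 8 of the Hardy part is raised to \<open>128 * pi\<close> so that
    the two parts combine into the full norm.\<close>
  also have "\<dots> \<le> ennreal (128 * pi * dirichlet_normsq \<mu> f)"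
  proof (rule ennreal_leI)
    have "8 * (\<Sum>n. (norm (taylor_coeff f n))\<^sup>2) \<le> 128 * pi * (\<Sum>n. (norm (taylor_coeff f n))\<^sup>2)"
      using pi_gt3 hardy2_summable[OF fH] by (intro mult_right_mono suminf_nonneg) auto
    then show "128 * pi * enn2real (dirichlet_integral \<mu> f) + 8 * (\<Sum>n. (norm (taylor_coeff f n))\<^sup>2) \<le> 128 * pi * dirichlet_normsq \<mu> f"
      by (simp add: dirichlet_normsq_def algebra_simps)
  qed
  finally show ?thesis .
qed

lemma dirichlet_upper_bound:
  assumes f: "f \<in> dirichlet_space \<mu>" and rho: "0 \<le> \<rho>" "\<rho> < 1"
  defines "I \<equiv> integral {0..\<rho>} (\<lambda>r. 1 / ray_weight \<mu> \<omega> r)"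
  shows "(norm (f (of_real \<rho> * \<omega>)))\<^sup>2 \<le> (2 + 64 * pi)\<^sup>2 * (1 + I) * dirichlet_normsq \<mu> f"
proof -
  let ?Q = "dirichlet_normsq \<mu> f"
  have fH: "f \<in> hardy2" by (rule dirichlet_space_hardy2[OF mu f])
  then have hol: "f holomorphic_on ball 0 1" by (simp add: hardy2_def)
  have I0: "0 \<le> I" unfolding I_def by (rule ray_weight_inverse_integrable(3)[OF rho])
  have Q0: "0 \<le> ?Q" by (rule dirichlet_integral_le_normsq(4)[OF mu f])
  have rw: "norm (complex_of_real \<rho> * \<omega>) < 1" using rho w by (simp add: norm_mult)
  show ?thesis
  \<comment> \<open>Separated because the balancing factor \<open>l\<close> below must be
    positive.\<close>
  proof (cases "?Q = 0")
    case True
    then have "(norm (f (of_real \<rho> * \<omega>)))\<^sup>2 \<le> 0" using dirichlet_pointwise_bound[OF mu f rw] by simp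
    then show ?thesis using True by simp
  next
    case False
    then have Q: "0 < ?Q" using Q0 by simp
    \<comment> \<open>Cauchy-Schwarz is carried out as
      \<open>D \<le> (l / W + W D\<^sup>2 / l) / 2\<close> with the balancing choice
      \<open>l = sqrt (?Q / (1 + I))\<close>. Then \<open>?Q / l = s\<close> and
      \<open>l * I \<le> s\<close>; \<open>1 + I\<close> instead of \<open>I\<close> keeps
      \<open>l\<close> defined when \<open>I = 0\<close> and leaves room for
      \<open>f 0\<close>.\<close>
    define s where "s = sqrt (?Q * (1 + I))"
    define l where "l = s / (1 + I)"
    have s: "0 < s" "s\<^sup>2 = ?Q * (1 + I)" using Q I0 by (auto simp: s_def)
    have l: "0 < l" using s I0 by (simp add: l_def)
    define D where "D r = norm (deriv f (of_real r * \<omega>))" for r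
    define W where "W = ray_weight \<mu> \<omega>"
    have cD: "continuous_on {0..\<rho>} D"
    proof -
      have "deriv f holomorphic_on ball 0 1" using hol by (intro holomorphic_deriv) auto
      from continuous_on_ray[OF holomorphic_on_imp_continuous_on[OF this] w]
      have "continuous_on {0..<1} D" unfolding D_def by (rule continuous_on_norm)
      then show ?thesis by (rule continuous_on_subset) (use rho in auto)
    qed
    have iD: "set_integrable lborel {0..\<rho>} D" by (rule borel_integrable_atLeastAtMost'[OF cD])
    have Dm: "(\<lambda>r. indicator {0..\<rho>} r *\<^sub>R D r) \<in> borel_measurable lborel"
      using iD unfolding set_integrable_def by (rule borel_measurable_integrable)
    have Wm: "W \<in> borel_measurable lborel" unfolding W_def by simp
    have E_le: "(\<integral>\<^sup>+r. ennreal (indicator {0..\<rho>} r *\<^sub>R (W r * (D r)\<^sup>2)) \<partial>lborel) \<le> ennreal (128 * pi * ?Q)"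
    proof (rule order_trans[OF _ poisson_ray_deriv_bound[OF f]], rule nn_integral_mono)
      fix r show "ennreal (indicator {0..\<rho>} r *\<^sub>R (W r * (D r)\<^sup>2)) \<le>
          ennreal (ray_weight \<mu> \<omega> r * (norm (deriv f (of_real r * \<omega>)))\<^sup>2) * indicator {0..<1} r"
        using rho by (auto simp: indicator_def W_def D_def)
    qed
    have W0: "0 < W r" if "r \<in> {0..\<rho>}" for r unfolding W_def using that rho by (intro ray_weight_ge) auto
    have iE: "set_integrable lborel {0..\<rho>} (\<lambda>r. W r * (D r)\<^sup>2)"
      unfolding set_integrable_def
    proof (rule integrableI_bounded)
      have "(\<lambda>r. indicator {0..\<rho>} r *\<^sub>R (W r * (D r)\<^sup>2)) = (\<lambda>r. W r * (indicator {0..\<rho>} r *\<^sub>R D r)\<^sup>2)"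
        by (auto simp: indicator_def)
      then show "(\<lambda>r. indicator {0..\<rho>} r *\<^sub>R (W r * (D r)\<^sup>2)) \<in> borel_measurable lborel"
        using Dm Wm by simp
      have "(\<integral>\<^sup>+r. ennreal (norm (indicator {0..\<rho>} r *\<^sub>R (W r * (D r)\<^sup>2))) \<partial>lborel) = (\<integral>\<^sup>+r. ennreal (indicator {0..\<rho>} r *\<^sub>R (W r * (D r)\<^sup>2)) \<partial>lborel)"
      proof (rule nn_integral_cong)
        fix r show "ennreal (norm (indicator {0..\<rho>} r *\<^sub>R (W r * (D r)\<^sup>2))) = ennreal (indicator {0..\<rho>} r *\<^sub>R (W r * (D r)\<^sup>2))"
          using W0[of r] by (cases "r \<in> {0..\<rho>}") (auto simp: abs_mult)
      qed
      then show "(\<integral>\<^sup>+r. ennreal (norm (indicator {0..\<rho>} r *\<^sub>R (W r * (D r)\<^sup>2))) \<partial>lborel) < \<infinity>"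
        using E_le by (auto intro: le_less_trans)
    qed
    have E: "(LINT r:{0..\<rho>}|lborel. W r * (D r)\<^sup>2) \<le> 128 * pi * ?Q"
    proof -
      have "ennreal (LINT r:{0..\<rho>}|lborel. W r * (D r)\<^sup>2) = (\<integral>\<^sup>+r. ennreal (indicator {0..\<rho>} r *\<^sub>R (W r * (D r)\<^sup>2)) \<partial>lborel)"
        unfolding set_lebesgue_integral_def
      proof (rule nn_integral_eq_integral[symmetric])
        show "AE r in lborel. 0 \<le> indicator {0..\<rho>} r *\<^sub>R (W r * (D r)\<^sup>2)"
        proof (rule AE_I2)
          fix r show "0 \<le> indicator {0..\<rho>} r *\<^sub>R (W r * (D r)\<^sup>2)"
            using W0[of r] by (cases "r \<in> {0..\<rho>}") auto
        qed
      qed (use iE in \<open>simp add: set_integrable_def\<close>)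
      then have "ennreal (LINT r:{0..\<rho>}|lborel. W r * (D r)\<^sup>2) \<le> ennreal (128 * pi * ?Q)"
        using E_le by (simp only:)
      then show ?thesis by (rule ennreal_le_iff[THEN iffD1, rotated]) (use Q in simp)
    qed
    note iW = ray_weight_inverse_integrable[OF rho, folded W_def]
    have X: "(LINT r:{0..\<rho>}|lborel. D r) \<le> (l * I + 128 * pi * ?Q / l) / 2"
    proof -
      have "(LINT r:{0..\<rho>}|lborel. D r) \<le> (LINT r:{0..\<rho>}|lborel. l / 2 * (1 / W r) + 1 / (2 * l) * (W r * (D r)\<^sup>2))"
      proof (rule set_integral_mono[OF iD])
        show "set_integrable lborel {0..\<rho>} (\<lambda>r. l / 2 * (1 / W r) + 1 / (2 * l) * (W r * (D r)\<^sup>2))"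
          by (intro set_integral_add set_integrable_mult_right iW(1) iE)
        fix r assume "r \<in> {0..\<rho>}"
        then have Wr: "0 < W r" by (rule W0)
        have "2 * l * (W r * D r) \<le> l\<^sup>2 + (W r * D r)\<^sup>2"
          using sum_squares_bound[of l "W r * D r"] by simp
        then have "2 * l * (W r * D r) / (2 * l * W r) \<le> (l\<^sup>2 + (W r * D r)\<^sup>2) / (2 * l * W r)"
          using l Wr by (intro divide_right_mono) auto
        then show "D r \<le> l / 2 * (1 / W r) + 1 / (2 * l) * (W r * (D r)\<^sup>2)"
          using l Wr by (simp add: add_divide_distrib power2_eq_square mult_ac)
      qed
      also have "\<dots> = l / 2 * (LINT r:{0..\<rho>}|lborel. 1 / W r) + 1 / (2 * l) * (LINT r:{0..\<rho>}|lborel. W r * (D r)\<^sup>2)"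
        unfolding set_integral_add(2)[OF set_integrable_mult_right[OF iW(1)] set_integrable_mult_right[OF iE]]
        by (simp only: set_integral_mult_right)
      also have "\<dots> \<le> l / 2 * I + 1 / (2 * l) * (128 * pi * ?Q)"
        using l E iW(2) by (intro add_mono mult_left_mono) (auto simp: I_def W_def)
      finally show ?thesis by (simp add: field_simps)
    qed
    have ftc: "norm (f (of_real \<rho> * \<omega>) - f 0) \<le> (LINT r:{0..\<rho>}|lborel. D r)"
    proof -
      have has_integral_fd: "((\<lambda>r. deriv f (of_real r * \<omega>) * \<omega>) has_integral (f (of_real \<rho> * \<omega>) - f (of_real 0 * \<omega>))) {0..\<rho>}"
      proof (rule fundamental_theorem_of_calculus[OF rho(1)])
        fix r assume "r \<in> {0..\<rho>}"
        then have r: "of_real r * \<omega> \<in> ball 0 1" using rho w by (auto simp: norm_mult)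
        have "(f has_field_derivative deriv f (of_real r * \<omega>)) (at (of_real r * \<omega>))"
          using hol r by (intro holomorphic_derivI[of f "ball 0 1"]) auto
        moreover have "((\<lambda>z. z * \<omega>) has_field_derivative \<omega>) (at (complex_of_real r))"
          by (auto intro!: derivative_eq_intros)
        ultimately have "((\<lambda>z. f (z * \<omega>)) has_field_derivative deriv f (of_real r * \<omega>) * \<omega>) (at (complex_of_real r))"
          by (rule DERIV_chain2)
        then show "((\<lambda>r. f (of_real r * \<omega>)) has_vector_derivative deriv f (of_real r * \<omega>) * \<omega>) (at r within {0..\<rho>})"
          by (rule has_vector_derivative_real_field)
      qed
      moreover have has_integral_D: "(D has_integral (LINT r:{0..\<rho>}|lborel. D r)) {0..\<rho>}"
        using set_borel_integral_eq_integral[OF iD] by (simp add: has_integral_integral)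
      ultimately have "norm (integral {0..\<rho>} (\<lambda>r. deriv f (of_real r * \<omega>) * \<omega>)) \<le> integral {0..\<rho>} D"
        by (intro integral_norm_bound_integral) (auto simp: D_def norm_mult w dest: has_integral_integrable)
      then show ?thesis
        unfolding integral_unique[OF has_integral_fd] integral_unique[OF has_integral_D] by simp
    qed
    have f0: "norm (f 0) \<le> s"
    proof -
      have "(norm (f 0))\<^sup>2 \<le> ?Q * 1" using dirichlet_pointwise_bound[OF mu f, of 0] by simp
      also have "?Q * 1 \<le> ?Q * (1 + I)" using Q0 I0 by (intro mult_left_mono) auto
      also have "\<dots> = s\<^sup>2" by (rule s(2)[symmetric])
      finally show ?thesis by (rule power2_le_imp_le) (use s(1) in simp)
    qed
    have lI: "l * I \<le> s" using s I0 by (simp add: l_def field_simps)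
    have Ql: "?Q / l = s" using s I0 by (simp add: l_def field_simps power2_eq_square)
    have "norm (f (of_real \<rho> * \<omega>)) \<le> norm (f 0) + norm (f (of_real \<rho> * \<omega>) - f 0)"
      using norm_triangle_sub[of "f (of_real \<rho> * \<omega>)" "f 0"] by simp
    \<comment> \<open>The sum is \<open>(3/2 + 64 * pi) * s\<close>; rounding up and squaring gives
      the constant of the theorem.\<close>
    also have "\<dots> \<le> s + (s + 128 * pi * s) / 2"
    proof (intro add_mono f0 order_trans[OF ftc] order_trans[OF X] divide_right_mono)
      show "128 * pi * ?Q / l \<le> 128 * pi * s" unfolding Ql[symmetric] by simp
    qed (use lI in auto)
    also have "\<dots> \<le> (2 + 64 * pi) * s" using s by (simp add: algebra_simps)
    finally have "(norm (f (of_real \<rho> * \<omega>)))\<^sup>2 \<le> ((2 + 64 * pi) * s)\<^sup>2" by (intro power_mono) auto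
    then show ?thesis by (simp add: power_mult_distrib s mult_ac)
  qed
qed

end

section \<open>The lower bound\<close>

lemma integrable_bounded_support:
  fixes g :: "real \<Rightarrow> 'b :: {banach, second_countable_topology}"
  assumes g: "g \<in> borel_measurable borel" and B: "\<And>r. norm (g r) \<le> indicator {0..\<rho>} r * B" and rho: "0 \<le> \<rho>"
  shows "integrable lborel g"
proof (rule Bochner_Integration.integrable_bound)
  show "integrable lborel (\<lambda>r. indicator {0..\<rho>} r * B)"
    using rho by (intro integrable_mult_left integrable_real_indicator) (auto simp: emeasure_lborel_Icc)
  show "AE r in lborel. norm (g r) \<le> norm (indicator {0..\<rho>} r * B)"
    using B by (intro AE_I2) (auto intro: order_trans[OF _ abs_ge_self])
qed (use g in simp)

context
  fixes \<mu> :: "complex measure" and \<omega> :: complex and \<rho> :: real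
  assumes mu: "circle_measure \<mu>" and w: "norm \<omega> = 1" and rho: "0 \<le> \<rho>" "\<rho> < 1"
begin

text \<open>The test function is \<open>(\<integral> test_density r / (1 - r cnj \<omega> w) dr)\<close> as a function of \<open>w\<close>; its
  coefficients are moments, to which the dual form of Hilbert's inequality applies.\<close>

definition test_density :: "real \<Rightarrow> real" where
  "test_density r = indicator {0..\<rho>} r * ((1 - r) / ray_weight \<mu> \<omega> r)"

definition test_moment :: "nat \<Rightarrow> real" where
  "test_moment n = (LINT r|lborel. test_density r * r ^ n)"

definition test_fun :: "complex \<Rightarrow> complex" where
  "test_fun = power_fun (\<lambda>n. cnj \<omega> ^ n * of_real (test_moment n))"

abbreviation "ray_integral \<equiv> integral {0..\<rho>} (\<lambda>r. 1 / ray_weight \<mu> \<omega> r)"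

lemma weight_ge:
  assumes "r \<in> {0..\<rho>}"
  shows "0 < ray_weight \<mu> \<omega> r" "(1 - r)\<^sup>2 \<le> ray_weight \<mu> \<omega> r"
    "(1 - r) * poisson \<mu> (of_real r * \<omega>) \<le> ray_weight \<mu> \<omega> r" "0 \<le> poisson \<mu> (of_real r * \<omega>)"
  using ray_weight_ge[OF mu w, of r] poisson_ray_kernel(3)[OF mu w, of r] assms rho by auto

lemma borel_measurable_test_density [measurable]: "test_density \<in> borel_measurable borel"
proof -
  have [measurable]: "ray_weight \<mu> \<omega> \<in> borel_measurable borel" by (rule borel_measurable_ray_weight[OF mu w])
  show ?thesis unfolding test_density_def[abs_def] by measurable
qed

lemma test_density_nonneg: "0 \<le> test_density r"
  using weight_ge(1)[of r] rho by (cases "r \<in> {0..\<rho>}") (auto simp: test_density_def)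

text \<open>A crude bound that blows up as \<open>\<rho>\<close> tends to 1. It serves integrability
  only; the uniform estimates go through the weight itself.\<close>

lemma test_density_le: "test_density r \<le> indicator {0..\<rho>} r * (1 / (1 - \<rho>))"
proof (cases "r \<in> {0..\<rho>}")
  case True
  have "(1 - r) / ray_weight \<mu> \<omega> r \<le> (1 - r) / (1 - r)\<^sup>2"
    using True rho weight_ge[OF True] by (intro divide_left_mono mult_pos_pos) auto
  also have "\<dots> = 1 / (1 - r)" by (simp add: power2_eq_square)
  also have "\<dots> \<le> 1 / (1 - \<rho>)" using True rho by (intro divide_left_mono) auto
  finally show ?thesis using True by (simp add: test_density_def)
qed (simp add: test_density_def)

text \<open>This uses the summand \<open>(1 - r)\<^sup>2\<close> of the weight and is responsible
  for the Hardy norm of the test function.\<close>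

lemma test_density_sq_le: "(test_density r)\<^sup>2 \<le> indicator {0..\<rho>} r * (1 / ray_weight \<mu> \<omega> r)"
proof (cases "r \<in> {0..\<rho>}")
  case True
  note W = weight_ge[OF True]
  have "((1 - r) / ray_weight \<mu> \<omega> r)\<^sup>2 = (1 - r)\<^sup>2 / (ray_weight \<mu> \<omega> r)\<^sup>2" by (simp add: power_divide)
  also have "\<dots> \<le> ray_weight \<mu> \<omega> r / (ray_weight \<mu> \<omega> r)\<^sup>2" using W by (intro divide_right_mono) auto
  also have "\<dots> = 1 / ray_weight \<mu> \<omega> r" using W by (simp add: power2_eq_square)
  finally show ?thesis using True by (simp add: test_density_def)
qed (simp add: test_density_def)

lemma integrable_test_density_mult:
  fixes g :: "real \<Rightarrow> 'b :: {banach, second_countable_topology}"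
  assumes [measurable]: "g \<in> borel_measurable borel" and B: "\<And>r. r \<in> {0..\<rho>} \<Longrightarrow> norm (g r) \<le> B"
  shows "integrable lborel (\<lambda>r. test_density r *\<^sub>R g r)"
proof (rule integrable_bounded_support[where \<rho> = \<rho> and B = "1 / (1 - \<rho>) * B"])
  show "norm (test_density r *\<^sub>R g r) \<le> indicator {0..\<rho>} r * (1 / (1 - \<rho>) * B)" for r
  proof (cases "r \<in> {0..\<rho>}")
    case True
    have "test_density r * norm (g r) \<le> (1 / (1 - \<rho>)) * B"
      using test_density_le[of r] True rho B[OF True] test_density_nonneg by (intro mult_mono) auto
    then show ?thesis using True test_density_nonneg[of r] by simp
  qed (simp add: test_density_def)
qed (use rho in simp_all)

lemma integrable_test_moment: "integrable lborel (\<lambda>r. test_density r * r ^ n)"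
  using integrable_test_density_mult[of "\<lambda>r. r ^ n" 1] rho by (auto simp: power_le_one)

lemma test_density_power_nonneg: "0 \<le> test_density r * r ^ n"
proof (cases "r \<in> {0..\<rho>}")
  case True
  then show ?thesis by (intro mult_nonneg_nonneg test_density_nonneg) auto
qed (simp add: test_density_def)

lemma test_moment_nonneg: "0 \<le> test_moment n"
  unfolding test_moment_def
  by (intro integral_nonneg_AE AE_I2 test_density_power_nonneg)

lemma ray_integral_lborel:
  "integrable lborel (\<lambda>r. indicator {0..\<rho>} r * (1 / ray_weight \<mu> \<omega> r))"
  "(LINT r|lborel. indicator {0..\<rho>} r * (1 / ray_weight \<mu> \<omega> r)) = ray_integral"
  "0 \<le> ray_integral"
  using ray_weight_inverse_integrable[OF mu w rho]
  by (simp_all add: set_integrable_def set_lebesgue_integral_def)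

lemma integral_test_density_sq: "(LINT r|lborel. (test_density r)\<^sup>2) \<le> ray_integral"
  unfolding ray_integral_lborel(2)[symmetric]
proof (rule integral_mono)
  show "integrable lborel (\<lambda>r. (test_density r)\<^sup>2)"
  proof -
    have "norm (test_density r) \<le> 1 / (1 - \<rho>)" if "r \<in> {0..\<rho>}" for r
      using test_density_le[of r] test_density_nonneg[of r] that by simp
    from integrable_test_density_mult[OF _ this] show ?thesis by (simp add: power2_eq_square)
  qed
qed (rule ray_integral_lborel(1) test_density_sq_le)+

text \<open>The dual Hilbert inequality with a spare factor: \<open>g = 1\<close> gives the Hardy
  norm of the test function, and \<open>g r = 1 / |\<xi> - r \<omega>|\<close> its local Dirichlet
  integral at \<open>\<xi>\<close>.\<close>

lemma suminf_test_moments: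
  assumes g[measurable]: "g \<in> borel_measurable borel" and B: "\<And>r. r \<in> {0..\<rho>} \<Longrightarrow> g r \<le> B" and g0: "\<And>r. 0 \<le> g r"
  shows "(\<Sum>n. ennreal ((LINT r|lborel. test_density r * g r * r ^ n)\<^sup>2)) \<le> ennreal (8 * (LINT r|lborel. (test_density r * g r)\<^sup>2))"
proof -
  let ?e = "\<lambda>n r. indicator {0..1} r * r ^ n :: real"
  have eq: "test_density r * g r * ?e n r = test_density r * g r * r ^ n" for r n
    using rho by (auto simp: test_density_def indicator_def)
  have "(\<Sum>n. ennreal ((LINT r|lborel. test_density r * g r * ?e n r)\<^sup>2)) \<le> ennreal (8 * (LINT r|lborel. (test_density r * g r)\<^sup>2))"
  proof (rule suminf_moments_le)
    show "(\<integral>\<^sup>+r. ennreal (?e n r * ?e m r) \<partial>lborel) \<le> ennreal (1 / (real n + real m + 1))" for n m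
      by (rule monomials_gram)
    show "integrable lborel (\<lambda>r. (test_density r * g r)\<^sup>2)"
    proof -
      have "norm (g r * (test_density r * g r)) \<le> B * (1 / (1 - \<rho>) * B)" if "r \<in> {0..\<rho>}" for r
        unfolding norm_mult using B[OF that] g0[of r] test_density_le[of r] test_density_nonneg[of r] that rho
        by (intro mult_mono) auto
      from integrable_test_density_mult[OF _ this]
      show ?thesis by (simp add: power2_eq_square mult_ac)
    qed
    show "integrable lborel (\<lambda>r. test_density r * g r * ?e n r)" for n
    proof -
      have "norm (g r * ?e n r) \<le> B * 1" if "r \<in> {0..\<rho>}" for r
        unfolding norm_mult using B[OF that] g0[of r] that rho
        by (intro mult_mono) (auto simp: power_le_one indicator_def)
      from integrable_test_density_mult[OF _ this]
      show ?thesis by (simp add: mult.assoc)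
    qed
  qed (auto simp: test_density_nonneg g0 indicator_def)
  then show ?thesis by (simp only: eq)
qed

lemma summable_test_moments:
  "summable (\<lambda>n. (test_moment n)\<^sup>2)" "(\<Sum>n. (test_moment n)\<^sup>2) \<le> 8 * ray_integral"
proof -
  have le: "(\<Sum>n. ennreal ((test_moment n)\<^sup>2)) \<le> ennreal (8 * (LINT r|lborel. (test_density r)\<^sup>2))"
    unfolding test_moment_def
    by (rule suminf_test_moments[where g = "\<lambda>_. 1" and B = 1, unfolded mult_1_right]) auto
  have "(\<Sum>n. ennreal ((test_moment n)\<^sup>2)) \<noteq> top"
    using le by (rule neq_top_trans[OF ennreal_neq_top])
  then show s: "summable (\<lambda>n. (test_moment n)\<^sup>2)"
    by (rule summable_suminf_not_top[rotated]) simp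
  have "(\<Sum>n. ennreal ((test_moment n)\<^sup>2)) = ennreal (\<Sum>n. (test_moment n)\<^sup>2)"
    by (rule suminf_ennreal2[OF _ s]) simp
  then have "ennreal (\<Sum>n. (test_moment n)\<^sup>2) \<le> ennreal (8 * (LINT r|lborel. (test_density r)\<^sup>2))"
    using le by (simp only:)
  then have "(\<Sum>n. (test_moment n)\<^sup>2) \<le> 8 * (LINT r|lborel. (test_density r)\<^sup>2)"
    by (rule ennreal_le_iff[THEN iffD1, rotated]) simp
  then show "(\<Sum>n. (test_moment n)\<^sup>2) \<le> 8 * ray_integral"
    using integral_test_density_sq by linarith
qed

lemma test_fun_coeff:
  "test_fun \<in> hardy2" "taylor_coeff test_fun = (\<lambda>n. cnj \<omega> ^ n * of_real (test_moment n))"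
  "(\<Sum>n. (norm (taylor_coeff test_fun n))\<^sup>2) \<le> 8 * ray_integral"
proof -
  have n: "(norm (cnj \<omega> ^ n * complex_of_real (test_moment n)))\<^sup>2 = (test_moment n)\<^sup>2" for n
    by (simp add: norm_mult norm_power w)
  have "summable (\<lambda>n. (norm (cnj \<omega> ^ n * complex_of_real (test_moment n)))\<^sup>2)"
    using summable_test_moments(1) by (simp only: n)
  from power_fun_hardy2[OF this] show "test_fun \<in> hardy2"
    "taylor_coeff test_fun = (\<lambda>n. cnj \<omega> ^ n * of_real (test_moment n))"
    by (simp_all only: test_fun_def)
  then show "(\<Sum>n. (norm (taylor_coeff test_fun n))\<^sup>2) \<le> 8 * ray_integral"
    using summable_test_moments(2) by (simp only: n)
qed

text \<open>At the point \<open>\<rho> \<omega>\<close> the phases cancel and the series has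
  nonnegative terms, so it may be summed under the integral sign to the density divided by
  \<open>1 - r \<rho>\<close>.\<close>

lemma test_fun_value: "ray_integral / 2 \<le> norm (test_fun (of_real \<rho> * \<omega>))"
proof -
  let ?z = "complex_of_real \<rho> * \<omega>"
  have z: "norm ?z < 1" using rho w by (simp add: norm_mult)
  have "taylor_coeff test_fun n * ?z ^ n = of_real (test_moment n * \<rho> ^ n)" for n
  proof -
    have "(cnj \<omega> * \<omega>) ^ n = 1" using unimodular_mult_cnj[OF w] by (simp add: mult.commute)
    then have "cnj \<omega> ^ n * \<omega> ^ n = 1" by (simp only: power_mult_distrib)
    then show ?thesis by (simp add: test_fun_coeff(2) power_mult_distrib mult_ac)
  qed
  then have s: "(\<lambda>n. complex_of_real (test_moment n * \<rho> ^ n)) sums test_fun ?z"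
    using hardy2_sums[OF test_fun_coeff(1) z] by simp
  define S where "S = Re (test_fun ?z)"
  have S: "(\<lambda>n. test_moment n * \<rho> ^ n) sums S"
    using sums_Re[OF s] by (simp add: S_def)
  have S0: "0 \<le> S" by (rule sums_le[OF _ sums_zero S]) (simp add: test_moment_nonneg rho)
  have "ennreal (ray_integral / 2) = (\<integral>\<^sup>+r. ennreal (indicator {0..\<rho>} r * (1 / ray_weight \<mu> \<omega> r) / 2) \<partial>lborel)"
  proof -
    have "(LINT r|lborel. indicator {0..\<rho>} r * (1 / ray_weight \<mu> \<omega> r) / 2) = ray_integral / 2"
      unfolding ray_integral_lborel(2)[symmetric] by (rule integral_divide_zero)
    moreover have "(\<integral>\<^sup>+r. ennreal (indicator {0..\<rho>} r * (1 / ray_weight \<mu> \<omega> r) / 2) \<partial>lborel) =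
        ennreal (LINT r|lborel. indicator {0..\<rho>} r * (1 / ray_weight \<mu> \<omega> r) / 2)"
    proof (rule nn_integral_eq_integral[OF integrable_divide[OF ray_integral_lborel(1)]], rule AE_I2)
      fix r show "0 \<le> indicator {0..\<rho>} r * (1 / ray_weight \<mu> \<omega> r) / 2"
        using weight_ge(1)[of r] by (cases "r \<in> {0..\<rho>}") auto
    qed
    ultimately show ?thesis by (simp only:)
  qed
  also have "\<dots> \<le> (\<integral>\<^sup>+r. (\<Sum>n. ennreal (test_density r * r ^ n * \<rho> ^ n)) \<partial>lborel)"
  proof (rule nn_integral_mono)
    fix r
    show "ennreal (indicator {0..\<rho>} r * (1 / ray_weight \<mu> \<omega> r) / 2) \<le> (\<Sum>n. ennreal (test_density r * r ^ n * \<rho> ^ n))"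
    proof (cases "r \<in> {0..\<rho>}")
      case True
      have "r * \<rho> \<le> 1 * \<rho>" using True rho by (intro mult_right_mono) auto
      then have rr: "0 \<le> r * \<rho>" "r * \<rho> < 1" using True rho by auto
      have "(\<lambda>n. test_density r * (r * \<rho>) ^ n) sums (test_density r * (1 / (1 - r * \<rho>)))"
        using rr by (intro sums_mult geometric_sums) auto
      then have "(\<lambda>n. test_density r * r ^ n * \<rho> ^ n) sums (test_density r * (1 / (1 - r * \<rho>)))"
        by (simp add: power_mult_distrib mult.assoc)
      then have "(\<Sum>n. ennreal (test_density r * r ^ n * \<rho> ^ n)) = ennreal (test_density r * (1 / (1 - r * \<rho>)))"
        using True rho by (intro suminf_ennreal_eq) (auto simp: test_density_nonneg)
      moreover have "1 / ray_weight \<mu> \<omega> r / 2 \<le> test_density r * (1 / (1 - r * \<rho>))"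
      proof -
        \<comment> \<open>For \<open>r \<le> \<rho>\<close> the denominator
          \<open>1 - r \<rho>\<close> is comparable to \<open>1 - r\<close>, which cancels the
          factor in the density; this is the origin of the 1/2.\<close>
        have "r * (1 - \<rho>) \<le> 1 * (1 - r)" using True rho by (intro mult_mono) auto
        then have "1 - r * \<rho> \<le> 2 * (1 - r)" by (simp add: algebra_simps)
        then have "1 / 2 \<le> (1 - r) / (1 - r * \<rho>)" using rr by (simp add: field_simps)
        then have "1 / ray_weight \<mu> \<omega> r * (1 / 2) \<le> 1 / ray_weight \<mu> \<omega> r * ((1 - r) / (1 - r * \<rho>))"
          using weight_ge(1)[OF True] by (intro mult_left_mono) auto
        then show ?thesis using True by (simp add: test_density_def)
      qed
      ultimately show ?thesis using True by (simp add: ennreal_leI)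
    qed simp
  qed
  also have "\<dots> = (\<Sum>n. \<integral>\<^sup>+r. ennreal (test_density r * r ^ n * \<rho> ^ n) \<partial>lborel)"
    by (rule nn_integral_suminf) measurable
  also have "\<dots> = (\<Sum>n. ennreal (test_moment n * \<rho> ^ n))"
  proof (rule suminf_cong)
    fix n
    have "(\<integral>\<^sup>+r. ennreal (test_density r * r ^ n * \<rho> ^ n) \<partial>lborel) = ennreal (LINT r|lborel. test_density r * r ^ n * \<rho> ^ n)"
    proof (rule nn_integral_eq_integral)
      show "integrable lborel (\<lambda>r. test_density r * r ^ n * \<rho> ^ n)" by (intro integrable_mult_left integrable_test_moment)
      show "AE r in lborel. 0 \<le> test_density r * r ^ n * \<rho> ^ n"
        using rho by (intro AE_I2 mult_nonneg_nonneg test_density_power_nonneg) auto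
    qed
    then show "(\<integral>\<^sup>+r. ennreal (test_density r * r ^ n * \<rho> ^ n) \<partial>lborel) = ennreal (test_moment n * \<rho> ^ n)"
      by (simp add: test_moment_def)
  qed
  also have "\<dots> = ennreal S"
    using S by (intro suminf_ennreal_eq) (simp_all add: test_moment_nonneg rho)
  finally have "ray_integral / 2 \<le> S" using S0 by simp
  also have "S \<le> norm (test_fun ?z)" unfolding S_def by (rule complex_Re_le_cmod)
  finally show ?thesis .
qed

text \<open>The deviation of the \<open>n\<close>-th partial sum from the boundary value is a tail
  of moments, that is, an integral of tails of geometric series with ratio \<open>r \<eta>\<close>.
  These are at most \<open>2 r\<^sup>n / |1 - r \<eta>|\<close>, so the deviation is bounded by
  twice a moment of the density divided by \<open>|\<xi> - r \<omega>|\<close>. The constant is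
  \<open>2 * pi\<close> times 4 times the 8 of the dual inequality.\<close>

lemma local_dirichlet_test_fun:
  assumes xi: "norm \<xi> = 1"
  shows "local_dirichlet test_fun \<xi> \<le> ennreal (64 * pi) * (\<integral>\<^sup>+r. ennreal ((test_density r)\<^sup>2 / (norm (\<xi> - of_real r * \<omega>))\<^sup>2) \<partial>lborel)"
proof -
  \<comment> \<open>Rotation of the radius to the positive axis;
    \<open>|\<xi> - r \<omega>| = |1 - r \<eta>|\<close>.\<close>
  define \<eta> where "\<eta> = \<xi> * cnj \<omega>"
  have eta: "norm \<eta> = 1" by (simp add: \<eta>_def norm_mult xi w)
  define D where "D r = norm (\<xi> - complex_of_real r * \<omega>)" for r
  have D: "D r = norm (1 - of_real r * \<eta>)" for r
  proof -
    have "\<xi> - of_real r * \<omega> = \<xi> * cnj (1 - of_real r * \<eta>)"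
      using unimodular_mult_cnj[OF xi] by (simp add: \<eta>_def algebra_simps)
    then show ?thesis by (simp add: D_def norm_mult xi del: complex_cnj_diff)
  qed
  have D_ge: "1 - \<rho> \<le> D r" if "r \<in> {0..\<rho>}" for r
    using norm_circle_minus_ray[OF xi w, of r] that by (simp add: D_def)
  have [measurable]: "D \<in> borel_measurable borel"
    unfolding D_def by (intro borel_measurable_continuous_onI continuous_intros)
  have D_inv: "1 / D r \<le> 1 / (1 - \<rho>)" if "r \<in> {0..\<rho>}" for r
    using D_ge[OF that] rho by (intro divide_left_mono mult_pos_pos) auto
  define c where "c n = (LINT r|lborel. test_density r * (1 / D r) * r ^ n)" for n
  have ic: "integrable lborel (\<lambda>r. test_density r * (1 / D r * r ^ n))" for n
  proof -
    have "norm (1 / D r * r ^ n) \<le> (1 / (1 - \<rho>)) * 1" if "r \<in> {0..\<rho>}" for r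
      unfolding norm_mult using that rho D_inv[OF that] by (intro mult_mono) (auto simp: power_le_one D_def)
    from integrable_test_density_mult[OF _ this] show ?thesis by simp
  qed
  have partial: "partial_taylor test_fun n \<xi> = (\<Sum>k\<le>n. of_real (test_moment k) * \<eta> ^ k)" for n
    by (simp add: partial_taylor_def test_fun_coeff(2) \<eta>_def power_mult_distrib mult_ac)
  have moment: "complex_of_real (test_moment k) * \<eta> ^ k = (LINT r|lborel. test_density r *\<^sub>R (of_real r * \<eta>) ^ k)" for k
  proof -
    have "complex_of_real (test_moment k) = (LINT r|lborel. complex_of_real (test_density r * r ^ k))"
      unfolding test_moment_def by (rule integral_complex_of_real[symmetric])
    then have "complex_of_real (test_moment k) * \<eta> ^ k = (LINT r|lborel. complex_of_real (test_density r * r ^ k) * \<eta> ^ k)"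
      by (simp only: integral_mult_left_zero)
    then show ?thesis by (simp add: power_mult_distrib scaleR_conv_of_real mult.assoc)
  qed
  have im: "integrable lborel (\<lambda>r. test_density r *\<^sub>R (complex_of_real r * \<eta>) ^ k)" for k
  proof (rule integrable_test_density_mult)
    show "(\<lambda>r. (complex_of_real r * \<eta>) ^ k) \<in> borel_measurable borel"
      by (intro borel_measurable_continuous_onI continuous_intros)
    show "norm ((complex_of_real r * \<eta>) ^ k) \<le> 1" if "r \<in> {0..\<rho>}" for r
      using that rho by (simp add: norm_power norm_mult eta power_le_one)
  qed
  \<comment> \<open>sums of blocks of the geometric series with ratio \<open>r \<eta>\<close> are at most \<open>2 r\<^sup>n / |1 - r \<eta>|\<close>\<close>
  have block: "norm (partial_taylor test_fun N \<xi> - partial_taylor test_fun n \<xi>) \<le> 2 * c n" if "n \<le> N" for n N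
  proof -
    have "partial_taylor test_fun N \<xi> - partial_taylor test_fun n \<xi> = (\<Sum>k\<in>{Suc n..N}. of_real (test_moment k) * \<eta> ^ k)"
    proof -
      have "{..N} = {..n} \<union> {Suc n..N}" "{..n} \<inter> {Suc n..N} = {}" using that by auto
      then show ?thesis unfolding partial by (simp add: sum.union_disjoint)
    qed
    also have "\<dots> = (LINT r|lborel. (\<Sum>k\<in>{Suc n..N}. test_density r *\<^sub>R (of_real r * \<eta>) ^ k))"
      unfolding moment using im by (intro Bochner_Integration.integral_sum[symmetric])
    also have "norm \<dots> \<le> (LINT r|lborel. 2 * (test_density r * (1 / D r * r ^ n)))"
    proof (rule order_trans[OF integral_norm_bound], rule integral_mono)
      show "integrable lborel (\<lambda>r. norm (\<Sum>k\<in>{Suc n..N}. test_density r *\<^sub>R (complex_of_real r * \<eta>) ^ k))"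
        by (intro integrable_norm Bochner_Integration.integrable_sum im)
      show "integrable lborel (\<lambda>r. 2 * (test_density r * (1 / D r * r ^ n)))"
        by (intro integrable_mult_right ic)
      fix r
      show "norm (\<Sum>k\<in>{Suc n..N}. test_density r *\<^sub>R (complex_of_real r * \<eta>) ^ k) \<le> 2 * (test_density r * (1 / D r * r ^ n))"
      proof (cases "r \<in> {0..\<rho>}")
        case True
        then have r: "0 \<le> r" "r < 1" using rho by auto
        let ?q = "complex_of_real r * \<eta>"
        have q: "norm ?q = r" using r by (simp add: norm_mult eta)
        have D0: "0 < D r" using D_ge[OF True] rho by linarith
        have "(1 - ?q) * (\<Sum>k\<in>{Suc n..N}. ?q ^ k) = ?q ^ Suc n - ?q ^ Suc N"
          using that sum_gp_multiplied[of "Suc n" N ?q] by (cases "Suc n \<le> N") (auto simp: not_less_eq_eq)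
        then have "D r * norm (\<Sum>k\<in>{Suc n..N}. ?q ^ k) = norm (?q ^ Suc n - ?q ^ Suc N)"
          by (metis D norm_mult)
        also have "\<dots> \<le> r ^ Suc n + r ^ Suc N"
          using norm_triangle_ineq4[of "?q ^ Suc n" "?q ^ Suc N"] by (simp only: norm_power q)
        also have "\<dots> \<le> r ^ n + r ^ n"
          using r that by (intro add_mono power_decreasing) auto
        finally have "norm (\<Sum>k\<in>{Suc n..N}. ?q ^ k) \<le> 2 * (1 / D r * r ^ n)"
          using D0 by (simp add: field_simps)
        then have "test_density r * norm (\<Sum>k\<in>{Suc n..N}. ?q ^ k) \<le> test_density r * (2 * (1 / D r * r ^ n))"
          by (rule mult_left_mono[OF _ test_density_nonneg])
        then show ?thesis
          unfolding scaleR_right.sum[symmetric] norm_scaleR using test_density_nonneg[of r] by (simp add: mult_ac)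
      qed (simp add: test_density_def)
    qed
    also have "\<dots> = 2 * c n" unfolding c_def mult.assoc by (rule integral_mult_right_zero)
    finally show ?thesis .
  qed
  have "Cauchy (\<lambda>n. partial_taylor test_fun n \<xi>)"
  proof -
    \<comment> \<open>The density lives on \<open>[0, \<rho>]\<close>, so the moments decay like
      \<open>\<rho> ^ k\<close>. The rate depends on \<open>\<rho>\<close> but is used only for the
      existence of the limit.\<close>
    have "summable (\<lambda>k. complex_of_real (test_moment k) * \<eta> ^ k)"
    proof (rule summable_norm_cancel, rule summable_comparison_test')
      show "summable (\<lambda>k. (LINT r|lborel. test_density r) * \<rho> ^ k)"
        using rho by (intro summable_mult summable_geometric) simp
      fix k
      have "test_moment k \<le> (LINT r|lborel. test_density r * \<rho> ^ k)"
        unfolding test_moment_def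
      proof (rule integral_mono[OF integrable_test_moment])
        show "integrable lborel (\<lambda>r. test_density r * \<rho> ^ k)"
          using integrable_test_moment[of 0] by (intro integrable_mult_left) simp
        fix r show "test_density r * r ^ k \<le> test_density r * \<rho> ^ k"
        proof (cases "r \<in> {0..\<rho>}")
          case True
          then show ?thesis by (intro mult_left_mono power_mono test_density_nonneg) auto
        qed (simp add: test_density_def)
      qed
      then show "norm (norm (complex_of_real (test_moment k) * \<eta> ^ k)) \<le> (LINT r|lborel. test_density r) * \<rho> ^ k"
        by (simp add: norm_mult norm_power eta test_moment_nonneg)
    qed
    then have "convergent (\<lambda>n. \<Sum>k\<le>n. complex_of_real (test_moment k) * \<eta> ^ k)"
      by (simp add: summable_iff_convergent')
    then show ?thesis unfolding partial by (rule convergent_Cauchy)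
  qed
  then obtain L where L: "(\<lambda>n. partial_taylor test_fun n \<xi>) \<longlonglongrightarrow> L"
    using Cauchy_convergent convergent_def by blast
  have Lc: "norm (L - partial_taylor test_fun n \<xi>) \<le> 2 * c n" for n
  proof (rule tendsto_upperbound)
    show "(\<lambda>N. norm (partial_taylor test_fun N \<xi> - partial_taylor test_fun n \<xi>)) \<longlonglongrightarrow> norm (L - partial_taylor test_fun n \<xi>)"
      by (intro tendsto_intros L)
    show "\<forall>\<^sub>F N in sequentially. norm (partial_taylor test_fun N \<xi> - partial_taylor test_fun n \<xi>) \<le> 2 * c n"
      using eventually_ge_at_top[of n] by eventually_elim (rule block)
  qed simp
  have "(\<Sum>n. ennreal ((norm (L - partial_taylor test_fun n \<xi>))\<^sup>2)) \<le> (\<Sum>n. 4 * ennreal ((c n)\<^sup>2))"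
  proof (rule suminf_le)
    fix n
    have "(norm (L - partial_taylor test_fun n \<xi>))\<^sup>2 \<le> (2 * c n)\<^sup>2" using Lc by (intro power_mono) auto
    then have "ennreal ((norm (L - partial_taylor test_fun n \<xi>))\<^sup>2) \<le> ennreal (4 * (c n)\<^sup>2)"
      by (intro ennreal_leI) (simp add: power_mult_distrib)
    then show "ennreal ((norm (L - partial_taylor test_fun n \<xi>))\<^sup>2) \<le> 4 * ennreal ((c n)\<^sup>2)"
      by (simp add: ennreal_mult)
  qed auto
  also have "\<dots> = 4 * (\<Sum>n. ennreal ((c n)\<^sup>2))" by simp
  also have "\<dots> \<le> 4 * ennreal (8 * (LINT r|lborel. (test_density r * (1 / D r))\<^sup>2))"
    unfolding c_def using D_inv
    by (intro mult_left_mono suminf_test_moments[where B = "1 / (1 - \<rho>)"]) (auto simp: D_def)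
  also have "\<dots> = ennreal (32 * (LINT r|lborel. (test_density r * (1 / D r))\<^sup>2))"
    by (simp add: ennreal_mult mult.assoc[symmetric])
  finally have T: "(\<Sum>n. ennreal ((norm (L - partial_taylor test_fun n \<xi>))\<^sup>2)) \<le> ennreal (32 * (LINT r|lborel. (test_density r * (1 / D r))\<^sup>2))" .
  have sm: "summable (\<lambda>n. (norm (L - partial_taylor test_fun n \<xi>))\<^sup>2)"
    by (rule summable_suminf_not_top) (use T in \<open>auto simp: top_unique\<close>)
  have iD: "integrable lborel (\<lambda>r. (test_density r * (1 / D r))\<^sup>2)"
  proof -
    have "norm (test_density r * (1 / D r)\<^sup>2) \<le> (1 / (1 - \<rho>)) * (1 / (1 - \<rho>))\<^sup>2" if "r \<in> {0..\<rho>}" for r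
      unfolding norm_mult using test_density_le[of r] test_density_nonneg[of r] that rho D_inv[OF that]
      by (intro mult_mono) (auto simp: D_def norm_power power_mono intro!: power_mono[of "1 / _"])
    from integrable_test_density_mult[OF _ this] show ?thesis by (simp add: power2_eq_square mult_ac)
  qed
  have "local_dirichlet test_fun \<xi> = ennreal (2 * pi) * (\<Sum>n. ennreal ((norm (L - partial_taylor test_fun n \<xi>))\<^sup>2))"
    by (rule local_dirichlet_summable[OF test_fun_coeff(1) xi sm])
  also have "\<dots> \<le> ennreal (2 * pi) * ennreal (32 * (LINT r|lborel. (test_density r * (1 / D r))\<^sup>2))"
    by (rule mult_left_mono[OF T]) simp
  also have "\<dots> = ennreal (64 * pi) * ennreal (LINT r|lborel. (test_density r * (1 / D r))\<^sup>2)"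
    by (simp flip: ennreal_mult)
  also have "ennreal (LINT r|lborel. (test_density r * (1 / D r))\<^sup>2) = (\<integral>\<^sup>+r. ennreal ((test_density r * (1 / D r))\<^sup>2) \<partial>lborel)"
    by (rule nn_integral_eq_integral[OF iD, symmetric]) simp
  finally show ?thesis by (simp add: D_def power_divide)
qed

text \<open>Integrating \<open>1 / |\<xi> - r \<omega>|\<^sup>2\<close> against \<open>\<mu>\<close>
  gives the Poisson integral over \<open>1 - r\<^sup>2\<close>, and the factor
  \<open>(1 - r)\<^sup>2\<close> in the squared density leaves at most
  \<open>1 / ray_weight\<close>. The constant is \<open>64 * pi\<close> divided by
  \<open>2 * pi\<close>.\<close>

lemma test_fun_dirichlet_integral: "dirichlet_integral \<mu> test_fun \<le> ennreal (32 * ray_integral)"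
proof -
  interpret m: finite_measure \<mu> using mu by (simp add: circle_measure_def)
  interpret pair_sigma_finite lborel \<mu> by unfold_locales
  define N where "N p = (norm (snd p - complex_of_real (fst p) * \<omega>))\<^sup>2" for p
  have [measurable]: "N \<in> borel_measurable (lborel \<Otimes>\<^sub>M \<mu>)"
    unfolding N_def by (rule borel_measurable_ray_kernel[OF mu w])
  have [measurable]: "fst \<in> borel_measurable (lborel \<Otimes>\<^sub>M \<mu>)"
    using measurable_fst[of lborel \<mu>] by simp
  have "(\<lambda>p. ennreal ((test_density (fst p))\<^sup>2 / N p)) \<in> borel_measurable (lborel \<Otimes>\<^sub>M \<mu>)"
    by measurable
  then have Km: "(\<lambda>(r, \<xi>). ennreal ((test_density r)\<^sup>2 / (norm (\<xi> - of_real r * \<omega>))\<^sup>2)) \<in> borel_measurable (lborel \<Otimes>\<^sub>M \<mu>)"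
    by (simp add: N_def case_prod_beta)
  let ?K = "\<lambda>\<xi>. \<integral>\<^sup>+r. ennreal ((test_density r)\<^sup>2 / (norm (\<xi> - of_real r * \<omega>))\<^sup>2) \<partial>lborel"
  have "(\<integral>\<^sup>+\<xi>. local_dirichlet test_fun \<xi> \<partial>\<mu>) \<le> (\<integral>\<^sup>+\<xi>. ennreal (64 * pi) * ?K \<xi> \<partial>\<mu>)"
    by (intro nn_integral_mono local_dirichlet_test_fun) (simp add: space_mu[OF mu])
  also have "\<dots> = ennreal (64 * pi) * (\<integral>\<^sup>+\<xi>. ?K \<xi> \<partial>\<mu>)"
  proof (rule nn_integral_cmult)
    have "(\<lambda>(\<xi>, r). ennreal ((test_density r)\<^sup>2 / (norm (\<xi> - of_real r * \<omega>))\<^sup>2)) \<in> borel_measurable (\<mu> \<Otimes>\<^sub>M lborel)"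
      using measurable_pair_swap[OF Km] by (simp add: case_prod_beta)
    from lborel.borel_measurable_nn_integral_fst[OF this] show "?K \<in> borel_measurable \<mu>" by simp
  qed
  also have "(\<integral>\<^sup>+\<xi>. ?K \<xi> \<partial>\<mu>) = (\<integral>\<^sup>+r. \<integral>\<^sup>+\<xi>. ennreal ((test_density r)\<^sup>2 / (norm (\<xi> - of_real r * \<omega>))\<^sup>2) \<partial>\<mu> \<partial>lborel)"
    by (rule Fubini'[OF Km])
  also have "\<dots> \<le> (\<integral>\<^sup>+r. ennreal (indicator {0..\<rho>} r * (1 / ray_weight \<mu> \<omega> r)) \<partial>lborel)"
  proof (rule nn_integral_mono)
    fix r
    show "(\<integral>\<^sup>+\<xi>. ennreal ((test_density r)\<^sup>2 / (norm (\<xi> - of_real r * \<omega>))\<^sup>2) \<partial>\<mu>) \<le> ennreal (indicator {0..\<rho>} r * (1 / ray_weight \<mu> \<omega> r))"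
    proof (cases "r \<in> {0..\<rho>}")
      case True
      then have r: "0 \<le> r" "r < 1" using rho by auto
      have r2: "1 - r \<le> 1 - r\<^sup>2" using r by (simp add: power2_eq_square mult_left_le)
      then have r2': "0 < 1 - r\<^sup>2" using r by linarith
      let ?P = "poisson \<mu> (of_real r * \<omega>)" and ?W = "ray_weight \<mu> \<omega> r"
      have P0: "0 \<le> ?P" by (rule weight_ge(4)[OF True])
      have "(\<integral>\<^sup>+\<xi>. ennreal ((test_density r)\<^sup>2 / (norm (\<xi> - of_real r * \<omega>))\<^sup>2) \<partial>\<mu>)
          = (\<integral>\<^sup>+\<xi>. ennreal ((test_density r)\<^sup>2 / (1 - r\<^sup>2) * ((1 - r\<^sup>2) / (norm (\<xi> - of_real r * \<omega>))\<^sup>2)) \<partial>\<mu>)"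
        using r2' by (intro nn_integral_cong) simp
      also have "\<dots> = ennreal (LINT \<xi>|\<mu>. (test_density r)\<^sup>2 / (1 - r\<^sup>2) * ((1 - r\<^sup>2) / (norm (\<xi> - of_real r * \<omega>))\<^sup>2))"
        using r2' by (intro nn_integral_eq_integral integrable_mult_right poisson_ray_kernel(1)[OF mu w r] AE_I2) simp
      also have "(LINT \<xi>|\<mu>. (test_density r)\<^sup>2 / (1 - r\<^sup>2) * ((1 - r\<^sup>2) / (norm (\<xi> - of_real r * \<omega>))\<^sup>2)) = (test_density r)\<^sup>2 / (1 - r\<^sup>2) * ?P"
        unfolding poisson_ray[OF mu w] by (rule integral_mult_right_zero)
      also have "(test_density r)\<^sup>2 / (1 - r\<^sup>2) * ?P \<le> 1 / ?W"
      proof -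
        \<comment> \<open>This step uses the Poisson summand of the weight: \<open>(1 - r) P\<close>
          is dominated by one of the two factors \<open>?W\<close> in the denominator.\<close>
        have "(test_density r)\<^sup>2 / (1 - r\<^sup>2) * ?P \<le> (test_density r)\<^sup>2 / (1 - r) * ?P"
          using r r2 r2' P0 by (intro mult_right_mono divide_left_mono mult_pos_pos) auto
        also have "\<dots> = ((1 - r) * ?P) / ?W\<^sup>2"
          using True r by (simp add: test_density_def power2_eq_square)
        also have "\<dots> \<le> ?W / ?W\<^sup>2" using weight_ge[OF True] by (intro divide_right_mono) auto
        also have "\<dots> = 1 / ?W" using weight_ge(1)[OF True] by (simp add: power2_eq_square)
        finally show ?thesis .
      qed
      finally show ?thesis using True by (simp add: ennreal_leI)
    qed (simp add: test_density_def)
  qed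
  also have "\<dots> = ennreal ray_integral"
  proof (subst nn_integral_eq_integral[OF ray_integral_lborel(1)])
    show "AE r in lborel. 0 \<le> indicator {0..\<rho>} r * (1 / ray_weight \<mu> \<omega> r)"
    proof (rule AE_I2)
      fix r show "0 \<le> indicator {0..\<rho>} r * (1 / ray_weight \<mu> \<omega> r)"
        using weight_ge(1)[of r] by (cases "r \<in> {0..\<rho>}") auto
    qed
  qed (simp only: ray_integral_lborel(2))
  finally have "(\<integral>\<^sup>+\<xi>. local_dirichlet test_fun \<xi> \<partial>\<mu>) \<le> ennreal (64 * pi) * ennreal ray_integral"
    by (simp add: mult_left_mono)
  then have "dirichlet_integral \<mu> test_fun \<le> ennreal (1 / (2*pi)) * (ennreal (64 * pi) * ennreal ray_integral)"
    unfolding dirichlet_integral_def by (rule mult_left_mono) simp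
  also have "\<dots> = ennreal (32 * ray_integral)"
    using ray_integral_lborel(3) by (simp flip: ennreal_mult)
  finally show ?thesis .
qed

lemma test_fun_dirichlet_space: "test_fun \<in> dirichlet_space \<mu>"
  using test_fun_dirichlet_integral test_fun_coeff(1) by (auto simp: dirichlet_space_def intro: le_less_trans)

lemma test_fun_normsq: "dirichlet_normsq \<mu> test_fun \<le> 40 * ray_integral"
proof -
  have "enn2real (dirichlet_integral \<mu> test_fun) \<le> 32 * ray_integral"
    using test_fun_dirichlet_integral ray_integral_lborel(3) by (intro enn2real_leI) auto
  then show ?thesis using test_fun_coeff(3) by (simp add: dirichlet_normsq_def)
qed

text \<open>The constant function 1 gives \<open>1 \<le> Re \<kappa>\<close> and thus the summand 1
  of the lower bound; the test function gives the integral. Adding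
  \<open>1 \<le> Re \<kappa>\<close> and \<open>ray_integral \<le> 160 * Re \<kappa>\<close> yields
  161.\<close>

lemma dirichlet_kernel_bounds:
  defines "\<kappa> \<equiv> dirichlet_kernel \<mu> (of_real \<rho> * \<omega>) (of_real \<rho> * \<omega>)"
  shows "\<kappa> \<in> \<real>" "1 / 161 * (1 + ray_integral) \<le> Re \<kappa>" "Re \<kappa> \<le> (2 + 64 * pi)\<^sup>2 * (1 + ray_integral)"
proof -
  have z: "norm (complex_of_real \<rho> * \<omega>) < 1" using rho w by (simp add: norm_mult)
  note k = dirichlet_kernel_characterization[OF mu z, folded \<kappa>_def]
  show "\<kappa> \<in> \<real>" by (rule k(1))
  show "Re \<kappa> \<le> (2 + 64 * pi)\<^sup>2 * (1 + ray_integral)"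
    by (rule k(3)) (rule dirichlet_upper_bound[OF mu w _ rho])
  have k1: "1 \<le> Re \<kappa>"
    using k(2)[OF one_dirichlet_space[OF mu]] by (simp add: dirichlet_normsq_one[OF mu])
  have "ray_integral \<le> 160 * Re \<kappa>"
  proof (cases "ray_integral = 0")
    case True
    then show ?thesis using k1 by simp
  next
    case False
    then have I: "0 < ray_integral" using ray_integral_lborel(3) by simp
    have "(ray_integral / 2)\<^sup>2 \<le> (norm (test_fun (of_real \<rho> * \<omega>)))\<^sup>2"
      using I by (intro power_mono test_fun_value) auto
    also have "\<dots> \<le> Re \<kappa> * dirichlet_normsq \<mu> test_fun"
      by (rule k(2)[OF test_fun_dirichlet_space])
    also have "\<dots> \<le> Re \<kappa> * (40 * ray_integral)"
      using k1 by (intro mult_left_mono test_fun_normsq) auto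
    \<comment> \<open>The 160 is 4, from the square of the 1/2 in \<open>test_fun_value\<close>,
      times the 40 of \<open>test_fun_normsq\<close>.\<close>
    finally have "ray_integral * ray_integral \<le> ray_integral * (160 * Re \<kappa>)"
      by (simp add: power2_eq_square algebra_simps)
    then show ?thesis using I by (rule mult_left_le_imp_le)
  qed
  then show "1 / 161 * (1 + ray_integral) \<le> Re \<kappa>" using k1 by simp
qed

end

theorem theorem1:
  "\<exists>c C :: real. 0 < c \<and> c \<le> C \<and>
     (\<forall>\<mu> :: complex measure. circle_measure \<mu> \<longrightarrow>
       (\<forall>z \<in> ball (0 :: complex) 1.
          let I = integral {0..norm z}
                (\<lambda>r. 1 / ((1 - r) * poisson \<mu> (complex_of_real r * z / complex_of_real (norm z))
                          + (1 - r)\<^sup>2))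
          in dirichlet_kernel \<mu> z z \<in> \<real> \<and>
             c * (1 + I) \<le> Re (dirichlet_kernel \<mu> z z) \<and>
             Re (dirichlet_kernel \<mu> z z) \<le> C * (1 + I)))"
proof (intro exI conjI allI impI ballI)
  show "(1 / 161 :: real) \<le> (2 + 64 * pi)\<^sup>2"
  proof -
    have "(1 :: real)\<^sup>2 \<le> (2 + 64 * pi)\<^sup>2" by (intro power_mono) auto
    then show ?thesis by (rule order_trans[rotated]) simp
  qed
  fix \<mu> :: "complex measure" and z :: complex
  assume mu: "circle_measure \<mu>" and "z \<in> ball 0 1"
  then have z: "norm z < 1" by simp
  \<comment> \<open>At \<open>z = 0\<close> any direction serves: the interval of integration is
    degenerate and both integrals are 0.\<close>
  define \<omega> where "\<omega> = (if z = 0 then 1 else z / of_real (norm z))"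
  have w: "norm \<omega> = 1" by (simp add: \<omega>_def norm_divide)
  have zw: "of_real (norm z) * \<omega> = z" by (simp add: \<omega>_def)
  have I: "integral {0..norm z} (\<lambda>r. 1 / ((1 - r) * poisson \<mu> (complex_of_real r * z / complex_of_real (norm z)) + (1 - r)\<^sup>2))
      = integral {0..norm z} (\<lambda>r. 1 / ray_weight \<mu> \<omega> r)"
  proof (cases "z = 0")
    case False
    then show ?thesis by (simp add: ray_weight_def \<omega>_def)
  qed simp
  show "let I = integral {0..norm z}
                (\<lambda>r. 1 / ((1 - r) * poisson \<mu> (complex_of_real r * z / complex_of_real (norm z))
                          + (1 - r)\<^sup>2))
          in dirichlet_kernel \<mu> z z \<in> \<real> \<and>
             1 / 161 * (1 + I) \<le> Re (dirichlet_kernel \<mu> z z) \<and>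
             Re (dirichlet_kernel \<mu> z z) \<le> (2 + 64 * pi)\<^sup>2 * (1 + I)"
    unfolding Let_def I
    using dirichlet_kernel_bounds[OF mu w norm_ge_zero z] unfolding zw by blast
qed simp

end
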